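(* Let $(\ell_i)_{i=1,\dots,N}\in(0,+\infty)^N$ be such that $\#\{i:\ \ell_i\in\mathcal N\}\le1$. Then there exist $C>0$ and $\mu>0$ such that for all $\underline u^0\in\mathbb L^2(\mathcal T)$ the (mild) solution $\underline u$ of $$\begin{cases}(\partial_tu_j+\partial_xu_j+\partial_x^3u_j)(t,x)=0,& x\in(0,\ell_j),\ t>0,\ j=1,\dots,N,\\ u_j(t,0)=u_k(t,0),& j,k=1,\dots,N,\ t>0,\\ \sum_{j=1}^N\partial_x^2u_j(t,0)=-\alpha u_1(t,0),& t>0,\\ u_j(t,\ell_j)=\partial_xu_j(t,\ell_j)=0,& t>0,\ j=1,\dots,N,\\ u_j(0,x)=u_j^0(x),& x\in(0,\ell_j),\ j=1,\dots,N,\end{cases}$$ satisfies, for all $t\ge0$, $$\|\underline u(t,\cdot)\|_{\mathbb L^2(\mathcal T)}\le C\,\|\underline u^0\|_{\mathbb L^2(\mathcal T)}\,e^{-\mu t}.$$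
   Context: $N\ge1$ is an integer and $\alpha>\frac N2$ is fixed. The set of critical lengths is $\mathcal N=\Big\{2\pi\sqrt{\tfrac{k^2+l^2+kl}{3}}:\ k,l\in\mathbb N^*\Big\}$, with $\mathbb N^*=\{1,2,\dots\}$. The star-shaped network $\mathcal T$ consists of $N$ edges, the $j$-th one identified with $[0,\ell_j]$, all joined at the central node $x=0$. Functions are complex-valued. $\mathbb L^2(\mathcal T)=\prod_{j=1}^NL^2(0,\ell_j)$ with its Hilbert norm. $\mathbb H^2_e(\mathcal T)$ is the set of $\underline u\in\prod_jH^2(0,\ell_j)$ with $u_j(\ell_j)=u_j'(\ell_j)=0$ for all $j$ and $u_j(0)=u_k(0)$ for all $j,k$. The mild solution is $\underline u(t)=e^{t\mathcal A}\underline u^0$, where $e^{t\mathcal A}$ is the strongly continuous contraction semigroup on $\mathbb L^2(\mathcal T)$ generated by $\mathcal A\underline u=(-u_j'-u_j''')_j$ with domain $\{\underline u\in\mathbb H^2_e(\mathcal T)\cap\prod_jH^3(0,\ell_j):\sum_ju_j''(0)=-\alpha u_1(0)\}$. *)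

theory Defs
  imports "HOL-Analysis.Analysis"
begin

definition critical_lengths :: "real set" where
  "critical_lengths =
     {2 * pi * sqrt (real (k\<^sup>2 + l\<^sup>2 + k * l) / 3) | k l :: nat. 1 \<le> k \<and> 1 \<le> l}"

section \<open>Lebesgue and Sobolev spaces on an interval\<close>

text \<open>
  Elements of \<open>L\<^sup>2(0,a)\<close> are represented by functions on the line, of which only the values in
  \<open>(0,a)\<close> matter; two representatives are identified when they agree almost everywhere there.
\<close>

abbreviation interval_measure :: "real \<Rightarrow> real measure" where
  "interval_measure a \<equiv> lebesgue_on {0<..<a}"

definition L2 :: "real \<Rightarrow> (real \<Rightarrow> complex) set" where
  "L2 a = {f \<in> borel_measurable (interval_measure a).
             integrable (interval_measure a) (\<lambda>x. (cmod (f x))\<^sup>2)}"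

definition test_functions :: "real \<Rightarrow> (real \<Rightarrow> complex) set" where
  "test_functions a =
     {\<phi>. \<phi> C1_differentiable_on UNIV \<and> closure {x. \<phi> x \<noteq> 0} \<subseteq> {0<..<a}}"

definition is_weak_deriv :: "real \<Rightarrow> (real \<Rightarrow> complex) \<Rightarrow> (real \<Rightarrow> complex) \<Rightarrow> bool" where
  "is_weak_deriv a f g \<longleftrightarrow>
     (\<forall>\<phi>\<in>test_functions a.
        (\<integral>x. f x * vector_derivative \<phi> (at x) \<partial>interval_measure a)
          = - (\<integral>x. g x * \<phi> x \<partial>interval_measure a))"

text \<open>\<open>sobolev m a\<close> is the complex space \<open>H\<^sup>m(0,a)\<close>.\<close>

primrec sobolev :: "nat \<Rightarrow> real \<Rightarrow> (real \<Rightarrow> complex) set" where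
  "sobolev 0 a = L2 a"
| "sobolev (Suc m) a = {f \<in> L2 a. \<exists>g\<in>sobolev m a. is_weak_deriv a f g}"

text \<open>The weak derivative of an \<open>H\<^sup>1\<close> function; it is determined almost everywhere.\<close>

definition weak_deriv :: "real \<Rightarrow> (real \<Rightarrow> complex) \<Rightarrow> real \<Rightarrow> complex" where
  "weak_deriv a f = (SOME g. g \<in> L2 a \<and> is_weak_deriv a f g)"

text \<open>
  The pointwise value at \<open>x \<in> [0,a]\<close> of an \<open>H\<^sup>1\<close> function, read off from its representative that
  is continuous on the closed interval.
\<close>

definition point_value :: "real \<Rightarrow> (real \<Rightarrow> complex) \<Rightarrow> real \<Rightarrow> complex" where
  "point_value a f x =
     (THE c. \<exists>h. continuous_on {0..a} h \<and> (AE y in interval_measure a. h y = f y) \<and> c = h x)"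

section \<open>The star-shaped network\<close>

text \<open>
  The edges are numbered \<open>1,\<dots>,N\<close>, the \<open>j\<close>-th one having length \<open>L j\<close>. A function on the network
  is a family \<open>u\<close> with components \<open>u j\<close>; components with \<open>j\<close> outside \<open>{1..N}\<close> are irrelevant.
\<close>

type_synonym netfun = "nat \<Rightarrow> real \<Rightarrow> complex"

definition L2_net :: "nat \<Rightarrow> (nat \<Rightarrow> real) \<Rightarrow> netfun set" where
  "L2_net N L = {u. \<forall>j\<in>{1..N}. u j \<in> L2 (L j)}"

definition norm_net :: "nat \<Rightarrow> (nat \<Rightarrow> real) \<Rightarrow> netfun \<Rightarrow> real" where
  "norm_net N L u = sqrt (\<Sum>j = 1..N. \<integral>x. (cmod (u j x))\<^sup>2 \<partial>interval_measure (L j))"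

definition eq_net :: "nat \<Rightarrow> (nat \<Rightarrow> real) \<Rightarrow> netfun \<Rightarrow> netfun \<Rightarrow> bool" where
  "eq_net N L u v \<longleftrightarrow> (\<forall>j\<in>{1..N}. AE x in interval_measure (L j). u j x = v j x)"

definition H2e_net :: "nat \<Rightarrow> (nat \<Rightarrow> real) \<Rightarrow> netfun set" where
  "H2e_net N L =
     {u. (\<forall>j\<in>{1..N}. u j \<in> sobolev 2 (L j) \<and>
            point_value (L j) (u j) (L j) = 0 \<and>
            point_value (L j) (weak_deriv (L j) (u j)) (L j) = 0) \<and>
         (\<forall>j\<in>{1..N}. \<forall>k\<in>{1..N}. point_value (L j) (u j) 0 = point_value (L k) (u k) 0)}"

definition dom_A :: "nat \<Rightarrow> real \<Rightarrow> (nat \<Rightarrow> real) \<Rightarrow> netfun set" where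
  "dom_A N \<alpha> L =
     {u \<in> H2e_net N L. (\<forall>j\<in>{1..N}. u j \<in> sobolev 3 (L j)) \<and>
        (\<Sum>j = 1..N. point_value (L j) ((weak_deriv (L j) ^^ 2) (u j)) 0)
          = - complex_of_real \<alpha> * point_value (L 1) (u 1) 0}"

definition op_A :: "(nat \<Rightarrow> real) \<Rightarrow> netfun \<Rightarrow> netfun" where
  "op_A L u =
     (\<lambda>j x. - weak_deriv (L j) (u j) x - (weak_deriv (L j) ^^ 3) (u j) x)"

section \<open>Contraction semigroups on the network space\<close>

text \<open>
  A semigroup acts on representatives. All identities are required up to \<open>eq_net\<close>; linearity and
  contractivity make every \<open>S t\<close> compatible with that equivalence.
\<close>

definition C0_contraction_semigroup ::
    "nat \<Rightarrow> (nat \<Rightarrow> real) \<Rightarrow> (real \<Rightarrow> netfun \<Rightarrow> netfun) \<Rightarrow> bool" where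
  "C0_contraction_semigroup N L S \<longleftrightarrow>
     (\<forall>t\<ge>0. \<forall>u\<in>L2_net N L. S t u \<in> L2_net N L \<and> norm_net N L (S t u) \<le> norm_net N L u) \<and>
     (\<forall>t\<ge>0. \<forall>u\<in>L2_net N L. \<forall>v\<in>L2_net N L. \<forall>a b :: complex.
        eq_net N L (S t (\<lambda>j x. a * u j x + b * v j x)) (\<lambda>j x. a * S t u j x + b * S t v j x)) \<and>
     (\<forall>u\<in>L2_net N L. eq_net N L (S 0 u) u) \<and>
     (\<forall>s\<ge>0. \<forall>t\<ge>0. \<forall>u\<in>L2_net N L. eq_net N L (S (s + t) u) (S s (S t u))) \<and>
     (\<forall>u\<in>L2_net N L. ((\<lambda>t. norm_net N L (\<lambda>j x. S t u j x - u j x)) \<longlongrightarrow> 0) (at_right 0))"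

definition infinitesimal_generator ::
    "nat \<Rightarrow> (nat \<Rightarrow> real) \<Rightarrow> (real \<Rightarrow> netfun \<Rightarrow> netfun) \<Rightarrow> netfun \<Rightarrow> netfun \<Rightarrow> bool" where
  "infinitesimal_generator N L S u v \<longleftrightarrow>
     u \<in> L2_net N L \<and> v \<in> L2_net N L \<and>
     ((\<lambda>h. norm_net N L (\<lambda>j x. (S h u j x - u j x) / complex_of_real h - v j x)) \<longlongrightarrow> 0)
       (at_right 0)"

text \<open>
  \<open>S\<close> is the semigroup \<open>exp (t A)\<close>: it is a strongly continuous contraction semigroup and its
  generator (as a graph, with the maximal domain on which the defining limit exists) is exactly
  the graph of \<open>A\<close> on \<open>dom_A\<close>. These requirements determine \<open>S\<close> uniquely up to \<open>eq_net\<close>.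
\<close>

definition is_exp_A ::
    "nat \<Rightarrow> real \<Rightarrow> (nat \<Rightarrow> real) \<Rightarrow> (real \<Rightarrow> netfun \<Rightarrow> netfun) \<Rightarrow> bool" where
  "is_exp_A N \<alpha> L S \<longleftrightarrow>
     C0_contraction_semigroup N L S \<and>
     (\<forall>u\<in>L2_net N L. \<forall>v\<in>L2_net N L.
        infinitesimal_generator N L S u v \<longleftrightarrow> u \<in> dom_A N \<alpha> L \<and> eq_net N L v (op_A L u))"

end

theory Submission
  imports Defs "HOL-Complex_Analysis.Great_Picard" "HOL-Computational_Algebra.Fundamental_Theorem_Algebra"
    "HOL-Real_Asymp.Real_Asymp"
begin

text \<open>The energy \<open>E = \<parallel>u\<parallel>\<^sup>2\<close> dissipates only through the traces at the centre: on the domain of the generator its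
derivative is \<open>- (2 \<alpha> - N) \<bar>u(0)\<bar>\<^sup>2 - \<Sum>\<^sub>j \<bar>u\<^sub>j'(0)\<bar>\<^sup>2\<close>. The classical proof of exponential decay deduces an
observability inequality for these traces from compactness and unique continuation. Here the
same two ingredients are used directly on the semigroup.

Compactness. With the weight \<open>\<kappa> + x\<close> in place of \<open>1\<close> the energy balance (\<open>network_energy\<close>)
acquires the term \<open>- 3 \<Sum>\<^sub>j \<parallel>u\<^sub>j'\<parallel>\<^sup>2\<close>, and for large \<open>\<kappa>\<close> every boundary term has the good sign. Hence an
orbit of bounded norm has bounded \<open>H\<^sup>1\<close> norm at some instant of \<open>[0,1]\<close> (\<open>smoothing\<close>). Since
bounded sets of \<open>H\<^sup>1\<close> are precompact (\<open>slope_energy_compact\<close>) and the domain is dense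
(\<open>dom_A_dense\<close>), \<open>S 1\<close> is a compact map (\<open>S1_compactI\<close>).

Alternative. A contraction semigroup with compact \<open>S 1\<close> either decays exponentially or has a common unit
eigenvector with unimodular eigenvalues (\<open>decay_or_eigenvector\<close>). Indeed, if no \<open>S n\<close> is a strict
contraction, compactness produces a unit vector whose norm never decreases. The vectors of this kind form
an invariant subspace on which all \<open>S t\<close> preserve inner products and whose unit ball is compact up to \<open>S 1\<close>.
There, maximizing \<open>Re \<langle>S h w, w\<rangle>\<close> yields an eigenvector of \<open>S h\<close>, and a limit \<open>h \<rightarrow> 0\<close> yields an eigenvector
of all \<open>S t\<close> at once; it satisfies \<open>A y = \<lambda> y\<close> with \<open>\<lambda>\<close> imaginary.

Unique continuation. An imaginary eigenvalue leaves no dissipation, so every component of the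
eigenvector satisfies \<open>\<lambda> u + u' + u''' = 0\<close> with \<open>u\<close> and \<open>u'\<close> vanishing at both ends. For a root \<open>z\<close> of
\<open>z\<^sup>3 + z + \<lambda>\<close> the function \<open>e\<^sup>-\<^sup>z\<^sup>x (u'' + z u' + (z\<^sup>2 + 1) u)\<close> is constant, so \<open>u''(0) = e\<^sup>-\<^sup>z\<^sup>l u''(l)\<close> for all
three roots. If \<open>u''(0) \<noteq> 0\<close>, the differences of the roots are multiples of \<open>2 \<pi> \<i> / l\<close>, which forces \<open>l\<close> to be
critical (\<open>noncritical_trace_zero\<close>). At most one component can therefore have \<open>u''(0) \<noteq> 0\<close>, and the condition
\<open>\<Sum>\<^sub>j u\<^sub>j''(0) = - \<alpha> u(0) = 0\<close> excludes that one as well. So the eigenvector is zero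
(\<open>no_imaginary_eigenvector\<close>), and decay is the only remaining alternative.

All orbits are differentiated from the right only, for initial data in the domain of the generator; the real-variable
lemma \<open>right_derivative_decrease\<close> takes the place of integrating in time.\<close>

section \<open>Spaces with a semi-inner product\<close>

text \<open>Vectors are representatives of equivalence classes, so the form may be degenerate. The single operation
\<open>lc\<close>, forming linear combinations, enters only through the values of \<open>ip\<close>: two vectors count as equal when they have the
same inner products with all vectors.\<close>

locale semi_inner_space =
  fixes X :: "'v set"
    and lc :: "complex \<Rightarrow> 'v \<Rightarrow> complex \<Rightarrow> 'v \<Rightarrow> 'v"
    and ip :: "'v \<Rightarrow> 'v \<Rightarrow> complex"
  assumes lc_mem [simp, intro]: "u \<in> X \<Longrightarrow> v \<in> X \<Longrightarrow> lc a u b v \<in> X"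
    and ip_lc_left [simp]: "u \<in> X \<Longrightarrow> v \<in> X \<Longrightarrow> w \<in> X \<Longrightarrow> ip (lc a u b v) w = a * ip u w + b * ip v w"
    and ip_cnj: "u \<in> X \<Longrightarrow> v \<in> X \<Longrightarrow> ip v u = cnj (ip u v)"
    and ip_self_nonneg: "u \<in> X \<Longrightarrow> 0 \<le> Re (ip u u)"
begin

definition nm :: "'v \<Rightarrow> real" where
  "nm u = sqrt (Re (ip u u))"

abbreviation df :: "'v \<Rightarrow> 'v \<Rightarrow> 'v" where
  "df u v \<equiv> lc 1 u (-1) v"

definition tends :: "(nat \<Rightarrow> 'v) \<Rightarrow> 'v \<Rightarrow> bool" where
  "tends f y \<longleftrightarrow> (\<lambda>n. nm (df (f n) y)) \<longlonglongrightarrow> 0"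

lemma ip_lc_right [simp]:
  assumes "u \<in> X" "v \<in> X" "w \<in> X"
  shows "ip w (lc a u b v) = cnj a * ip w u + cnj b * ip w v"
proof -
  have "ip w (lc a u b v) = cnj (ip (lc a u b v) w)"
    using assms by (intro ip_cnj) auto
  then show ?thesis
    using assms by (simp add: ip_cnj[of u w] ip_cnj[of v w])
qed

lemma Im_ip_self [simp]: "u \<in> X \<Longrightarrow> Im (ip u u) = 0"
  using ip_cnj[of u u] by (metis complex_cnj cnj.simps(2) add.inverse_inverse neg_equal_0_iff_equal complex.sel(2) equation_minus_iff neg_equal_zero)

lemma nm_nonneg [simp]: "u \<in> X \<Longrightarrow> 0 \<le> nm u"
  by (simp add: nm_def ip_self_nonneg)

lemma nm_power2: "u \<in> X \<Longrightarrow> (nm u)\<^sup>2 = Re (ip u u)"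
  by (simp add: nm_def ip_self_nonneg)

lemma ip_self: "u \<in> X \<Longrightarrow> ip u u = of_real ((nm u)\<^sup>2)"
  by (simp add: nm_power2 complex_eq_iff)

lemma nm_lc_power2:
  assumes "u \<in> X" "v \<in> X"
  shows "(nm (lc a u b v))\<^sup>2
    = (cmod a)\<^sup>2 * (nm u)\<^sup>2 + (cmod b)\<^sup>2 * (nm v)\<^sup>2 + 2 * Re (a * cnj b * ip u v)"
proof -
  have "of_real ((nm (lc a u b v))\<^sup>2) = ip (lc a u b v) (lc a u b v)"
    using assms by (intro ip_self[symmetric]) auto
  also have "\<dots> = a * cnj a * ip u u + b * cnj b * ip v v
      + (a * cnj b * ip u v + cnj (a * cnj b * ip u v))"
    using assms by (simp add: algebra_simps ip_cnj[of u v])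
  also have "\<dots> = of_real ((cmod a)\<^sup>2 * (nm u)\<^sup>2 + (cmod b)\<^sup>2 * (nm v)\<^sup>2
      + 2 * Re (a * cnj b * ip u v))"
    using assms unfolding complex_add_cnj complex_mult_cnj ip_self[OF assms(1)] ip_self[OF assms(2)]
    by (simp add: cmod_power2)
  finally show ?thesis
    using of_real_eq_iff by blast
qed

lemma Cauchy_Schwarz:
  assumes u: "u \<in> X" and v: "v \<in> X"
  shows "cmod (ip u v) \<le> nm u * nm v"
proof -
  define c where "c = ip u v"
  have pos: "0 \<le> (cmod a)\<^sup>2 * (nm u)\<^sup>2 + (cmod b)\<^sup>2 * (nm v)\<^sup>2 + 2 * Re (a * cnj b * c)" for a b
    unfolding c_def nm_lc_power2[OF u v, symmetric] by simp
  have "(cmod c)\<^sup>2 \<le> (nm u * nm v)\<^sup>2"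
  proof (cases "nm v = 0")
    case True
    \<comment> \<open>a null vector: letting the coefficient of \<open>u\<close> go to \<open>0\<close> leaves only the linear term\<close>
    have "c = 0"
    proof (rule ccontr)
      assume "c \<noteq> 0"
      define r where "r = 1 / ((nm u)\<^sup>2 + 1)"
      have r: "0 < r" "r * (nm u)\<^sup>2 < 1"
        by (auto simp: r_def field_simps sum_power2_gt_zero_iff add_pos_nonneg add_nonneg_pos)
      have "0 \<le> (cmod (- of_real r * cnj c))\<^sup>2 * (nm u)\<^sup>2 + 2 * Re (- of_real r * cnj c * c)"
        using pos[of "- of_real r * cnj c" 1] True by simp
      also have "\<dots> = r * (cmod c)\<^sup>2 * (r * (nm u)\<^sup>2 - 2)"
      proof -
        have "cnj c * c = of_real ((cmod c)\<^sup>2)"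
          by (metis complex_norm_square mult.commute)
        then have "Re (- of_real r * cnj c * c) = - r * (cmod c)\<^sup>2"
          by (simp only: mult.assoc mult_minus_left uminus_complex.sel flip: of_real_mult) simp
        then show ?thesis
          using r(1) by (simp only: norm_mult norm_minus_cancel complex_mod_cnj norm_of_real) (simp add: algebra_simps power2_eq_square)
      qed
      finally show False
        using mult_pos_neg[of "r * (cmod c)\<^sup>2" "r * (nm u)\<^sup>2 - 2"] r \<open>c \<noteq> 0\<close>
        by (simp add: mult_pos_pos)
    qed
    then show ?thesis
      by simp
  next
    case False
    define n2 where "n2 = (nm v)\<^sup>2"
    have n2: "n2 > 0"
      using False by (simp add: n2_def)
    have "cnj (- c) * c = - of_real ((cmod c)\<^sup>2)"
      by (simp add: complex_norm_square mult.commute del: of_real_power)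
    then have "Re (of_real n2 * cnj (- c) * c) = - n2 * (cmod c)\<^sup>2"
      by (simp only: mult.assoc) simp
    then have "0 \<le> n2\<^sup>2 * (nm u)\<^sup>2 + (cmod c)\<^sup>2 * n2 + 2 * (- n2 * (cmod c)\<^sup>2)"
      using pos[of "of_real n2" "- c"] by (simp only: norm_of_real power2_abs norm_minus_cancel n2_def)
    also have "\<dots> = n2 * (n2 * (nm u)\<^sup>2 - (cmod c)\<^sup>2)"
      by (simp add: algebra_simps power2_eq_square)
    finally have "(cmod c)\<^sup>2 \<le> n2 * (nm u)\<^sup>2"
      using n2 by (simp add: zero_le_mult_iff)
    then show ?thesis
      by (simp add: n2_def power_mult_distrib mult.commute)
  qed
  then show ?thesis
    using u v by (simp add: c_def)
qed

lemma ip_null: "u \<in> X \<Longrightarrow> v \<in> X \<Longrightarrow> nm u = 0 \<Longrightarrow> ip u v = 0"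
  using Cauchy_Schwarz[of u v] by simp

lemma nm_lc_le:
  assumes "u \<in> X" "v \<in> X"
  shows "nm (lc a u b v) \<le> cmod a * nm u + cmod b * nm v"
proof -
  have "Re (a * cnj b * ip u v) \<le> cmod a * cmod b * (nm u * nm v)"
    using complex_Re_le_cmod[of "a * cnj b * ip u v"] Cauchy_Schwarz[OF assms]
    by (smt (verit, best) mult_left_mono norm_mult complex_mod_cnj mult_nonneg_nonneg norm_ge_zero)
  then have "(nm (lc a u b v))\<^sup>2 \<le> (cmod a * nm u + cmod b * nm v)\<^sup>2"
    unfolding nm_lc_power2[OF assms] by (simp add: power2_sum power_mult_distrib algebra_simps)
  then show ?thesis
    using assms by (simp add: power2_le_iff_abs_le)
qed

lemma nm_df_commute: "u \<in> X \<Longrightarrow> v \<in> X \<Longrightarrow> nm (df u v) = nm (df v u)"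
  unfolding nm_def by (simp add: algebra_simps)

lemma nm_df_triangle:
  assumes "u \<in> X" "v \<in> X" "w \<in> X"
  shows "nm (df u w) \<le> nm (df u v) + nm (df v w)"
proof -
  have "nm (df u w) = nm (lc 1 (df u v) 1 (df v w))"
    unfolding nm_def using assms by (simp add: algebra_simps)
  then show ?thesis
    using nm_lc_le[of "df u v" "df v w" 1 1] assms by simp
qed

lemma nm_le_df:
  assumes "u \<in> X" "v \<in> X"
  shows "nm u \<le> nm (df u v) + nm v"
proof -
  have "nm u = nm (lc 1 (df u v) 1 v)"
    unfolding nm_def using assms by (simp add: algebra_simps)
  then show ?thesis
    using nm_lc_le[of "df u v" v 1 1] assms by simp
qed

lemma tends_nm:
  assumes "tends f y" "\<And>n. f n \<in> X" "y \<in> X"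
  shows "(\<lambda>n. nm (f n)) \<longlonglongrightarrow> nm y"
proof -
  have "\<bar>nm (f n) - nm y\<bar> \<le> nm (df (f n) y)" for n
    using nm_le_df[of "f n" y] nm_le_df[of y "f n"] nm_df_commute[of y "f n"] assms by auto
  moreover have "(\<lambda>n. nm (df (f n) y)) \<longlonglongrightarrow> 0"
    using assms by (simp add: tends_def)
  ultimately have "(\<lambda>n. nm (f n) - nm y) \<longlonglongrightarrow> 0"
    by (intro Lim_null_comparison[where f = "\<lambda>n. nm (f n) - nm y"]) auto
  then show ?thesis
    by (simp add: LIM_zero_iff)
qed

lemma tends_ip:
  assumes f: "tends f y" "\<And>n. f n \<in> X" "y \<in> X"
    and g: "tends g z" "\<And>n. g n \<in> X" "z \<in> X"
  shows "(\<lambda>n. ip (f n) (g n)) \<longlonglongrightarrow> ip y z"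
proof -
  have eq: "ip (f n) (g n) - ip y z = ip (df (f n) y) (g n) + ip y (df (g n) z)" for n
    using f g by simp
  have bd: "cmod (ip (f n) (g n) - ip y z) \<le> nm (df (f n) y) * nm (g n) + nm y * nm (df (g n) z)" for n
    unfolding eq using Cauchy_Schwarz[of "df (f n) y" "g n"] Cauchy_Schwarz[of y "df (g n) z"] f g
    by (smt (verit) lc_mem norm_triangle_ineq)
  have "(\<lambda>n. nm (df (f n) y) * nm (g n) + nm y * nm (df (g n) z)) \<longlonglongrightarrow> 0 * nm z + nm y * 0"
    using f(1) g(1) tends_nm[OF g] unfolding tends_def by (intro tendsto_intros)
  then have "(\<lambda>n. ip (f n) (g n) - ip y z) \<longlonglongrightarrow> 0"
    using bd by (intro Lim_null_comparison[where f = "\<lambda>n. ip (f n) (g n) - ip y z"]) auto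
  then show ?thesis
    by (simp add: LIM_zero_iff)
qed

lemma tends_subseq: "tends f y \<Longrightarrow> strict_mono r \<Longrightarrow> tends (\<lambda>n. f (r n)) y"
  unfolding tends_def using LIMSEQ_subseq_LIMSEQ[of "\<lambda>n. nm (df (f n) y)" 0 r] by (simp add: o_def)

lemma tends_close:
  assumes "(\<lambda>n. nm (df (f n) (g n))) \<longlonglongrightarrow> 0" "tends g y"
    "\<And>n. f n \<in> X" "\<And>n. g n \<in> X" "y \<in> X"
  shows "tends f y"
proof -
  have "(\<lambda>n. nm (df (f n) (g n)) + nm (df (g n) y)) \<longlonglongrightarrow> 0 + 0"
    using assms unfolding tends_def by (intro tendsto_intros)
  then show ?thesis
    unfolding tends_def using nm_df_triangle assms
    by (intro Lim_null_comparison[where f = "\<lambda>n. nm (df (f n) y)"]) auto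
qed

end

section \<open>Lemmas on functions of a real variable\<close>

text \<open>A continuous character of the half-line is smooth: integrating \<open>c (h + x) = c h * c x\<close> over an interval on which \<open>c\<close> has
nonzero integral writes \<open>c h\<close> through primitives of \<open>c\<close>.\<close>

lemma multiplicative_right_differentiable:
  fixes c :: "real \<Rightarrow> complex"
  assumes cont: "continuous_on {0..} c" and c0: "c 0 = 1"
    and mult: "\<And>s t. 0 \<le> s \<Longrightarrow> 0 \<le> t \<Longrightarrow> c (s + t) = c s * c t"
  shows "\<exists>l. ((\<lambda>h. (c h - 1) / of_real h) \<longlongrightarrow> l) (at_right 0)"
proof -
  define F where "F x = integral {0..x} c" for x
  have ci: "c integrable_on {a..b}" if "0 \<le> a" for a b
    using that by (intro integrable_continuous_real continuous_on_subset[OF cont]) auto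
  have D: "((\<lambda>h. (F (x + h) - F x) / of_real h) \<longlongrightarrow> c x) (at_right 0)" if x: "0 \<le> x" for x
  proof -
    have "(F has_vector_derivative c x) (at x within {0..x+1})"
      unfolding F_def using x by (intro integral_has_vector_derivative continuous_on_subset[OF cont]) auto
    then have "(F has_vector_derivative c x) (at x within {x..x+1})"
      using x by (elim has_vector_derivative_within_subset) auto
    then have "((\<lambda>y. norm (F y - F x - (y - x) *\<^sub>R c x) / norm (y - x)) \<longlongrightarrow> 0) (at_right x)"
      by (simp add: has_vector_derivative_def has_derivative_iff_norm at_within_Icc_at_right)
    then have "((\<lambda>h. norm (F (x + h) - F x - h *\<^sub>R c x) / norm h) \<longlongrightarrow> 0) (at_right 0)"
      by (subst (asm) filterlim_at_right_to_0) (simp add: add.commute)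
    then have "((\<lambda>h. (F (x + h) - F x) / of_real h - c x) \<longlongrightarrow> 0) (at_right 0)"
    proof (rule Lim_null_comparison[rotated])
      show "\<forall>\<^sub>F h in at_right 0. norm ((F (x + h) - F x) / of_real h - c x) \<le> norm (F (x + h) - F x - h *\<^sub>R c x) / norm h"
        unfolding eventually_at_right_field
      proof (intro exI[of _ 1] conjI allI impI)
        fix h :: real assume "0 < h" "h < 1"
        then have "(F (x + h) - F x) / of_real h - c x = (F (x + h) - F x - h *\<^sub>R c x) / of_real h"
          by (simp add: field_simps scaleR_conv_of_real)
        then show "norm ((F (x + h) - F x) / of_real h - c x) \<le> norm (F (x + h) - F x - h *\<^sub>R c x) / norm h"
          by (simp add: norm_divide)
      qed simp
    qed
    then show ?thesis by (simp add: LIM_zero_iff)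
  qed
  have F0: "F 0 = 0" by (simp add: F_def)
  obtain b where b: "0 < b" "F b \<noteq> 0"
  proof -
    have "((\<lambda>h. F h / of_real h) \<longlongrightarrow> 1) (at_right 0)"
      using D[of 0] F0 c0 by simp
    then have "\<forall>\<^sub>F h in at_right 0. F h / of_real h \<noteq> 0"
      by (rule tendsto_imp_eventually_ne) simp
    then obtain d where "0 < d" "\<forall>h>0. h < d \<longrightarrow> F h / of_real h \<noteq> 0"
      unfolding eventually_at_right_field by auto
    then show ?thesis using that[of "d / 2"] by auto
  qed
  \<comment> \<open>integrating the functional equation over \<open>[0,b]\<close> exhibits \<open>c\<close> as a combination of primitives\<close>
  have shift: "F (b + h) - F h = c h * F b" if h: "0 \<le> h" for h
  proof -
    have "((\<lambda>x. c h * c x) has_integral c h * F b) {0..b}"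
      unfolding F_def using ci[of 0 b] by (intro has_integral_mult_right integrable_integral) simp
    moreover have "c h * c x = c (x + h)" if "x \<in> {0..b}" for x
      using mult[of x h] that h by (simp add: mult.commute)
    ultimately have 1: "((\<lambda>x. c (x + h)) has_integral c h * F b) {0..b}"
      using has_integral_cong by (metis (no_types, lifting))
    have "(c has_integral integral {h..b+h} c) {h..b+h}"
      using ci[of h "b + h"] h by (simp add: integrable_integral)
    then have "((\<lambda>x. c (x + h)) has_integral integral {h..b+h} c) {0..b}"
      using has_integral_affinity'[of c "integral {h..b+h} c" h "b + h" 1 h] by simp
    then have "integral {h..b+h} c = c h * F b"
      using 1 has_integral_unique by blast
    moreover have "F h + integral {h..b+h} c = F (b + h)"
      unfolding F_def using h b ci by (intro Henstock_Kurzweil_Integration.integral_combine) auto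
    ultimately show ?thesis by (simp add: algebra_simps)
  qed
  have "((\<lambda>h. ((F (b + h) - F b) / of_real h - (F (0 + h) - F 0) / of_real h) / F b) \<longlongrightarrow> (c b - c 0) / F b) (at_right 0)"
    using D[of b] D[of 0] b by (intro tendsto_intros) auto
  moreover have "\<forall>\<^sub>F h in at_right 0. ((F (b + h) - F b) / of_real h - (F (0 + h) - F 0) / of_real h) / F b = (c h - 1) / of_real h"
    unfolding eventually_at_right_field
  proof (intro exI[of _ 1] conjI allI impI)
    fix h :: real assume h: "0 < h" "h < 1"
    have "(F (b + h) - F b) - (F (0 + h) - F 0) = (c h - 1) * F b"
      using shift[of h] h F0 by (simp add: algebra_simps)
    then show "((F (b + h) - F b) / of_real h - (F (0 + h) - F 0) / of_real h) / F b = (c h - 1) / of_real h"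
      using b by (simp add: diff_divide_distrib[symmetric])
  qed simp
  ultimately show ?thesis
    using tendsto_cong by fast
qed

text \<open>A strict decrease in every right derivative propagates: after the last instant at which the claimed
bound holds, it would have to hold a little longer. No measurability or integrability of the derivative in time
enters, which is why this lemma can replace the fundamental theorem of calculus for orbits.\<close>

lemma right_derivative_decrease:
  fixes G :: "real \<Rightarrow> real"
  assumes cont: "continuous_on {0..1} G"
    and der: "\<And>t. 0 \<le> t \<Longrightarrow> t < 1 \<Longrightarrow> \<exists>d\<le>-c. ((\<lambda>h. (G (t + h) - G t) / h) \<longlongrightarrow> d) (at_right 0)"
  shows "G 1 \<le> G 0 - c"
proof (rule field_le_epsilon)
  fix e :: real assume e: "e > 0"
  define f where "f t = G t + (c - e) * t - G 0" for t
  have cf: "continuous_on {0..1} f" unfolding f_def by (intro continuous_intros cont)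
  show "G 1 \<le> G 0 - c + e"
  proof (rule ccontr)
    assume "\<not> G 1 \<le> G 0 - c + e"
    then have f1: "f 1 > 0" by (simp add: f_def)
    define A where "A = {t \<in> {0..1}. f t \<le> 0}"
    have "closed A"
      unfolding A_def by (rule continuous_on_closed_Collect_le[OF cf continuous_on_const closed_atLeastAtMost])
    then have "compact ({0..1} \<inter> A)" by (intro compact_Int_closed compact_Icc)
    moreover have "{0..1} \<inter> A = A" by (auto simp: A_def)
    ultimately have "compact A" by simp
    moreover have "0 \<in> A" by (simp add: A_def f_def)
    ultimately obtain t where t: "t \<in> A" "\<forall>s\<in>A. s \<le> t"
      using compact_attains_sup[of A] by blast
    have t': "0 \<le> t" "t \<le> 1" "f t \<le> 0" using t(1) by (auto simp: A_def)
    have "t \<noteq> 1" using f1 t'(3) by (metis not_le)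
    then have t01: "0 \<le> t" "t < 1" "f t \<le> 0" using t' by auto
    obtain d where d: "d \<le> -c" "((\<lambda>h. (G (t + h) - G t) / h) \<longlongrightarrow> d) (at_right 0)"
      using der[OF t01(1,2)] by blast
    have "\<forall>\<^sub>F h in at_right 0. (G (t + h) - G t) / h < - c + e"
      using order_tendstoD(2)[OF d(2), of "- c + e"] d(1) e by simp
    then obtain b where b: "b > 0" "\<And>h. 0 < h \<Longrightarrow> h < b \<Longrightarrow> (G (t + h) - G t) / h < - c + e"
      unfolding eventually_at_right_field by auto
    define h where "h = min (b / 2) ((1 - t) / 2)"
    have h: "0 < h" "h < b" "t + h \<le> 1" using b t01 by (auto simp: h_def min_def field_simps)
    have "G (t + h) - G t < (- c + e) * h" using b(2)[OF h(1,2)] h(1) by (simp add: divide_less_eq)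
    then have "f (t + h) < f t" by (simp add: f_def algebra_simps)
    then have "t + h \<in> A" using t01 h by (simp add: A_def)
    then show False using t(2) h(1) by force
  qed
qed

section \<open>Contraction semigroups with a compact time-one map\<close>

locale contraction_semigroup = semi_inner_space X lc ip
  for X :: "'v set" and lc ip +
  fixes S :: "real \<Rightarrow> 'v \<Rightarrow> 'v"
  assumes S_mem [simp, intro]: "0 \<le> t \<Longrightarrow> u \<in> X \<Longrightarrow> S t u \<in> X"
    and S_contraction: "0 \<le> t \<Longrightarrow> u \<in> X \<Longrightarrow> nm (S t u) \<le> nm u"
    and S_lc: "0 \<le> t \<Longrightarrow> u \<in> X \<Longrightarrow> v \<in> X \<Longrightarrow> w \<in> X \<Longrightarrow>
      ip (S t (lc a u b v)) w = a * ip (S t u) w + b * ip (S t v) w"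
    and S_0: "u \<in> X \<Longrightarrow> w \<in> X \<Longrightarrow> ip (S 0 u) w = ip u w"
    and S_add: "0 \<le> s \<Longrightarrow> 0 \<le> t \<Longrightarrow> u \<in> X \<Longrightarrow> w \<in> X \<Longrightarrow> ip (S (s + t) u) w = ip (S s (S t u)) w"
    and S_right_cont: "u \<in> X \<Longrightarrow> ((\<lambda>t. nm (df (S t u) u)) \<longlongrightarrow> 0) (at_right 0)"
begin

text \<open>Vectors that pair equally with everything are indistinguishable: every expression formed
  from inner products may be rewritten along such an equality.\<close>

definition eqv :: "'v \<Rightarrow> 'v \<Rightarrow> bool" where
  "eqv u v \<longleftrightarrow> (\<forall>w\<in>X. ip u w = ip v w)"

lemma eqv_right: "eqv u v \<Longrightarrow> u \<in> X \<Longrightarrow> v \<in> X \<Longrightarrow> w \<in> X \<Longrightarrow> ip w u = ip w v"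
  using ip_cnj[of u w] ip_cnj[of v w] by (simp add: eqv_def)

lemma eqv_nm: "eqv u v \<Longrightarrow> u \<in> X \<Longrightarrow> v \<in> X \<Longrightarrow> nm u = nm v"
  using eqv_right[of u v u] unfolding nm_def eqv_def by simp

lemma eqv_iff_nm: 
  assumes "u \<in> X" "v \<in> X" shows "eqv u v \<longleftrightarrow> nm (df u v) = 0"
proof
  assume "eqv u v"
  then have "ip (df u v) (df u v) = 0" using assms by (simp add: eqv_def)
  then show "nm (df u v) = 0" by (simp add: nm_def)
next
  assume "nm (df u v) = 0"
  then have "ip (df u v) w = 0" if "w \<in> X" for w
    using ip_null[of "df u v" w] that assms by blast
  then show "eqv u v" using assms by (simp add: eqv_def)
qed

lemma eqv_sym: "eqv u v \<Longrightarrow> eqv v u" by (simp add: eqv_def)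
lemma eqv_trans: "eqv u v \<Longrightarrow> eqv v w \<Longrightarrow> eqv u w" by (simp add: eqv_def)

lemma S_lc_eqv: "0 \<le> t \<Longrightarrow> u \<in> X \<Longrightarrow> v \<in> X \<Longrightarrow> eqv (S t (lc a u b v)) (lc a (S t u) b (S t v))"
  unfolding eqv_def using S_lc by auto

lemma S_add_eqv: "0 \<le> s \<Longrightarrow> 0 \<le> t \<Longrightarrow> u \<in> X \<Longrightarrow> eqv (S (s + t) u) (S s (S t u))"
  unfolding eqv_def using S_add by auto

lemma nm_S_df:
  assumes "0 \<le> t" "u \<in> X" "v \<in> X"
  shows "nm (df (S t u) (S t v)) \<le> nm (df u v)"
proof -
  have "nm (df (S t u) (S t v)) = nm (S t (df u v))"
    using eqv_nm[OF S_lc_eqv[of t u v 1 "-1"]] assms by auto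
  then show ?thesis using S_contraction[of t "df u v"] assms by auto
qed

lemma S_eqv: "0 \<le> t \<Longrightarrow> u \<in> X \<Longrightarrow> v \<in> X \<Longrightarrow> eqv u v \<Longrightarrow> eqv (S t u) (S t v)"
  using nm_S_df[of t u v] nm_nonneg[OF lc_mem[of "S t u" "S t v" 1 "-1"]]
  by (simp add: eqv_iff_nm del: nm_nonneg)

lemma nm_S_antimono:
  assumes "0 \<le> s" "s \<le> t" "u \<in> X"
  shows "nm (S t u) \<le> nm (S s u)"
proof -
  have "nm (S t u) = nm (S (t - s) (S s u))"
    using eqv_nm[OF S_add_eqv[of "t - s" s u]] assms by auto
  then show ?thesis using S_contraction[of "t - s" "S s u"] assms by auto
qed

lemma nm_S_time_df:
  assumes "0 \<le> s" "0 \<le> t" "u \<in> X"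
  shows "nm (df (S t u) (S s u)) \<le> nm (df (S \<bar>t - s\<bar> u) u)"
proof -
  have *: "nm (df (S t u) (S s u)) \<le> nm (df (S (t - s) u) u)" if "0 \<le> s" "s \<le> t" for s t
  proof -
    have "eqv (df (S t u) (S s u)) (df (S s (S (t - s) u)) (S s u))"
      using S_add_eqv[of s "t - s" u] that assms(3) by (simp add: eqv_def)
    then have "nm (df (S t u) (S s u)) = nm (df (S s (S (t - s) u)) (S s u))"
      using that assms(3) by (intro eqv_nm) auto
    then show ?thesis using nm_S_df[of s "S (t - s) u" u] that assms(3) by auto
  qed
  show ?thesis
  proof (cases "s \<le> t")
    case True then show ?thesis using *[of s t] assms by simp
  next
    case False
    then show ?thesis using *[of t s] assms nm_df_commute[of "S t u" "S s u"] by (simp add: abs_if)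
  qed
qed

text \<open>The semigroup is contractive, so right continuity at time \<open>0\<close> gives joint continuity in time and
vector.\<close>

lemma S_jointly_continuous:
  assumes t: "t \<longlonglongrightarrow> t0" "\<And>n. 0 \<le> t n" "0 \<le> t0"
    and u: "tends u u0" "\<And>n. u n \<in> X" "u0 \<in> X"
  shows "tends (\<lambda>n. S (t n) (u n)) (S t0 u0)"
proof -
  have lim0: "((\<lambda>h. nm (df (S h u0) u0)) \<longlongrightarrow> 0) (at 0 within {0..})"
    using S_right_cont[OF u(3)] by (simp add: at_within_Ici_at_right)
  have at0: "nm (df (S 0 u0) u0) = 0"
    using S_0[of u0] u(3) by (subst eqv_iff_nm[symmetric]) (auto simp: eqv_def)
  have "(\<lambda>n. \<bar>t n - t0\<bar>) \<longlonglongrightarrow> 0"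
    using t(1) by (intro tendsto_rabs_zero) (simp add: LIM_zero_iff)
  then have A: "(\<lambda>n. nm (df (S \<bar>t n - t0\<bar> u0) u0)) \<longlonglongrightarrow> 0"
    using continuous_within_tendsto_compose'[of 0 "{0..}" "\<lambda>h. nm (df (S h u0) u0)" "\<lambda>n. \<bar>t n - t0\<bar>" sequentially]
      lim0 at0 by (simp add: continuous_within)
  have "nm (df (S (t n) (u n)) (S t0 u0)) \<le> nm (df (u n) u0) + nm (df (S \<bar>t n - t0\<bar> u0) u0)" for n
    using nm_df_triangle[of "S (t n) (u n)" "S (t n) u0" "S t0 u0"] nm_S_df[of "t n" "u n" u0]
      nm_S_time_df[of t0 "t n" u0] t u by (smt (verit) S_mem)
  moreover have "(\<lambda>n. nm (df (u n) u0) + nm (df (S \<bar>t n - t0\<bar> u0) u0)) \<longlonglongrightarrow> 0 + 0"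
    using A u(1) unfolding tends_def by (intro tendsto_intros)
  ultimately show ?thesis
    unfolding tends_def using t u
    by (intro Lim_null_comparison[where f = "\<lambda>n. nm (df (S (t n) (u n)) (S t0 u0))"]) auto
qed

lemma tends_const: "u \<in> X \<Longrightarrow> tends (\<lambda>_. u) u"
proof -
  assume "u \<in> X"
  then have "nm (df u u) = 0" by (subst eqv_iff_nm[symmetric]) (auto simp: eqv_def)
  then show ?thesis by (simp add: tends_def)
qed

lemma tends_S: "0 \<le> t \<Longrightarrow> tends u y \<Longrightarrow> (\<And>n. u n \<in> X) \<Longrightarrow> y \<in> X \<Longrightarrow> tends (\<lambda>n. S t (u n)) (S t y)"
  using S_jointly_continuous[of "\<lambda>_. t" t u y] by simp

text \<open>Compactness of the time-one map. The limits are required to lie in \<open>X\<close>, so that the definition also takes over the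
role of completeness.\<close>

definition S1_compact :: bool where
  "S1_compact \<longleftrightarrow> (\<forall>f :: nat \<Rightarrow> 'v. (\<forall>n. f n \<in> X \<and> nm (f n) \<le> 1) \<longrightarrow>
     (\<exists>r y. strict_mono r \<and> y \<in> X \<and> tends (\<lambda>n. S 1 (f (r n))) y))"

text \<open>The instant at which an orbit enters the precompact set \<open>K\<close> may depend on the orbit. It ranges over
the compact interval \<open>[0,1]\<close>, so after passing to a subsequence the remaining time \<open>1 - t\<close> converges
as well, and \<open>S 1 d = S (1 - t) (S t d)\<close> converges by joint continuity.\<close>

lemma S1_compactI:
  assumes K: "K \<subseteq> X" "\<And>f :: nat \<Rightarrow> 'v. (\<And>n. f n \<in> K) \<Longrightarrow> \<exists>r y. strict_mono r \<and> y \<in> X \<and> tends (\<lambda>n. f (r n)) y"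
    and D: "\<And>u. u \<in> D \<Longrightarrow> u \<in> X \<and> (nm u \<le> 2 \<longrightarrow> (\<exists>t\<in>{0..1}. S t u \<in> K))"
    and dense: "\<And>u e. u \<in> X \<Longrightarrow> e > 0 \<Longrightarrow> \<exists>v\<in>D. nm (df v u) < e"
  shows S1_compact
  unfolding S1_compact_def
proof (intro allI impI)
  fix f :: "nat \<Rightarrow> 'v" assume f: "\<forall>n. f n \<in> X \<and> nm (f n) \<le> 1"
  have "\<exists>v\<in>D. nm (df v (f n)) < 1 / real (Suc n)" for n
    using dense f by simp
  then obtain d where d: "\<And>n. d n \<in> D" "\<And>n. nm (df (d n) (f n)) < 1 / real (Suc n)"
    by metis
  have dX: "d n \<in> X" for n using D d(1) by blast
  have "nm (d n) \<le> 2" for n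
  proof -
    have "1 / real (Suc n) \<le> 1" by simp
    then show ?thesis
      using nm_le_df[OF dX[of n], of "f n"] f d(2)[of n] by (smt (verit))
  qed
  then have "\<exists>t\<in>{0..1}. S t (d n) \<in> K" for n using D d(1) by blast
  then obtain t where t: "\<And>n. t n \<in> {0..1}" "\<And>n. S (t n) (d n) \<in> K" by metis
  obtain r0 y0 where r0: "strict_mono r0" "y0 \<in> X" "tends (\<lambda>n. S (t (r0 n)) (d (r0 n))) y0"
    using K(2)[of "\<lambda>n. S (t n) (d n)"] t(2) by blast
  obtain t0 r1 where r1: "strict_mono (r1 :: nat \<Rightarrow> nat)" "t0 \<in> {0..1}" "(\<lambda>n. t (r0 (r1 n))) \<longlonglongrightarrow> t0"
  proof -
    have "seq_compact {0..1::real}"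
      by (simp add: compact_imp_seq_compact)
    then show ?thesis
      using t(1) that unfolding seq_compact_def o_def by (meson)
  qed
  define r where "r = r0 \<circ> r1"
  have r: "strict_mono r" using r0 r1 by (simp add: r_def strict_mono_o)
  have "tends (\<lambda>n. S (1 - t (r n)) (S (t (r n)) (d (r n)))) (S (1 - t0) y0)"
  proof (rule S_jointly_continuous)
    show "(\<lambda>n. 1 - t (r n)) \<longlonglongrightarrow> 1 - t0" using r1(3) by (auto simp: r_def intro: tendsto_intros)
    show "tends (\<lambda>n. S (t (r n)) (d (r n))) y0" using tends_subseq[OF r0(3) r1(1)] by (simp add: r_def)
  qed (use t(1) dX r0 r1 in auto)
  then have T: "tends (\<lambda>n. S (1 - t (r n)) (S (t (r n)) (d (r n)))) (S (1 - t0) y0)" .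
  have N: "(\<lambda>n. nm (df (S 1 (f (r n))) (S (1 - t (r n)) (S (t (r n)) (d (r n)))))) \<longlonglongrightarrow> 0"
  proof (rule Lim_null_comparison)
    have "nm (df (S 1 (f (r n))) (S (1 - t (r n)) (S (t (r n)) (d (r n))))) \<le> 1 / real (Suc (r n))" for n
    proof -
      have tt: "0 \<le> t (r n)" "t (r n) \<le> 1" using t(1)[of "r n"] by auto
      have "nm (df (S 1 (f (r n))) (S (1 - t (r n)) (S (t (r n)) (d (r n))))) = nm (df (S 1 (f (r n))) (S 1 (d (r n))))"
        using S_add_eqv[of "1 - t (r n)" "t (r n)" "d (r n)"] tt dX f 
        by (intro eqv_nm) (auto simp: eqv_def)
      also have "\<dots> \<le> nm (df (f (r n)) (d (r n)))" using dX f by (intro nm_S_df) auto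
      finally show ?thesis
        using d(2)[of "r n"] nm_df_commute[of "d (r n)" "f (r n)"] f dX by simp
    qed
    then show "\<forall>\<^sub>F n in sequentially. norm (nm (df (S 1 (f (r n))) (S (1 - t (r n)) (S (t (r n)) (d (r n)))))) \<le> 1 / real (Suc (r n))"
      using t(1) dX f by (auto simp: nm_nonneg)
    show "(\<lambda>n. 1 / real (Suc (r n))) \<longlonglongrightarrow> 0"
      using LIMSEQ_subseq_LIMSEQ[OF lim_1_over_n[THEN LIMSEQ_Suc] r] by (simp add: o_def)
  qed
  have "tends (\<lambda>n. S 1 (f (r n))) (S (1 - t0) y0)"
  proof (rule tends_close[OF N T])
    show "S 1 (f (r n)) \<in> X" for n using f by simp
    show "S (1 - t (r n)) (S (t (r n)) (d (r n))) \<in> X" for n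
      using t(1)[of "r n"] dX by (intro S_mem) auto
    show "S (1 - t0) y0 \<in> X" using r0(2) r1(2) by (intro S_mem) auto
  qed
  then show "\<exists>r y. strict_mono r \<and> y \<in> X \<and> tends (\<lambda>n. S 1 (f (r n))) y"
    using r r0(2) r1(2) by (intro exI[of _ r] exI[of _ "S (1 - t0) y0"]) auto
qed

text \<open>The vectors that never lose norm. Defining them by preservation of inner products makes linearity evident; by
\<open>isometric_partI\<close> preservation of norms suffices for membership.\<close>

definition isometric_part :: "'v set" where
  "isometric_part = {u \<in> X. \<forall>t\<ge>0. \<forall>v\<in>X. ip (S t u) (S t v) = ip u v}"

lemma isometric_partD:
  assumes "u \<in> isometric_part"
  shows "u \<in> X" "\<And>t v. 0 \<le> t \<Longrightarrow> v \<in> X \<Longrightarrow> ip (S t u) (S t v) = ip u v"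
    "\<And>t. 0 \<le> t \<Longrightarrow> nm (S t u) = nm u"
  using assms by (auto simp: isometric_part_def nm_def)

text \<open>The defect \<open>ip u v - ip (S t u) (S t v)\<close> is again a semi-inner product because \<open>S t\<close> is a contraction. A vector
that is null for this form is orthogonal to everything with respect to it, by Cauchy-Schwarz.\<close>

lemma isometric_partI:
  assumes u: "u \<in> X" and iso: "\<And>t. 0 \<le> t \<Longrightarrow> nm (S t u) = nm u"
  shows "u \<in> isometric_part"
proof -
  have "ip (S t u) (S t v) = ip u v" if t: "0 \<le> t" and v: "v \<in> X" for t v
  proof -
    interpret D: semi_inner_space X lc "\<lambda>u v. ip u v - ip (S t u) (S t v)"
    proof
      show "lc a u b v \<in> X" if "u \<in> X" "v \<in> X" for a u b v using that by auto
      show "ip (lc a u b v) w - ip (S t (lc a u b v)) (S t w)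
          = a * (ip u w - ip (S t u) (S t w)) + b * (ip v w - ip (S t v) (S t w))"
        if "u \<in> X" "v \<in> X" "w \<in> X" for a u b v w
        using that t S_lc[of t u v "S t w" a b] by (simp add: algebra_simps)
      show "ip v u - ip (S t v) (S t u) = cnj (ip u v - ip (S t u) (S t v))"
        if "u \<in> X" "v \<in> X" for u v
        using that t ip_cnj[of u v] ip_cnj[of "S t u" "S t v"] by simp
      show "0 \<le> Re (ip u u - ip (S t u) (S t u))" if "u \<in> X" for u
        using S_contraction[OF t that] that t power_mono[of "nm (S t u)" "nm u" 2]
        by (simp add: nm_power2)
    qed
    have "D.nm u = 0"
      unfolding D.nm_def using iso[OF t] u t nm_power2[of u] nm_power2[of "S t u"] by simp
    then show ?thesis
      using D.ip_null[OF u v] by simp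
  qed
  then show ?thesis
    using u by (simp add: isometric_part_def)
qed

lemma isometric_part_lc:
  assumes "u \<in> isometric_part" "v \<in> isometric_part"
  shows "lc a u b v \<in> isometric_part"
proof -
  have "ip (S t (lc a u b v)) (S t w) = ip (lc a u b v) w" if "0 \<le> t" "w \<in> X" for t w
    using that assms[THEN isometric_partD(1)] isometric_partD(2)[OF assms(1) that]
      isometric_partD(2)[OF assms(2) that]
    by (simp add: S_lc)
  then show ?thesis
    using assms[THEN isometric_partD(1)] by (simp add: isometric_part_def)
qed

lemma isometric_part_S:
  assumes u: "u \<in> isometric_part" and s: "0 \<le> s"
  shows "S s u \<in> isometric_part"
proof (rule isometric_partI)
  note uX = isometric_partD(1)[OF u]
  show "S s u \<in> X" using uX s by simp
  fix t :: real assume t: "0 \<le> t"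
  have "nm (S t (S s u)) = nm (S (t + s) u)"
    using eqv_nm[OF S_add_eqv[of t s u]] uX s t by simp
  then show "nm (S t (S s u)) = nm (S s u)"
    using isometric_partD(3)[OF u] s t by simp
qed

lemma isometric_part_closed:
  assumes f: "\<And>n. f n \<in> isometric_part" "tends f y" "y \<in> X"
  shows "y \<in> isometric_part"
proof (rule isometric_partI)
  fix t :: real assume t: "0 \<le> t"
  note fX = isometric_partD(1)[OF f(1)]
  have "(\<lambda>n. nm (S t (f n))) \<longlonglongrightarrow> nm (S t y)"
    using tends_nm[OF tends_S[OF t f(2) fX f(3)]] t fX f(3) by auto
  moreover have "(\<lambda>n. nm (S t (f n))) \<longlonglongrightarrow> nm y"
    using tends_nm[OF f(2) fX f(3)] isometric_partD(3)[OF f(1) t] by simp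
  ultimately show "nm (S t y) = nm y"
    by (rule LIMSEQ_unique)
qed (use f in auto)

text \<open>On the isometric part \<open>S 1\<close> preserves norms, so compactness of \<open>S 1\<close> keeps limits of unit vectors
on the unit sphere.\<close>

lemma isometric_part_compact:
  assumes S1_compact and f: "\<And>n. f n \<in> isometric_part" "\<And>n. nm (f n) = 1"
  obtains r y where "strict_mono (r :: nat \<Rightarrow> nat)" "y \<in> isometric_part" "nm y = 1" "tends (\<lambda>n. S 1 (f (r n))) y"
proof -
  note fX = isometric_partD(1)[OF f(1)]
  obtain r y where r: "strict_mono (r :: nat \<Rightarrow> nat)" "y \<in> X" "tends (\<lambda>n. S 1 (f (r n))) y"
    using \<open>S1_compact\<close>[unfolded S1_compact_def, rule_format, of f] fX f(2) by auto
  have "y \<in> isometric_part"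
    using isometric_part_closed[OF isometric_part_S[OF f(1)] r(3,2)] by simp
  moreover have "nm y = 1"
    using tends_nm[OF r(3) _ r(2)] isometric_partD(3)[OF f(1), of 1] fX f(2) LIMSEQ_unique[OF _ tendsto_const] by simp
  ultimately show ?thesis using that r by blast
qed

lemma unit_multiple:
  assumes "u \<in> X" "nm u > 0"
  shows "nm (lc (1 / of_real (nm u)) u 0 u) = 1"
proof -
  have "(nm (lc (1 / of_real (nm u)) u 0 u))\<^sup>2 = 1"
    using assms by (subst nm_lc_power2) (auto simp: norm_divide power_divide)
  then show ?thesis
    using nm_nonneg[OF lc_mem[OF assms(1,1)]] power2_eq_imp_eq[where y = "1::real"] by simp
qed

text \<open>A maximizing sequence of the quadratic form stays maximizing after applying \<open>S 1\<close>, and then has a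
convergent subsequence.\<close>

lemma isometric_maximizer:
  assumes cpt: S1_compact and h: "0 \<le> h" and w: "w \<in> isometric_part" "nm w = 1"
  obtains y c where "y \<in> isometric_part" "nm y = 1" "c = Re (ip (S h y) y)"
    "\<forall>v\<in>isometric_part. Re (ip (S h v) v) \<le> c * (nm v)\<^sup>2"
proof -
  define J where "J w = Re (ip (S h w) w)" for w
  define A where "A = J ` {w \<in> isometric_part. nm w = 1}"
  have Jle: "\<bar>J u\<bar> \<le> nm u * nm u" if "u \<in> isometric_part" for u
    using Cauchy_Schwarz[of "S h u" u] abs_Re_le_cmod[of "ip (S h u) u"] isometric_partD[OF that] h
    by (auto simp: J_def)
  have bdd: "bdd_above A"
    using Jle unfolding A_def by (intro bdd_aboveI2[of _ _ 1]) force
  have ne: "A \<noteq> {}" using w by (auto simp: A_def)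
  define c where "c = Sup A"
  have le_c: "J u \<le> c" if "u \<in> isometric_part" "nm u = 1" for u
    unfolding c_def using bdd that by (intro cSup_upper) (auto simp: A_def)
  have "\<exists>u. u \<in> isometric_part \<and> nm u = 1 \<and> c - 1 / real (Suc n) < J u" for n
  proof -
    have "c - 1 / real (Suc n) < Sup A" by (simp add: c_def)
    then show ?thesis
      using less_cSup_iff[OF ne bdd] by (auto simp: A_def)
  qed
  then obtain f where f: "\<And>n. f n \<in> isometric_part" "\<And>n. nm (f n) = 1" "\<And>n. c - 1 / real (Suc n) < J (f n)"
    by metis
  note fX = isometric_partD(1)[OF f(1)]
  obtain r y where r: "strict_mono (r :: nat \<Rightarrow> nat)" "y \<in> isometric_part" "nm y = 1" "tends (\<lambda>n. S 1 (f (r n))) y"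
    using isometric_part_compact[OF cpt f(1,2)] .
  note yX = isometric_partD(1)[OF r(2)]
  \<comment> \<open>\<open>S 1\<close> commutes with \<open>S h\<close> and preserves inner products, so it does not change \<open>J\<close>\<close>
  have J1: "J (S 1 (f n)) = J (f n)" for n
  proof -
    have "eqv (S h (S 1 (f n))) (S 1 (S h (f n)))"
      using S_add_eqv[of h 1 "f n"] S_add_eqv[of 1 h "f n"] fX h eqv_sym eqv_trans
      by (metis add.commute zero_le_one)
    then show ?thesis
      using isometric_partD(2)[OF isometric_part_S[OF f(1) h], of 1] fX h by (simp add: J_def eqv_def)
  qed
  have "(\<lambda>n. J (S 1 (f (r n)))) \<longlonglongrightarrow> J y"
    unfolding J_def using tends_ip[OF tends_S[OF h r(4)] _ _ r(4)] fX yX h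
    by (intro tendsto_Re) auto
  then have lim: "(\<lambda>n. J (S 1 (f (r n)))) \<longlonglongrightarrow> J y" .
  have "(\<lambda>n. c - 1 / real (Suc (r n))) \<longlonglongrightarrow> c - 0"
    using LIMSEQ_subseq_LIMSEQ[OF lim_1_over_n[THEN LIMSEQ_Suc] r(1)] by (intro tendsto_intros) (simp add: o_def)
  then have "c - 0 \<le> J y"
    by (rule LIMSEQ_le[OF _ lim]) (use f(3) J1 in \<open>auto intro: less_imp_le simp del: of_nat_Suc\<close>)
  then have Jy: "J y = c"
    using le_c[OF r(2,3)] by simp
  have "J v \<le> c * (nm v)\<^sup>2" if v: "v \<in> isometric_part" for v
  proof (cases "nm v = 0")
    case True
    then show ?thesis using Jle[OF v] by simp
  next
    case False
    note vX = isometric_partD(1)[OF v]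
    then have pos: "nm v > 0" using False nm_nonneg[OF vX] by linarith
    define v' where "v' = lc (1 / of_real (nm v)) v 0 v"
    have "J v' \<le> c"
      unfolding v'_def using unit_multiple[OF vX pos] isometric_part_lc[OF v v] by (intro le_c) auto
    moreover have "J v' = J v / (nm v)\<^sup>2"
      unfolding v'_def J_def using vX h by (simp add: S_lc power2_eq_square flip: of_real_mult)
    ultimately show ?thesis using pos by (simp add: field_simps)
  qed
  then show ?thesis
    using that[OF r(2,3)] Jy by (simp add: J_def)
qed

text \<open>At a maximizer \<open>y\<close> the nonnegative form \<open>2 c \<langle>u,v\<rangle> - \<langle>U u,v\<rangle> - \<langle>u,U v\<rangle>\<close>, where \<open>U = S h\<close>, vanishes on \<open>(y,y)\<close>, hence
\<open>y\<close> lies in its kernel. For an isometry this kernel condition says \<open>U\<^sup>2 y - 2 c U y + y = 0\<close>, and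
one of the two linear factors produces an eigenvector.\<close>

lemma isometric_eigenvector:
  assumes cpt: S1_compact and h: "0 \<le> h" and w: "w \<in> isometric_part" "nm w = 1"
  obtains e a where "e \<in> isometric_part" "nm e = 1" "\<And>v. v \<in> X \<Longrightarrow> ip (S h e) v = a * ip e v"
proof -
  obtain y c where y: "y \<in> isometric_part" "nm y = 1" and c: "c = Re (ip (S h y) y)"
    and max: "\<forall>v\<in>isometric_part. Re (ip (S h v) v) \<le> c * (nm v)\<^sup>2"
    using isometric_maximizer[OF cpt h w] .
  note VX = isometric_partD(1)
  interpret E: semi_inner_space isometric_part lc "\<lambda>u v. 2 * of_real c * ip u v - ip (S h u) v - ip u (S h v)"
  proof
    show "lc a u b v \<in> isometric_part" if "u \<in> isometric_part" "v \<in> isometric_part" for a u b v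
      using that by (rule isometric_part_lc)
    show "2 * of_real c * ip (lc a u b v) w - ip (S h (lc a u b v)) w - ip (lc a u b v) (S h w)
        = a * (2 * of_real c * ip u w - ip (S h u) w - ip u (S h w))
          + b * (2 * of_real c * ip v w - ip (S h v) w - ip v (S h w))"
      if "u \<in> isometric_part" "v \<in> isometric_part" "w \<in> isometric_part" for a u b v w
      using that[THEN VX] h by (simp add: S_lc algebra_simps)
    show "2 * of_real c * ip v u - ip (S h v) u - ip v (S h u)
        = cnj (2 * of_real c * ip u v - ip (S h u) v - ip u (S h v))"
      if "u \<in> isometric_part" "v \<in> isometric_part" for u v
      using that[THEN VX] h ip_cnj[of u v] ip_cnj[of u "S h v"] ip_cnj[of "S h u" v] by simp
    show "0 \<le> Re (2 * of_real c * ip u u - ip (S h u) u - ip u (S h u))"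
      if "u \<in> isometric_part" for u
      using bspec[OF max that] VX[OF that] h ip_cnj[of "S h u" u] by (simp add: nm_power2)
  qed
  define U where "U = S h y"
  define U2 where "U2 = S h U"
  have V: "U \<in> isometric_part" "U2 \<in> isometric_part"
    unfolding U2_def U_def using y h isometric_part_S by auto
  have X: "y \<in> X" "U \<in> X" "U2 \<in> X" using V y VX by auto
  have "E.nm y = 0"
    unfolding E.nm_def using c X h ip_cnj[of "S h y" y] y nm_power2[of y] by simp
  then have crit: "2 * of_real c * ip y v = ip U v + ip y (S h v)" if "v \<in> isometric_part" for v
    using E.ip_null[OF y(1) that] by (simp add: U_def algebra_simps)
  define r where "r = lc 1 (lc 1 U2 (- 2 * of_real c) U) 1 y"
  have rX: "r \<in> X" using X by (simp add: r_def)
  \<comment> \<open>the maximizer is annihilated by \<open>z\<^sup>2 - 2 c z + 1\<close>, whose roots are unimodular\<close>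
  have ipyy: "ip y y = 1" "ip U U = 1" "ip U2 U2 = 1"
    using ip_self[of y] X y(2) isometric_partD(2)[OF y(1) h X(1)] isometric_partD(2)[OF V(1) h X(2)]
    by (auto simp: U_def U2_def)
  have ipUy: "ip U2 U = ip U y"
    using isometric_partD(2)[OF V(1) h X(1)] by (simp add: U_def U2_def)
  have ReU2: "Re (ip U2 y) = 2 * c\<^sup>2 - 1"
  proof -
    have "2 * of_real c * ip y U = 1 + ip y U2"
      using crit[OF V(1)] ipyy by (simp add: U2_def)
    from arg_cong[OF this, of Re] have "2 * c * Re (ip y U) = 1 + Re (ip y U2)"
      by simp
    then show ?thesis
      using c X ip_cnj[of U y] ip_cnj[of U2 y] by (simp add: U_def power2_eq_square)
  qed
  have "Re (ip r r) = 0"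
    unfolding r_def using X ipyy ipUy ReU2 c ip_cnj[of U2 U] ip_cnj[of U2 y] ip_cnj[of U y]
    by (simp add: algebra_simps U_def[symmetric] power2_eq_square)
  then have r0: "ip r v = 0" if "v \<in> X" for v
    using ip_null[OF rX that] by (simp add: nm_def)
  have c1: "c\<^sup>2 \<le> 1"
    using c Cauchy_Schwarz[of U y] abs_Re_le_cmod[of "ip U y"] X y(2) ipyy(2) nm_def[of U]
    by (simp add: U_def[symmetric] abs_square_le_1)
  define d where "d = sqrt (1 - c\<^sup>2)"
  define p where "p = Complex c d"
  define q where "q = Complex c (- d)"
  have pq: "p + q = 2 * of_real c" "p * q = 1"
    using c1 by (auto simp: p_def q_def d_def complex_eq_iff power2_eq_square)
  define z where "z = lc 1 U (- q) y"
  have zV: "z \<in> isometric_part" unfolding z_def using V y by (intro isometric_part_lc) auto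
  have zX: "z \<in> X" using VX[OF zV] .
  show ?thesis
  proof (cases "nm z = 0")
    case True
    then have "ip (S h y) v = q * ip y v" if "v \<in> X" for v
      using ip_null[OF zX that] that X by (simp add: z_def U_def)
    then show ?thesis using that[OF y] by blast
  next
    case False
    then have pos: "nm z > 0" using nm_nonneg[OF zX] by linarith
    have eig: "ip (S h z) v = p * ip z v" if "v \<in> X" for v
    proof -
      have "ip (S h z) v - p * ip z v = ip U2 v - (p + q) * ip U v + (p * q) * ip y v"
        using X that h by (simp add: z_def S_lc U2_def algebra_simps U_def[symmetric])
      also have "\<dots> = ip r v"
        using X that by (simp add: r_def pq)
      finally show ?thesis using r0[OF that] by simp
    qed
    define e where "e = lc (1 / of_real (nm z)) z 0 z"
    have "ip (S h e) v = p * ip e v" if "v \<in> X" for v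
      using that zX h eig[OF that] by (simp add: e_def S_lc)
    moreover have "e \<in> isometric_part" "nm e = 1"
      unfolding e_def using zV isometric_part_lc unit_multiple[OF zX pos] by auto
    ultimately show ?thesis using that by blast
  qed
qed

lemma eigenvector_iterate:
  assumes h: "0 \<le> h" and e: "e \<in> isometric_part" "nm e = 1" and eig: "\<And>v. v \<in> X \<Longrightarrow> ip (S h e) v = a * ip e v"
  shows "cmod (ip (S (real m * h) e) e) = 1"
proof -
  have eX: "e \<in> X" using isometric_partD(1)[OF e(1)] .
  have a: "cmod a = 1"
  proof -
    have "ip (S h e) (S h e) = a * cnj a * ip e e"
      using eig[of "S h e"] eig[OF eX] ip_cnj[of "S h e" e] eX h ip_self[OF eX] by simp
    then have "a * cnj a = 1"
      using isometric_partD(2)[OF e(1) h eX] ip_self[OF eX] e(2) by simp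
    then show ?thesis
      by (metis abs_norm_cancel complex_mod_mult_cnj norm_one real_sqrt_abs real_sqrt_one)
  qed
  have "eqv (S (real m * h) e) (lc (a ^ m) e 0 e)"
  proof (induction m)
    case 0
    then show ?case using S_0[OF eX] eX by (simp add: eqv_def)
  next
    case (Suc m)
    have mh: "0 \<le> real m * h" using h by simp
    have "eqv (S (real (Suc m) * h) e) (S h (S (real m * h) e))"
      using S_add_eqv[OF h mh eX] by (simp add: algebra_simps)
    moreover have "eqv (S h (S (real m * h) e)) (S h (lc (a ^ m) e 0 e))"
      using Suc.IH h mh eX by (intro S_eqv) auto
    moreover have "eqv (S h (lc (a ^ m) e 0 e)) (lc (a ^ Suc m) e 0 e)"
      using eig eX h by (simp add: eqv_def S_lc)
    ultimately show ?case using eqv_trans by blast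
  qed
  then have "ip (S (real m * h) e) e = a ^ m"
    using eX ip_self[OF eX] e(2) by (simp add: eqv_def)
  then show ?thesis by (simp add: norm_power a)
qed

text \<open>Unit eigenvectors \<open>e\<^sub>k\<close> of \<open>S h\<close> for \<open>h = 1 / (k + 1)\<close> satisfy \<open>\<bar>\<langle>S t e\<^sub>k, e\<^sub>k\<rangle>\<bar> = 1\<close> at all multiples \<open>t\<close> of \<open>h\<close>. These multiples become dense,
so a limit point \<open>y\<close> of \<open>S 1 e\<^sub>k\<close> satisfies \<open>\<bar>\<langle>S t y, y\<rangle>\<bar> = 1\<close> for every \<open>t\<close>. This is the equality case of
Cauchy-Schwarz, which makes \<open>S t y\<close> a multiple of \<open>y\<close>.\<close>

lemma joint_eigenvector:
  assumes cpt: S1_compact and w: "w \<in> isometric_part" "nm w = 1"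
  obtains y where "y \<in> isometric_part" "nm y = 1" "\<And>t. 0 \<le> t \<Longrightarrow> cmod (ip (S t y) y) = 1"
    "\<And>t v. 0 \<le> t \<Longrightarrow> v \<in> X \<Longrightarrow> ip (S t y) v = ip (S t y) y * ip y v"
proof -
  define h where "h k = 1 / real (Suc k)" for k
  have hpos: "0 < h k" for k by (simp add: h_def)
  have "\<exists>e a. e \<in> isometric_part \<and> nm e = 1 \<and> (\<forall>v\<in>X. ip (S (h k) e) v = a * ip e v)" for k
    using isometric_eigenvector[OF cpt less_imp_le[OF hpos[of k]] w] by metis
  then obtain e a where e: "\<And>k. e k \<in> isometric_part" "\<And>k. nm (e k) = 1"
    "\<And>k v. v \<in> X \<Longrightarrow> ip (S (h k) (e k)) v = a k * ip (e k) v"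
    by metis
  note eX = isometric_partD(1)[OF e(1)]
  obtain r y where r: "strict_mono (r :: nat \<Rightarrow> nat)" "y \<in> isometric_part" "nm y = 1" "tends (\<lambda>n. S 1 (e (r n))) y"
    using isometric_part_compact[OF cpt e(1,2)] .
  note yX = isometric_partD(1)[OF r(2)]
  have c1: "cmod (ip (S t y) y) = 1" if t: "0 \<le> t" for t
  proof -
    define m where "m n = nat \<lfloor>t / h (r n)\<rfloor>" for n
    define tn where "tn n = real (m n) * h (r n)" for n
    have tn0: "0 \<le> tn n" for n using hpos[of "r n"] by (simp add: tn_def)
    have bd: "\<bar>tn n - t\<bar> \<le> h (r n)" for n
    proof -
      have m: "real (m n) = of_int \<lfloor>t / h (r n)\<rfloor>"
        using t hpos[of "r n"] by (simp add: m_def)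
      have "real (m n) \<le> t / h (r n)" "t / h (r n) \<le> real (m n) + 1"
        unfolding m by linarith+
      then show ?thesis
        using hpos[of "r n"] by (simp add: tn_def field_simps)
    qed
    have "(\<lambda>n. h (r n)) \<longlonglongrightarrow> 0"
      using LIMSEQ_subseq_LIMSEQ[OF lim_1_over_n[THEN LIMSEQ_Suc] r(1)] by (simp add: o_def h_def)
    then have "(\<lambda>n. tn n - t) \<longlonglongrightarrow> 0"
      using bd by (intro Lim_null_comparison[where f = "\<lambda>n. tn n - t"]) auto
    then have tn: "tn \<longlonglongrightarrow> t" by (simp add: LIM_zero_iff)
    have "tends (\<lambda>n. S (tn n) (S 1 (e (r n)))) (S t y)"
      using tn tn0 t r(4) eX yX by (intro S_jointly_continuous) auto
    then have "(\<lambda>n. ip (S (tn n) (S 1 (e (r n)))) (S 1 (e (r n)))) \<longlonglongrightarrow> ip (S t y) y"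
      using r(4) eX yX t tn0 by (intro tends_ip) auto
    then have "(\<lambda>n. cmod (ip (S (tn n) (S 1 (e (r n)))) (S 1 (e (r n))))) \<longlonglongrightarrow> cmod (ip (S t y) y)"
      by (rule tendsto_norm)
    moreover have "cmod (ip (S (tn n) (S 1 (e (r n)))) (S 1 (e (r n)))) = 1" for n
    proof -
      let ?e = "e (r n)"
      have "eqv (S (tn n) (S 1 ?e)) (S 1 (S (tn n) ?e))"
        using S_add_eqv[of "tn n" 1 ?e] S_add_eqv[of 1 "tn n" ?e] eX tn0[of n] eqv_sym eqv_trans
        by (metis add.commute zero_le_one)
      then have "ip (S (tn n) (S 1 ?e)) (S 1 ?e) = ip (S (tn n) ?e) ?e"
        using isometric_partD(2)[OF isometric_part_S[OF e(1) tn0], of 1] eX by (simp add: eqv_def)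
      then show ?thesis
        using eigenvector_iterate[OF less_imp_le[OF hpos] e(1,2,3)] by (simp add: tn_def)
    qed
    ultimately show ?thesis by (simp add: LIMSEQ_const_iff)
  qed
  have "ip (S t y) v = ip (S t y) y * ip y v" if t: "0 \<le> t" and v: "v \<in> X" for t v
  proof -
    define c where "c = ip (S t y) y"
    define d where "d = lc 1 (S t y) (- c) y"
    have "(nm d)\<^sup>2 = 1 + 1 + 2 * Re (- (cnj c * c))"
      unfolding d_def using yX t isometric_partD(3)[OF r(2) t] r(3) c1[OF t]
      by (subst nm_lc_power2) (auto simp: c_def[symmetric])
    also have "cnj c * c = 1"
      using c1[OF t] by (metis c_def complex_norm_square mult.commute of_real_1 power_one)
    finally have "nm d = 0" by simp
    then show ?thesis
      using ip_null[of d v] yX t v by (simp add: d_def c_def)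
  qed
  then show ?thesis using that r c1 by blast
qed

text \<open>If some \<open>S n\<close> has norm below one, iteration gives decay. Otherwise there are unit vectors \<open>u\<^sub>n\<close> with
\<open>\<parallel>S (n + 1) u\<^sub>n\<parallel> \<rightarrow> 1\<close>, and a limit point of \<open>S 1 u\<^sub>n\<close> lies in the isometric part. The second
alternative says that \<open>y\<close> is in the domain of the generator with eigenvalue \<open>l\<close>, phrased as convergence of the difference
quotients.\<close>

theorem decay_or_eigenvector:
  assumes cpt: S1_compact
  shows "(\<exists>C>0. \<exists>\<mu>>0. \<forall>u\<in>X. \<forall>t\<ge>0. nm (S t u) \<le> C * nm u * exp (- \<mu> * t)) \<or>
    (\<exists>y\<in>X. \<exists>l. nm y = 1 \<and> Re l = 0 \<and>
      ((\<lambda>h. nm (lc (1 / of_real h) (S h y) (- (1 / of_real h) - l) y)) \<longlongrightarrow> 0) (at_right 0))"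
proof (cases "\<exists>n q. 0 < n \<and> 0 < q \<and> q < 1 \<and> (\<forall>u\<in>X. nm (S (real n) u) \<le> q * nm u)")
  case True
  then obtain n :: nat and q where n: "0 < n" and q: "0 < q" "q < 1"
    and le: "\<And>u. u \<in> X \<Longrightarrow> nm (S (real n) u) \<le> q * nm u"
    by blast
  have pow: "nm (S (real k * real n) u) \<le> q ^ k * nm u" if "u \<in> X" for k u
  proof (induction k)
    case 0 then show ?case using S_contraction[of 0 u] that by simp
  next
    case (Suc k)
    have "nm (S (real (Suc k) * real n) u) = nm (S (real n) (S (real k * real n) u))"
      using eqv_nm[OF S_add_eqv[of "real n" "real k * real n" u]] that by (simp add: algebra_simps)
    also have "\<dots> \<le> q * nm (S (real k * real n) u)" using le that by simp
    also have "\<dots> \<le> q * (q ^ k * nm u)" using Suc.IH q by simp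
    finally show ?case by simp
  qed
  define \<mu> where "\<mu> = - ln q / real n"
  have mu: "\<mu> > 0" using n q by (simp add: \<mu>_def field_simps)
  have "nm (S t u) \<le> (1 / q) * nm u * exp (- \<mu> * t)" if u: "u \<in> X" and t: "t \<ge> 0" for u t
  proof -
    define k where "k = nat \<lfloor>t / real n\<rfloor>"
    have k: "real k \<le> t / real n" "t / real n \<le> real k + 1"
      using t by (auto simp: k_def)
    have "nm (S t u) \<le> nm (S (real k * real n) u)"
      using k(1) n u by (intro nm_S_antimono) (auto simp: field_simps)
    also have "\<dots> \<le> q ^ k * nm u" by (rule pow[OF u])
    also have "q ^ k = exp (real k * ln q)" using q by (simp add: exp_of_nat_mult)
    also have "real k * ln q \<le> (t / real n - 1) * ln q"
      using k(2) q by (intro mult_right_mono_neg) auto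
    also have "(t / real n - 1) * ln q = - \<mu> * t - ln q"
      by (simp add: \<mu>_def algebra_simps)
    also have "exp (- \<mu> * t - ln q) = (1 / q) * exp (- \<mu> * t)"
      using q by (simp add: exp_diff)
    finally show ?thesis
      using nm_nonneg[OF u] by (simp add: mult_right_mono mult.commute mult.left_commute)
  qed
  then show ?thesis
    using q mu by (intro disjI1 exI[of _ "1 / q"] conjI exI[of _ \<mu>]) auto
next
  case False
  have "\<exists>u\<in>X. nm u = 1 \<and> 1 - 1 / real (n + 2) < nm (S (real (Suc n)) u)" for n
  proof -
    \<comment> \<open>any factors in \<open>(0,1)\<close> that tend to \<open>1\<close> would do\<close>
    define q where "q = 1 - 1 / real (n + 2)"
    have "0 < q" "q < 1" by (auto simp: q_def)
    then obtain u where u: "u \<in> X" "q * nm u < nm (S (real (Suc n)) u)"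
      using False by (metis not_le zero_less_Suc)
    have pos: "nm u > 0"
    proof (rule ccontr)
      assume "\<not> 0 < nm u"
      then have "nm u = 0" using nm_nonneg[OF u(1)] by linarith
      then show False using u S_contraction[of "real (Suc n)" u] by simp
    qed
    define v where "v = lc (1 / of_real (nm u)) u 0 u"
    have "nm (S (real (Suc n)) v) = nm (lc (1 / of_real (nm u)) (S (real (Suc n)) u) 0 (S (real (Suc n)) u))"
      unfolding v_def using u by (intro eqv_nm S_lc_eqv S_mem lc_mem) auto
    also have "\<dots> = nm (S (real (Suc n)) u) / nm u"
    proof (rule power2_eq_imp_eq)
      show "(nm (lc (1 / of_real (nm u)) (S (real (Suc n)) u) 0 (S (real (Suc n)) u)))\<^sup>2
          = (nm (S (real (Suc n)) u) / nm u)\<^sup>2"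
        using u pos by (subst nm_lc_power2) (auto simp: norm_divide power_divide)
    qed (use u in auto)
    finally have "q < nm (S (real (Suc n)) v)" using u(2) pos by (simp add: pos_less_divide_eq)
    then show ?thesis
      using unit_multiple[OF u(1) pos] u(1) by (intro bexI[of _ v]) (auto simp: v_def q_def)
  qed
  then obtain u where u: "\<And>n. u n \<in> X" "\<And>n. nm (u n) = 1"
    "\<And>n. 1 - 1 / real (n + 2) < nm (S (real (Suc n)) (u n))"
    by metis
  obtain r w where r: "strict_mono (r :: nat \<Rightarrow> nat)" and w: "w \<in> X" "tends (\<lambda>n. S 1 (u (r n))) w"
    using cpt[unfolded S1_compact_def, rule_format, of u] u by auto
  have lim1: "(\<lambda>n. 1 - 1 / real (r n + 2)) \<longlonglongrightarrow> 1"
  proof -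
    have "(\<lambda>n. 1 - 1 / real (n + 2)) \<longlonglongrightarrow> 1" by real_asymp
    from LIMSEQ_subseq_LIMSEQ[OF this r] show ?thesis by (simp add: o_def)
  qed
  have norm1: "nm (S t w) = 1" if t: "0 \<le> t" for t
  proof -
    have lim: "(\<lambda>n. nm (S t (S 1 (u (r n))))) \<longlonglongrightarrow> nm (S t w)"
      using w u t by (intro tends_nm tends_S) auto
    have "\<forall>\<^sub>F n in sequentially. 1 - 1 / real (r n + 2) \<le> nm (S t (S 1 (u (r n))))"
    proof (rule eventually_sequentiallyI[of "nat \<lceil>t\<rceil>"])
      fix n assume "nat \<lceil>t\<rceil> \<le> n"
      then have "t \<le> real n" by linarith
      also have "n \<le> r n" using seq_suble[OF r] .
      finally have "nm (S (real (Suc (r n))) (u (r n))) \<le> nm (S (t + 1) (u (r n)))"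
        using t u by (intro nm_S_antimono) auto
      also have "\<dots> = nm (S t (S 1 (u (r n))))"
        using t u by (intro eqv_nm S_add_eqv) auto
      finally show "1 - 1 / real (r n + 2) \<le> nm (S t (S 1 (u (r n))))"
        using u(3)[of "r n"] by simp
    qed
    then have "1 \<le> nm (S t w)"
      by (intro tendsto_le[OF _ lim lim1]) auto
    moreover have "nm (S t (S 1 (u (r n)))) \<le> 1" for n
      using S_contraction[of t "S 1 (u (r n))"] S_contraction[of 1 "u (r n)"] u t by (smt (verit) S_mem)
    then have "nm (S t w) \<le> 1"
      using LIMSEQ_le_const2[OF lim] by blast
    ultimately show ?thesis by simp
  qed
  have "nm w = 1"
    using norm1[of 0] eqv_nm[of "S 0 w" w] S_0[of w] w by (simp add: eqv_def)
  then have wI: "w \<in> isometric_part"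
    using norm1 w by (intro isometric_partI) auto
  obtain y where y: "y \<in> isometric_part" "nm y = 1" "\<And>t. 0 \<le> t \<Longrightarrow> cmod (ip (S t y) y) = 1"
    "\<And>t v. 0 \<le> t \<Longrightarrow> v \<in> X \<Longrightarrow> ip (S t y) v = ip (S t y) y * ip y v"
    using joint_eigenvector[OF cpt wI \<open>nm w = 1\<close>] by metis
  note yX = isometric_partD(1)[OF y(1)]
  define c where "c t = ip (S t y) y" for t
  have c: "ip (S t y) v = c t * ip y v" if "0 \<le> t" "v \<in> X" for t v
    unfolding c_def using that by (rule y(4))
  have c0: "c 0 = 1" using S_0[OF yX yX] ip_self[OF yX] y(2) by (simp add: c_def)
  have mult: "c (s + t) = c s * c t" if s: "0 \<le> s" and t: "0 \<le> t" for s t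
  proof -
    have "eqv (S t y) (lc (c t) y 0 y)"
      unfolding eqv_def using t yX by (simp add: c)
    then have "eqv (S s (S t y)) (S s (lc (c t) y 0 y))"
      using s t yX by (intro S_eqv) auto
    then have "ip (S s (S t y)) y = ip (S s (lc (c t) y 0 y)) y"
      using yX by (simp add: eqv_def)
    also have "\<dots> = c t * ip (S s y) y"
      using s yX by (subst S_lc) auto
    finally show ?thesis
      unfolding c_def[of "s + t"] c_def[of s] using S_add[OF s t yX yX] by simp
  qed
  have cont: "continuous_on {0..} c"
    unfolding continuous_on_sequentially o_def c_def
    using yX by (auto intro!: tends_ip S_jointly_continuous tends_const)
  obtain l where l: "((\<lambda>h. (c h - 1) / of_real h) \<longlongrightarrow> l) (at_right 0)"
    using multiplicative_right_differentiable[OF cont c0 mult] by blast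
  have "((\<lambda>h. ((c h - 1) / of_real h) * cnj (c h) + cnj ((c h - 1) / of_real h)) \<longlongrightarrow> l * cnj (c 0) + cnj l) (at_right 0)"
  proof (intro tendsto_intros l)
    show "(c \<longlongrightarrow> c 0) (at_right 0)"
      using cont[unfolded continuous_on_def, rule_format, of 0] by (simp add: at_within_Ici_at_right)
  qed
  moreover have "\<forall>\<^sub>F h in at_right 0. ((c h - 1) / of_real h) * cnj (c h) + cnj ((c h - 1) / of_real h) = 0"
    unfolding eventually_at_right_field
  proof (intro exI[of _ 1] conjI allI impI)
    fix h :: real assume h: "0 < h" "h < 1"
    have "c h * cnj (c h) = 1"
      using y(3)[of h] h by (simp add: c_def complex_norm_square[symmetric] del: of_real_power)
    then have "((c h - 1) * cnj (c h) + (cnj (c h) - 1)) / of_real h = 0"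
      by (simp add: algebra_simps)
    then show "((c h - 1) / of_real h) * cnj (c h) + cnj ((c h - 1) / of_real h) = 0"
      by (simp add: add_divide_distrib)
  qed simp
  ultimately have "((\<lambda>h. 0) \<longlongrightarrow> l * cnj (c 0) + cnj l) (at_right (0::real))"
    using tendsto_cong by fast
  then have "l + cnj l = 0"
    using c0 by (simp add: tendsto_const_iff)
  then have Rel: "Re l = 0" by (simp add: complex_add_cnj)
  have nmc: "nm (lc (1 / of_real h) (S h y) (- (1 / of_real h) - l) y) = cmod ((c h - 1) / of_real h - l)" if h: "0 < h" for h
  proof -
    have "eqv (lc (1 / of_real h) (S h y) (- (1 / of_real h) - l) y) (lc ((c h - 1) / of_real h - l) y 0 y)"
    proof -
      have "ip (lc (1 / of_real h) (S h y) (- (1 / of_real h) - l) y) v = ip (lc ((c h - 1) / of_real h - l) y 0 y) v"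
        if v: "v \<in> X" for v
      proof -
        have hy: "ip (S h y) v = c h * ip y v"
          using h v by (intro c) auto
        show ?thesis
          using yX h v by (simp add: hy algebra_simps diff_divide_distrib)
      qed
      then show ?thesis by (simp add: eqv_def)
    qed
    then have "nm (lc (1 / of_real h) (S h y) (- (1 / of_real h) - l) y) = nm (lc ((c h - 1) / of_real h - l) y 0 y)"
      using yX h by (intro eqv_nm) auto
    also have "\<dots> = cmod ((c h - 1) / of_real h - l)"
      by (rule power2_eq_imp_eq) (use yX y(2) in \<open>auto simp: nm_lc_power2\<close>)
    finally show ?thesis .
  qed
  have "((\<lambda>h. cmod ((c h - 1) / of_real h - l)) \<longlongrightarrow> 0) (at_right 0)"
    using l by (intro tendsto_norm_zero) (simp add: LIM_zero_iff)
  moreover have "\<forall>\<^sub>F h in at_right 0. nm (lc (1 / of_real h) (S h y) (- (1 / of_real h) - l) y) = cmod ((c h - 1) / of_real h - l)"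
    using nmc by (auto simp: eventually_at_right_field intro: exI[of _ 1])
  ultimately have "((\<lambda>h. nm (lc (1 / of_real h) (S h y) (- (1 / of_real h) - l) y)) \<longlongrightarrow> 0) (at_right 0)"
    using tendsto_cong by fast
  then show ?thesis
    using yX y(2) Rel by blast
qed

definition gen :: "'v \<Rightarrow> 'v \<Rightarrow> bool" where
  "gen u v \<longleftrightarrow> u \<in> X \<and> v \<in> X \<and>
    ((\<lambda>h. nm (lc 1 (lc (1 / of_real h) (S h u) (- (1 / of_real h)) u) (- 1) v)) \<longlongrightarrow> 0) (at_right 0)"

lemma S_commute_eqv: "0 \<le> s \<Longrightarrow> 0 \<le> t \<Longrightarrow> u \<in> X \<Longrightarrow> eqv (S s (S t u)) (S t (S s u))"
  using S_add_eqv[of s t u] S_add_eqv[of t s u] eqv_sym eqv_trans by (metis add.commute)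

lemma gen_S:
  assumes g: "gen u v" and t: "0 \<le> t"
  shows "gen (S t u) (S t v)"
proof -
  have X: "u \<in> X" "v \<in> X" using g by (auto simp: gen_def)
  define E where "E h = lc 1 (lc (1 / of_real h) (S h u) (- (1 / of_real h)) u) (- 1) v" for h
  define E' where "E' h = lc 1 (lc (1 / of_real h) (S h (S t u)) (- (1 / of_real h)) (S t u)) (- 1) (S t v)" for h
  have "nm (E' h) \<le> nm (E h)" if h: "0 < h" for h
  proof -
    have EX: "E h \<in> X" "E' h \<in> X" unfolding E_def E'_def using X h t by auto
    have "eqv (E' h) (S t (E h))"
      unfolding eqv_def
    proof
      fix w assume w: "w \<in> X"
      have "ip (S h (S t u)) w = ip (S t (S h u)) w"
        using S_commute_eqv[of h t u] h t X w by (simp add: eqv_def)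
      then show "ip (E' h) w = ip (S t (E h)) w"
        unfolding E_def E'_def using X h t w by (simp add: S_lc)
    qed
    then have "nm (E' h) = nm (S t (E h))" using EX t by (intro eqv_nm) auto
    then show ?thesis using S_contraction[OF t EX(1)] by simp
  qed
  then have ev: "\<forall>\<^sub>F h in at_right 0. norm (nm (E' h)) \<le> nm (E h)"
    unfolding eventually_at_right_field E'_def using X t by (intro exI[of _ 1]) auto
  have "((\<lambda>h. nm (E h)) \<longlongrightarrow> 0) (at_right 0)" using g by (simp add: gen_def E_def)
  then have "((\<lambda>h. nm (E' h)) \<longlongrightarrow> 0) (at_right 0)" by (rule Lim_null_comparison[OF ev])
  then show ?thesis using X t by (simp add: gen_def E'_def)
qed

end

section \<open>Differentiating quadratic forms along the semigroup\<close>

text \<open>A second semi-inner product \<open>b\<close> on the same vectors, dominated by the first: in the application, the inner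
product with a weight.\<close>

locale bounded_form = contraction_semigroup X lc ip S + B: semi_inner_space X lc b
  for X :: "'v set" and lc ip S b +
  fixes M :: real
  assumes M_pos: "0 \<le> M" and b_bound: "u \<in> X \<Longrightarrow> B.nm u \<le> M * nm u"
begin

lemma b_eqv: "eqv u v \<Longrightarrow> u \<in> X \<Longrightarrow> v \<in> X \<Longrightarrow> b u u = b v v"
proof -
  assume e: "eqv u v" and X: "u \<in> X" "v \<in> X"
  have "B.nm (df u v) \<le> 0"
    using b_bound[of "df u v"] e X eqv_iff_nm[of u v] by auto
  moreover have "0 \<le> B.nm (df u v)" using X by (intro B.nm_nonneg) auto
  ultimately have "B.nm (df u v) = 0" by linarith
  then have z: "b (df u v) w = 0" if "w \<in> X" for w
    using B.ip_null[of "df u v" w] X that by auto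
  have "b u u = b v u" using z[of u] X by simp
  also have "b v u = b v v" using z[of v] X B.ip_cnj[of u v] B.ip_cnj[of v v] by simp
  finally show ?thesis .
qed

lemma form_continuous:
  assumes u: "u \<in> X"
  shows "continuous_on {0..} (\<lambda>t. Re (b (S t u) (S t u)))"
proof -
  have "(\<lambda>n. b (S (t n) u) (S (t n) u)) \<longlonglongrightarrow> b (S t0 u) (S t0 u)"
    if t: "\<And>n. 0 \<le> t n" "0 \<le> t0" "t \<longlonglongrightarrow> t0" for t t0
  proof -
    have T: "tends (\<lambda>n. S (t n) u) (S t0 u)"
      using t u by (intro S_jointly_continuous tends_const) auto
    then have "(\<lambda>n. M * nm (df (S (t n) u) (S t0 u))) \<longlonglongrightarrow> M * 0"
      unfolding tends_def by (intro tendsto_intros)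
    then have "B.tends (\<lambda>n. S (t n) u) (S t0 u)"
      unfolding B.tends_def using b_bound[of "df (S (t n) u) (S t0 u)" for n] t u
      by (intro Lim_null_comparison[where f = "\<lambda>n. B.nm (df (S (t n) u) (S t0 u))" and g = "\<lambda>n. M * nm (df (S (t n) u) (S t0 u))"])
         auto
    then show ?thesis using t u by (intro B.tends_ip) auto
  qed
  then show ?thesis
    unfolding continuous_on_sequentially o_def by (auto intro!: tendsto_Re)
qed

text \<open>Writing \<open>S h u = u + h (v + E h)\<close> with \<open>E h \<rightarrow> 0\<close> turns the difference quotient into an exact expression in \<open>E h\<close>.\<close>

lemma form_right_derivative_0:
  assumes g: "gen u v"
  shows "((\<lambda>h. (Re (b (S h u) (S h u)) - Re (b u u)) / h) \<longlongrightarrow> 2 * Re (b v u)) (at_right 0)"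
proof -
  have X: "u \<in> X" "v \<in> X" using g by (auto simp: gen_def)
  define E where "E h = lc 1 (lc (1 / of_real h) (S h u) (- (1 / of_real h)) u) (- 1) v" for h
  have EX: "E h \<in> X" if "0 < h" for h unfolding E_def using X that by auto
  have E0: "((\<lambda>h. nm (E h)) \<longlongrightarrow> 0) (at_right 0)" using g by (simp add: gen_def E_def)
  have bE0: "((\<lambda>h. B.nm (E h)) \<longlongrightarrow> 0) (at_right 0)"
  proof (rule Lim_null_comparison)
    show "\<forall>\<^sub>F h in at_right 0. norm (B.nm (E h)) \<le> M * nm (E h)"
      unfolding eventually_at_right_field using EX b_bound by (intro exI[of _ 1]) auto
    show "((\<lambda>h. M * nm (E h)) \<longlongrightarrow> 0) (at_right 0)" using tendsto_mult_left[OF E0, of M] by simp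
  qed
  define R where "R h = 2 * Re (b v u) + 2 * Re (b (E h) u) + h * Re (b (lc 1 v 1 (E h)) (lc 1 v 1 (E h)))" for h
  have eq: "(Re (b (S h u) (S h u)) - Re (b u u)) / h = R h" if h: "0 < h" for h
  proof -
    define w where "w = lc 1 v 1 (E h)"
    have wX: "w \<in> X" and SX: "S h u \<in> X" unfolding w_def using X EX[OF h] h by auto
    have w: "b w z = (b (S h u) z - b u z) / of_real h" if "z \<in> X" for z
      unfolding w_def E_def using X h that by (simp add: diff_divide_distrib)
    have "b w w = (b (S h u) w - b u w) / of_real h" by (rule w[OF wX])
    moreover have "b (S h u) w = cnj (b w (S h u))" "b u w = cnj (b w u)"
      using B.ip_cnj[OF wX SX] B.ip_cnj[OF wX X(1)] by auto
    ultimately have ww: "b w w = (cnj ((b (S h u) (S h u) - b u (S h u)) / of_real h) - cnj ((b (S h u) u - b u u) / of_real h)) / of_real h"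
      using w[OF SX] w[OF X(1)] by simp
    have "2 * Re (b v u) + 2 * Re (b (E h) u) = 2 * Re (b w u)" unfolding w_def using X EX[OF h] by simp
    also have "\<dots> = 2 * (Re (b (S h u) u) - Re (b u u)) / h" using w[OF X(1)] by simp
    finally have 1: "2 * Re (b v u) + 2 * Re (b (E h) u) = 2 * (Re (b (S h u) u) - Re (b u u)) / h" .
    have "Re (b u (S h u)) = Re (b (S h u) u)" using B.ip_cnj[OF SX X(1)] by simp
    then have "h * Re (b w w) = (Re (b (S h u) (S h u)) - 2 * Re (b (S h u) u) + Re (b u u)) / h"
      unfolding ww using h by (simp add: field_simps)
    then show ?thesis
      unfolding R_def 1 using h by (simp add: w_def[symmetric] field_simps)
  qed
  have "(R \<longlongrightarrow> 2 * Re (b v u) + 2 * 0 + 0) (at_right 0)"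
  proof -
    have 1: "((\<lambda>h. Re (b (E h) u)) \<longlongrightarrow> 0) (at_right 0)"
    proof (rule Lim_null_comparison)
      show "\<forall>\<^sub>F h in at_right 0. norm (Re (b (E h) u)) \<le> B.nm (E h) * B.nm u"
        unfolding eventually_at_right_field
      proof (intro exI[of _ 1] conjI allI impI)
        fix h :: real assume "0 < h" "h < 1"
        then show "norm (Re (b (E h) u)) \<le> B.nm (E h) * B.nm u"
          using B.Cauchy_Schwarz[OF EX X(1), of h] abs_Re_le_cmod[of "b (E h) u"] by simp
      qed simp
      show "((\<lambda>h. B.nm (E h) * B.nm u) \<longlongrightarrow> 0) (at_right 0)" using tendsto_mult_right[OF bE0, of "B.nm u"] by simp
    qed
    have 2: "((\<lambda>h. h * Re (b (lc 1 v 1 (E h)) (lc 1 v 1 (E h)))) \<longlongrightarrow> 0) (at_right 0)"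
    proof (rule Lim_null_comparison)
      show "\<forall>\<^sub>F h in at_right 0. norm (h * Re (b (lc 1 v 1 (E h)) (lc 1 v 1 (E h)))) \<le> h * (B.nm v + B.nm (E h))\<^sup>2"
        unfolding eventually_at_right_field
      proof (intro exI[of _ 1] conjI allI impI)
        fix h :: real assume h: "0 < h" "h < 1"
        have wX: "lc 1 v 1 (E h) \<in> X" using X EX h by auto
        have "(B.nm (lc 1 v 1 (E h)))\<^sup>2 \<le> (B.nm v + B.nm (E h))\<^sup>2"
          using B.nm_lc_le[of v "E h" 1 1] X EX h wX by (intro power_mono) auto
        then show "norm (h * Re (b (lc 1 v 1 (E h)) (lc 1 v 1 (E h)))) \<le> h * (B.nm v + B.nm (E h))\<^sup>2"
          using B.nm_power2[OF wX] B.ip_self_nonneg[OF wX] h by (simp add: abs_mult mult_left_mono)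
      qed simp
      have "((\<lambda>h. h * (B.nm v + B.nm (E h))\<^sup>2) \<longlongrightarrow> 0 * (B.nm v + 0)\<^sup>2) (at_right 0)"
        by (intro tendsto_intros bE0)
      then show "((\<lambda>h. h * (B.nm v + B.nm (E h))\<^sup>2) \<longlongrightarrow> 0) (at_right 0)" by simp
    qed
    show ?thesis unfolding R_def by (intro tendsto_add tendsto_mult tendsto_const 1 2)
  qed
  then have Rl: "(R \<longlongrightarrow> 2 * Re (b v u)) (at_right 0)" by simp
  have "\<forall>\<^sub>F h in at_right 0. (Re (b (S h u) (S h u)) - Re (b u u)) / h = R h"
    unfolding eventually_at_right_field using eq by (intro exI[of _ 1]) auto
  then show ?thesis using Rl tendsto_cong by fast
qed

lemma form_right_derivative:
  assumes "u \<in> X" and g: "gen (S t u) v" and t: "0 \<le> t"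
  shows "((\<lambda>h. (Re (b (S (t + h) u) (S (t + h) u)) - Re (b (S t u) (S t u))) / h) \<longlongrightarrow> 2 * Re (b v (S t u))) (at_right 0)"
proof -
  have "\<forall>\<^sub>F h in at_right 0. (Re (b (S h (S t u)) (S h (S t u))) - Re (b (S t u) (S t u))) / h
      = (Re (b (S (t + h) u) (S (t + h) u)) - Re (b (S t u) (S t u))) / h"
    unfolding eventually_at_right_field
  proof (intro exI[of _ 1] conjI allI impI)
    fix h :: real assume "0 < h" "h < 1"
    then have "b (S h (S t u)) (S h (S t u)) = b (S (t + h) u) (S (t + h) u)"
      using b_eqv[OF S_add_eqv[of h t u]] assms by (simp add: add.commute)
    then show "(Re (b (S h (S t u)) (S h (S t u))) - Re (b (S t u) (S t u))) / h
      = (Re (b (S (t + h) u) (S (t + h) u)) - Re (b (S t u) (S t u))) / h" by simp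
  qed simp
  then show ?thesis using form_right_derivative_0[OF g] tendsto_cong by fast
qed

end

section \<open>Integrals over an interval\<close>

lemma integrable_interval_iff:
  fixes f :: "real \<Rightarrow> 'a::euclidean_space"
  shows "integrable (interval_measure a) f \<longleftrightarrow> f absolutely_integrable_on {0..a}"
proof -
  have "integrable (interval_measure a) f \<longleftrightarrow> f absolutely_integrable_on {0<..<a}"
    by (simp add: integrable_restrict_space set_integrable_def)
  also have "\<dots> \<longleftrightarrow> f absolutely_integrable_on {0..a}"
  proof (rule absolutely_integrable_spike_set_eq)
    have "{x \<in> {0..a} - {0<..<a}. f x \<noteq> 0} \<subseteq> {0, a}" by auto
    then show "negligible {x \<in> {0..a} - {0<..<a}. f x \<noteq> 0}"
      by (rule negligible_subset[rotated]) simp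
    have e: "{x \<in> {0<..<a} - {0..a}. f x \<noteq> 0} = {}" by auto
    show "negligible {x \<in> {0<..<a} - {0..a}. f x \<noteq> 0}" unfolding e by simp
  qed
  finally show ?thesis .
qed

lemma integral_interval:
  fixes f :: "real \<Rightarrow> 'a::euclidean_space"
  assumes "integrable (interval_measure a) f"
  shows "(\<integral>x. f x \<partial>interval_measure a) = integral {0..a} f"
  using lebesgue_integral_eq_integral[OF assms] by (simp add: integral_open_interval_real)

text \<open>Null sets are stated over the closed interval, where the gauge integral lives; the two endpoints are absorbed
in the exceptional set.\<close>

lemma AE_interval_iff:
  "(AE x in interval_measure a. P x) \<longleftrightarrow> (\<exists>N. negligible N \<and> (\<forall>x\<in>{0..a} - N. P x))"
proof
  assume "AE x in interval_measure a. P x"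
  then have "AE x in lebesgue. x \<in> {0<..<a} \<longrightarrow> P x"
    by (simp add: AE_restrict_space_iff)
  then obtain N where sub: "{x \<in> space lebesgue. \<not> (x \<in> {0<..<a} \<longrightarrow> P x)} \<subseteq> N"
    and null: "emeasure lebesgue N = 0" "N \<in> sets lebesgue"
    by (rule AE_E)
  have N: "N \<in> null_sets lebesgue" using null by (rule null_setsI)
  have "negligible (N \<union> {0, a})"
  proof (rule negligible_Un)
    show "negligible N" using N by (rule negligible_iff_null_sets[THEN iffD2])
  qed simp
  moreover have "\<forall>x\<in>{0..a} - (N \<union> {0, a}). P x"
  proof
    fix x assume "x \<in> {0..a} - (N \<union> {0, a})"
    then have "x \<in> {0<..<a}" "x \<notin> N" by auto
    then show "P x" using sub by auto
  qed
  ultimately show "\<exists>N. negligible N \<and> (\<forall>x\<in>{0..a} - N. P x)" by blast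
next
  assume "\<exists>N. negligible N \<and> (\<forall>x\<in>{0..a} - N. P x)"
  then obtain N where N: "negligible N" "\<forall>x\<in>{0..a} - N. P x" by blast
  have "AE x in lebesgue. x \<in> {0<..<a} \<longrightarrow> P x"
  proof (rule AE_I')
    show "N \<in> null_sets lebesgue" using N(1) by (rule negligible_iff_null_sets[THEN iffD1])
    show "{x \<in> space lebesgue. \<not> (x \<in> {0<..<a} \<longrightarrow> P x)} \<subseteq> N" using N(2) by auto
  qed
  then show "AE x in interval_measure a. P x"
    by (simp add: AE_restrict_space_iff)
qed

lemma continuous_integrable_interval:
  fixes f :: "real \<Rightarrow> 'a::euclidean_space"
  shows "continuous_on {0..a} f \<Longrightarrow> integrable (interval_measure a) f"
  unfolding integrable_interval_iff by (rule absolutely_integrable_continuous_real)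

lemma L2_times_integrable:
  fixes f g :: "real \<Rightarrow> complex"
  assumes "f \<in> L2 a" "g \<in> L2 a"
  shows "integrable (interval_measure a) (\<lambda>x. f x * g x)"
proof (rule Bochner_Integration.integrable_bound)
  show "integrable (interval_measure a) (\<lambda>x. (cmod (f x))\<^sup>2 + (cmod (g x))\<^sup>2)"
    using assms by (auto simp: L2_def)
  show "(\<lambda>x. f x * g x) \<in> borel_measurable (interval_measure a)"
    using assms by (auto simp: L2_def)
  have "norm (f x * g x) \<le> norm ((cmod (f x))\<^sup>2 + (cmod (g x))\<^sup>2)" for x
  proof -
    have "0 \<le> (cmod (f x) - cmod (g x))\<^sup>2 + ((cmod (f x))\<^sup>2 + (cmod (g x))\<^sup>2)" by simp
    then show ?thesis by (simp add: norm_mult power2_eq_square algebra_simps)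
  qed
  then show "AE x in interval_measure a. norm (f x * g x) \<le> norm ((cmod (f x))\<^sup>2 + (cmod (g x))\<^sup>2)"
    by simp
qed

lemma continuous_L2: "continuous_on {0..a} f \<Longrightarrow> f \<in> L2 a"
  unfolding L2_def using continuous_integrable_interval[of a f]
  by (auto intro!: continuous_integrable_interval continuous_intros)

lemma L2_integrable: "f \<in> L2 a \<Longrightarrow> integrable (interval_measure a) f"
  using L2_times_integrable[of f a "\<lambda>_. 1"] continuous_L2[of a "\<lambda>_. 1"] by simp

lemma L2_cong_AE:
  assumes "f \<in> L2 a" "AE x in interval_measure a. f x = g x"
  shows "g \<in> L2 a"
proof -
  have g: "g \<in> borel_measurable (interval_measure a)"
  proof -
    have "(\<lambda>x. if x \<in> {0<..<a} then f x else 0) \<in> borel_measurable lebesgue"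
      using assms by (intro borel_measurable_if_I) (auto simp: L2_def)
    then have "(\<lambda>x. if x \<in> {0<..<a} then g x else 0) \<in> borel_measurable lebesgue"
    proof (rule borel_measurable_AE)
      show "AE x in lebesgue. (if x \<in> {0<..<a} then f x else 0) = (if x \<in> {0<..<a} then g x else 0)"
        using assms(2) by (subst (asm) AE_restrict_space_iff) (auto elim: AE_mp)
    qed
    then show ?thesis by (rule borel_measurable_if_D)
  qed
  have "integrable (interval_measure a) (\<lambda>x. (cmod (f x))\<^sup>2) \<longleftrightarrow> integrable (interval_measure a) (\<lambda>x. (cmod (g x))\<^sup>2)"
    using assms g by (intro integrable_cong_AE) (auto simp: L2_def elim: AE_mp)
  then show ?thesis using assms g by (simp add: L2_def)
qed

lemma L2_lincomb:
  assumes "f \<in> L2 a" "g \<in> L2 a"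
  shows "(\<lambda>x. c * f x + d * g x) \<in> L2 a"
proof -
  have meas: "(\<lambda>x. c * f x + d * g x) \<in> borel_measurable (interval_measure a)"
    using assms by (auto simp: L2_def)
  have "integrable (interval_measure a) (\<lambda>x. 2 * (cmod c)\<^sup>2 * (cmod (f x))\<^sup>2 + 2 * (cmod d)\<^sup>2 * (cmod (g x))\<^sup>2)"
    using assms by (auto simp: L2_def)
  then have "integrable (interval_measure a) (\<lambda>x. (cmod (c * f x + d * g x))\<^sup>2)"
  proof (rule Bochner_Integration.integrable_bound)
    have "(cmod (c * f x + d * g x))\<^sup>2 \<le> 2 * (cmod c)\<^sup>2 * (cmod (f x))\<^sup>2 + 2 * (cmod d)\<^sup>2 * (cmod (g x))\<^sup>2" for x
    proof -
      have "(cmod (c * f x + d * g x))\<^sup>2 \<le> (cmod (c * f x) + cmod (d * g x))\<^sup>2"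
        by (intro power_mono norm_triangle_ineq) simp
      also have "\<dots> \<le> 2 * (cmod (c * f x))\<^sup>2 + 2 * (cmod (d * g x))\<^sup>2"
        using sum_squares_bound[of "cmod (c * f x)" "cmod (d * g x)"] by (simp add: power2_sum)
      finally show ?thesis by (simp add: norm_mult power_mult_distrib)
    qed
    then show "AE x in interval_measure a. norm ((cmod (c * f x + d * g x))\<^sup>2)
        \<le> norm (2 * (cmod c)\<^sup>2 * (cmod (f x))\<^sup>2 + 2 * (cmod d)\<^sup>2 * (cmod (g x))\<^sup>2)"
      by simp
  qed (use meas in measurable)
  then show ?thesis using meas by (simp add: L2_def)
qed

text \<open>Lebesgue differentiation of the indefinite integral.\<close>

lemma AE_zero_of_integral_zero:
  fixes h :: "real \<Rightarrow> 'a::euclidean_space"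
  assumes h: "integrable (interval_measure a) h"
    and 0: "\<And>p q. 0 < p \<Longrightarrow> p < q \<Longrightarrow> q < a \<Longrightarrow> integral {p..q} h = 0"
  shows "AE x in interval_measure a. h x = 0"
proof -
  define k where "k x = (if x \<in> {0..a} then h x else 0)" for x
  have kint: "k integrable_on UNIV"
    unfolding k_def integrable_restrict_UNIV using h by (simp add: integrable_interval_iff absolutely_integrable_on_def)
  have "k integrable_on cbox c d" for c d
    by (rule integrable_on_subcbox[OF kint]) simp
  then obtain N where N: "negligible N"
    "\<And>x e. x \<notin> N \<Longrightarrow> 0 < e \<Longrightarrow> \<exists>d>0. \<forall>s. 0 < s \<and> s < d \<longrightarrow> norm (integral (cbox x (x + s *\<^sub>R One)) k /\<^sub>R s ^ DIM(real) - k x) < e"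
    using integrable_ccontinuous_explicit[of k] by metis
  have "h x = 0" if x: "x \<in> {0..a} - (N \<union> {0, a})" for x
  proof (rule ccontr)
    assume "h x \<noteq> 0"
    then have "0 < norm (h x)" by simp
    then obtain d where d: "d > 0" "\<And>s. 0 < s \<Longrightarrow> s < d \<Longrightarrow> norm (integral {x..x+s} k /\<^sub>R s - k x) < norm (h x)"
      using N(2)[of x "norm (h x)"] x by auto
    define s where "s = min (d / 2) ((a - x) / 2)"
    have s: "0 < s" "s < d" "x + s < a" using d x by (auto simp: s_def min_def field_simps)
    have "integral {x..x+s} k = integral {x..x+s} h"
      using x s by (intro integral_cong) (auto simp: k_def)
    also have "\<dots> = 0" using 0 x s by simp
    finally show False using d(2)[of s] s x by (simp add: k_def)
  qed
  then show ?thesis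
    unfolding AE_interval_iff using N(1) by (intro exI[of _ "N \<union> {0, a}"]) auto
qed

section \<open>Primitives of integrable functions\<close>

text \<open>Integration by parts for a primitive \<open>F\<close> of an integrable function against a continuously
  differentiable one. The defect \<open>H\<close> of the identity on \<open>[0,x]\<close> changes between \<open>x\<close> and \<open>y\<close> by at
  most a constant times \<open>\<bar>y - x\<bar>\<close> times the integral of \<open>\<bar>g\<bar>\<close> over \<open>[x,y]\<close>; the last factor tends to zero,
  so \<open>H\<close> has derivative zero everywhere.\<close>

lemma integral_by_parts_primitive:
  fixes g F \<phi> \<phi>' :: "real \<Rightarrow> complex"
  assumes a: "0 \<le> a" and g: "integrable (interval_measure a) g"
    and F: "\<And>x. x \<in> {0..a} \<Longrightarrow> F x = F 0 + integral {0..x} g"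
    and d: "\<And>x. x \<in> {0..a} \<Longrightarrow> (\<phi> has_vector_derivative \<phi>' x) (at x within {0..a})"
    and c: "continuous_on {0..a} \<phi>'"
  shows "integral {0..a} (\<lambda>x. g x * \<phi> x) + integral {0..a} (\<lambda>x. F x * \<phi>' x) = F a * \<phi> a - F 0 * \<phi> 0"
    and "(\<lambda>x. g x * \<phi> x) absolutely_integrable_on {0..a}"
    and "continuous_on {0..a} F"
proof -
  have gabs: "g absolutely_integrable_on {0..a}" using g by (simp add: integrable_interval_iff)
  then have gi: "g integrable_on {0..a}" and ni: "(\<lambda>x. norm (g x)) integrable_on {0..a}"
    by (auto simp: absolutely_integrable_on_def)
  have cphi: "continuous_on {0..a} \<phi>"
    using d by (meson continuous_on_eq_continuous_within has_vector_derivative_continuous)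
  have "continuous_on {0..a} (\<lambda>x. F 0 + integral {0..x} g)"
    by (intro continuous_intros indefinite_integral_continuous_1 gi)
  then show cF: "continuous_on {0..a} F"
    by (rule continuous_on_eq) (rule F[symmetric])
  have gphi: "(\<lambda>x. g x * p x) absolutely_integrable_on {0..a}" if p: "continuous_on {0..a} p" for p :: "real \<Rightarrow> complex"
  proof -
    have "(\<lambda>x. p x * g x) absolutely_integrable_on {0..a}"
    proof (rule absolutely_integrable_bounded_measurable_product[where h = "(*)" and f = p, OF _ _ _ _ gabs])
      show "p \<in> borel_measurable (lebesgue_on {0..a})"
        using p by (intro continuous_imp_measurable_on_sets_lebesgue) auto
      show "bounded (p ` {0..a})"
        using p by (intro compact_imp_bounded compact_continuous_image) auto
    qed (auto simp: bilinear_times)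
    then show ?thesis by (simp add: mult.commute)
  qed
  show "(\<lambda>x. g x * \<phi> x) absolutely_integrable_on {0..a}" by (rule gphi[OF cphi])
  then have gphii: "(\<lambda>x. g x * \<phi> x) integrable_on {0..a}" by (simp add: absolutely_integrable_on_def)
  have Fphii: "(\<lambda>x. F x * \<phi>' x) integrable_on {0..a}"
    by (intro integrable_continuous_real continuous_intros cF c)
  define G where "G x = integral {0..x} (\<lambda>x. norm (g x))" for x
  define H where "H x = integral {0..x} (\<lambda>x. g x * \<phi> x) + integral {0..x} (\<lambda>x. F x * \<phi>' x) - F x * \<phi> x" for x
  obtain C where C: "\<And>x. x \<in> {0..a} \<Longrightarrow> norm (\<phi>' x) \<le> C" and "C \<ge> 0"
  proof -
    have "bounded (\<phi>' ` {0..a})" using c by (intro compact_imp_bounded compact_continuous_image) auto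
    then obtain C where "\<forall>x\<in>{0..a}. norm (\<phi>' x) \<le> C" unfolding bounded_iff by auto
    then show ?thesis using that[of "max C 0"] by force
  qed
  have lip: "norm (\<phi> s - \<phi> y) \<le> C * \<bar>s - y\<bar>" if "s \<in> {0..a}" "y \<in> {0..a}" for s y
    using differentiable_bound[of "{0..a}" \<phi> "\<lambda>x h. h *\<^sub>R \<phi>' x" C s y] d C that
    by (auto simp: has_vector_derivative_def onorm_scaleR_left[OF bounded_linear_ident] onorm_id)
  have sub: "f integrable_on {x..y}" if "f integrable_on {0..a}" "0 \<le> x" "y \<le> a" for x y and f :: "real \<Rightarrow> 'b::banach"
    using that by (auto intro: integrable_on_subinterval)
  have comb: "integral {0..y} f - integral {0..x} f = integral {x..y} f"
    if "f integrable_on {0..a}" "0 \<le> x" "x \<le> y" "y \<le> a" for x y and f :: "real \<Rightarrow> 'b::banach"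
    using Henstock_Kurzweil_Integration.integral_combine[of 0 x y f] sub[of f 0 y] that by (simp add: algebra_simps)
  have Fdiff: "norm (F s - F x) \<le> G s - G x" if "0 \<le> x" "x \<le> s" "s \<le> a" for x s
  proof -
    have "F s - F x = integral {0..s} g - integral {0..x} g"
      using F[of s] F[of x] that by auto
    also have "\<dots> = integral {x..s} g" by (rule comb[OF gi]) (use that in auto)
    also have "norm \<dots> \<le> integral {x..s} (\<lambda>x. norm (g x))"
      using sub[OF gi] sub[OF ni] that by (intro integral_norm_bound_integral) auto
    also have "\<dots> = G s - G x" unfolding G_def using comb[OF ni] that by simp
    finally show ?thesis .
  qed
  have Gmono: "G x \<le> G y" if "0 \<le> x" "x \<le> y" "y \<le> a" for x y
    using Fdiff[OF that] norm_ge_zero[of "F y - F x"] by linarith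
  have Hbound: "norm (H y - H x) \<le> (2 * C) * (y - x) * (G y - G x)" if xy: "0 \<le> x" "x \<le> y" "y \<le> a" for x y
  proof -
    have phi_int: "integral {x..y} \<phi>' = \<phi> y - \<phi> x"
    proof (rule integral_unique, rule fundamental_theorem_of_calculus)
      show "(\<phi> has_vector_derivative \<phi>' s) (at s within {x..y})" if "s \<in> {x..y}" for s
        using d[of s] that xy by (auto intro: has_vector_derivative_within_subset)
    qed (use xy in auto)
    have i1: "(\<lambda>s. g s * \<phi> s) integrable_on {x..y}" "g integrable_on {x..y}"
      "(\<lambda>s. F s * \<phi>' s) integrable_on {x..y}" "\<phi>' integrable_on {x..y}"
      using sub gphii gi Fphii integrable_continuous_real[OF c] xy by auto
    have 1: "((\<lambda>s. g s * \<phi> s - g s * \<phi> y) has_integral integral {x..y} (\<lambda>s. g s * \<phi> s) - (F y - F x) * \<phi> y) {x..y}"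
      using i1 comb[OF gi, of x y] F[of x] F[of y] xy
      by (intro has_integral_diff integrable_integral has_integral_mult_left) (auto simp: has_integral_integrable_integral)
    have 2: "((\<lambda>s. F s * \<phi>' s - F x * \<phi>' s) has_integral integral {x..y} (\<lambda>s. F s * \<phi>' s) - F x * (\<phi> y - \<phi> x)) {x..y}"
      using i1 phi_int by (intro has_integral_diff integrable_integral has_integral_mult_right) (auto simp: has_integral_integrable_integral)
    have Hd: "H y - H x = (integral {x..y} (\<lambda>s. g s * \<phi> s) - (F y - F x) * \<phi> y) + (integral {x..y} (\<lambda>s. F s * \<phi>' s) - F x * (\<phi> y - \<phi> x))"
      unfolding H_def using comb[OF gphii xy] comb[OF Fphii xy] by (simp add: algebra_simps)
    have n1: "norm (integral {x..y} (\<lambda>s. g s * \<phi> s) - (F y - F x) * \<phi> y) \<le> C * (y - x) * (G y - G x)"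
    proof -
      have "norm (integral {x..y} (\<lambda>s. g s * \<phi> s - g s * \<phi> y)) \<le> integral {x..y} (\<lambda>s. C * (y - x) * norm (g s))"
      proof (rule integral_norm_bound_integral)
        fix s assume s: "s \<in> {x..y}"
        have "norm (g s * \<phi> s - g s * \<phi> y) = norm (\<phi> s - \<phi> y) * norm (g s)"
          by (simp only: norm_mult mult.commute[of "norm (g s)"] flip: right_diff_distrib)
        also have "\<dots> \<le> C * \<bar>s - y\<bar> * norm (g s)"
          using lip[of s y] s xy by (intro mult_right_mono) auto
        also have "\<dots> \<le> C * (y - x) * norm (g s)"
          using s \<open>C \<ge> 0\<close> by (intro mult_right_mono mult_left_mono) auto
        finally show "norm (g s * \<phi> s - g s * \<phi> y) \<le> C * (y - x) * norm (g s)" .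
      next
        show "(\<lambda>s. g s * \<phi> s - g s * \<phi> y) integrable_on {x..y}" using 1 by blast
        show "(\<lambda>s. C * (y - x) * norm (g s)) integrable_on {x..y}"
          using sub[OF ni] xy by (intro integrable_on_mult_right) auto
      qed
      also have "\<dots> = C * (y - x) * (G y - G x)"
        unfolding G_def using comb[OF ni xy] by simp
      finally show ?thesis using integral_unique[OF 1] by simp
    qed
    have n2: "norm (integral {x..y} (\<lambda>s. F s * \<phi>' s) - F x * (\<phi> y - \<phi> x)) \<le> C * (y - x) * (G y - G x)"
    proof -
      have "norm (F s * \<phi>' s - F x * \<phi>' s) \<le> C * (G y - G x)" if s: "s \<in> {x..y}" for s
      proof -
        have "norm (F s - F x) \<le> G y - G x"
          using Fdiff[of x s] Gmono[of s y] s xy by force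
        moreover have "norm (\<phi>' s) \<le> C" using C s xy by auto
        ultimately have "norm (F s - F x) * norm (\<phi>' s) \<le> (G y - G x) * C"
          using Gmono[OF xy] by (intro mult_mono) auto
        then show ?thesis by (simp only: norm_mult mult.commute[of C] flip: left_diff_distrib)
      qed
      then have "norm (integral {x..y} (\<lambda>s. F s * \<phi>' s - F x * \<phi>' s)) \<le> C * (G y - G x) * (y - x)"
      proof (intro integral_bound)
        show "continuous_on {x..y} (\<lambda>s. F s * \<phi>' s - F x * \<phi>' s)"
          using xy by (intro continuous_intros continuous_on_subset[OF cF] continuous_on_subset[OF c]) auto
      qed (use xy in auto)
      then show ?thesis using integral_unique[OF 2] by (simp add: mult.commute mult.left_commute)
    qed
    show ?thesis
      unfolding Hd using norm_triangle_mono[OF n1 n2] by simp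
  qed
  have cG: "continuous_on {0..a} G" unfolding G_def by (intro indefinite_integral_continuous_1 ni)
  have Hd0: "(H has_derivative (\<lambda>h. 0)) (at x within {0..a})" if x: "x \<in> {0..a}" for x
    unfolding has_derivative_iff_norm
  proof (intro conjI)
    have "((\<lambda>y. 2 * C * \<bar>G y - G x\<bar>) \<longlongrightarrow> 2 * C * \<bar>G x - G x\<bar>) (at x within {0..a})"
      using cG x by (intro tendsto_intros) (auto simp: continuous_on_def)
    then have lim: "((\<lambda>y. 2 * C * \<bar>G y - G x\<bar>) \<longlongrightarrow> 0) (at x within {0..a})" by simp
    show "((\<lambda>y. norm (H y - H x - 0) / norm (y - x)) \<longlongrightarrow> 0) (at x within {0..a})"
    proof (rule Lim_null_comparison[OF _ lim])
      show "\<forall>\<^sub>F y in at x within {0..a}. norm (norm (H y - H x - 0) / norm (y - x)) \<le> 2 * C * \<bar>G y - G x\<bar>"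
        unfolding eventually_at
      proof (intro exI[of _ 1] conjI ballI impI)
        fix y assume y: "y \<in> {0..a}" "y \<noteq> x \<and> dist y x < 1"
        have "norm (H y - H x) \<le> 2 * C * \<bar>y - x\<bar> * \<bar>G y - G x\<bar>"
        proof (cases "x \<le> y")
          case True then show ?thesis using Hbound[of x y] Gmono[of x y] x y by auto
        next
          case False then show ?thesis using Hbound[of y x] Gmono[of y x] x y
            by (auto simp: norm_minus_commute abs_minus_commute)
        qed
        then show "norm (norm (H y - H x - 0) / norm (y - x)) \<le> 2 * C * \<bar>G y - G x\<bar>"
          using y by (simp add: divide_le_eq algebra_simps)
      qed simp
    qed
  qed simp
  obtain k where k: "\<forall>x\<in>{0..a}. H x = k"
    using has_derivative_zero_constant[OF convex_real_interval(5) Hd0] by blast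
  have "H a = H 0" using k a by simp
  then show "integral {0..a} (\<lambda>x. g x * \<phi> x) + integral {0..a} (\<lambda>x. F x * \<phi>' x) = F a * \<phi> a - F 0 * \<phi> 0"
    by (simp add: H_def algebra_simps)
qed

section \<open>Weak derivatives are derivatives of primitives\<close>

lemma test_functionD:
  assumes "\<phi> \<in> test_functions a"
  shows "(\<phi> has_vector_derivative vector_derivative \<phi> (at x)) (at x)"
    "continuous_on UNIV (\<lambda>x. vector_derivative \<phi> (at x))" "\<phi> 0 = 0" "\<phi> a = 0"
proof -
  have C1: "\<phi> C1_differentiable_on UNIV" and cl: "closure {x. \<phi> x \<noteq> 0} \<subseteq> {0<..<a}"
    using assms by (auto simp: test_functions_def)
  have "\<phi> differentiable at x" using C1 unfolding C1_differentiable_on_eq by blast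
  then show "(\<phi> has_vector_derivative vector_derivative \<phi> (at x)) (at x)"
    by (rule vector_derivative_works[THEN iffD1])
  show "continuous_on UNIV (\<lambda>x. vector_derivative \<phi> (at x))"
    using C1 unfolding C1_differentiable_on_eq by blast
  have "{x. \<phi> x \<noteq> 0} \<subseteq> {0<..<a}" by (rule order_trans[OF closure_subset cl])
  then show "\<phi> 0 = 0" "\<phi> a = 0" by auto
qed

text \<open>Test functions whose derivative is prescribed: any continuous function of mean zero that is supported
away from the endpoints occurs.\<close>

lemma test_function_primitive:
  fixes \<psi> :: "real \<Rightarrow> complex"
  assumes c: "continuous_on UNIV \<psi>" and d: "0 < d" "d < a"
    and supp: "\<And>x. x \<notin> {d..a-d} \<Longrightarrow> \<psi> x = 0"
    and mean: "integral {0..a} \<psi> = 0"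
  shows "(\<lambda>x. integral {0..x} \<psi>) \<in> test_functions a"
    "vector_derivative (\<lambda>x. integral {0..x} \<psi>) (at x) = \<psi> x"
proof -
  define \<phi> where "\<phi> x = integral {0..x} \<psi>" for x
  have ci: "\<psi> integrable_on {p..q}" for p q
    by (intro integrable_continuous_real continuous_on_subset[OF c]) auto
  have left: "\<phi> x = 0" if "x < d" for x
  proof -
    have "\<phi> x = integral {0..x} (\<lambda>_. 0)"
      unfolding \<phi>_def using that supp by (intro integral_cong) auto
    then show ?thesis by simp
  qed
  have right: "\<phi> x = 0" if x: "x > a - d" for x
  proof -
    have z: "integral {p..q} \<psi> = 0" if "a - d < p" for p q
    proof -
      have "integral {p..q} \<psi> = integral {p..q} (\<lambda>_. 0)"
        using that supp by (intro integral_cong) auto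
      then show ?thesis by simp
    qed
    show ?thesis
    proof (cases "x \<le> a")
      case True
      then have "\<phi> x + integral {x..a} \<psi> = integral {0..a} \<psi>"
        unfolding \<phi>_def using x d by (intro Henstock_Kurzweil_Integration.integral_combine ci) auto
      then show ?thesis using mean z x by simp
    next
      case False
      then have "integral {0..a} \<psi> + integral {a..x} \<psi> = \<phi> x"
        unfolding \<phi>_def using x d by (intro Henstock_Kurzweil_Integration.integral_combine ci) auto
      then show ?thesis using mean z d by simp
    qed
  qed
  have D: "(\<phi> has_vector_derivative \<psi> x) (at x)" for x
  proof (cases "x < d")
    case True
    have "((\<lambda>_. 0) has_vector_derivative \<psi> x) (at x)"
      using supp[of x] True by simp
    then show ?thesis
      by (rule has_vector_derivative_transform_within_open[where S = "{..<d}"]) (use True left in auto)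
  next
    case False
    have "(\<phi> has_vector_derivative \<psi> x) (at x within {0..x+1})"
      unfolding \<phi>_def using False d
      by (intro integral_has_vector_derivative continuous_on_subset[OF c]) auto
    moreover have "at x within {0..x+1} = at x"
      using False d by (intro at_within_interior) auto
    ultimately show ?thesis by simp
  qed
  then have vd: "vector_derivative \<phi> (at x) = \<psi> x" for x
    by (rule vector_derivative_at)
  have "\<phi> C1_differentiable_on UNIV"
    unfolding C1_differentiable_on_def using D c by blast
  moreover have "closure {x. \<phi> x \<noteq> 0} \<subseteq> {d..a-d}"
    using left right by (intro closure_minimal) (auto simp: not_less[symmetric])
  ultimately show "(\<lambda>x. integral {0..x} \<psi>) \<in> test_functions a"
    unfolding test_functions_def \<phi>_def[abs_def] using d by force
  show "vector_derivative (\<lambda>x. integral {0..x} \<psi>) (at x) = \<psi> x"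
    using vd[of x] by (simp add: \<phi>_def[abs_def])
qed

text \<open>Continuous approximations of the indicator of \<open>[p,q]\<close>, supported in the \<open>1/n\<close> neighbourhood.\<close>

definition trapezoid :: "real \<Rightarrow> real \<Rightarrow> nat \<Rightarrow> real \<Rightarrow> complex" where
  "trapezoid p q n x = of_real (max 0 (1 - real n * max 0 (max (p - x) (x - q))))"

lemma continuous_trapezoid: "continuous_on A (trapezoid p q n)"
  unfolding trapezoid_def by (intro continuous_intros)

lemma norm_trapezoid_le: "cmod (trapezoid p q n x) \<le> 1"
  unfolding trapezoid_def by (simp add: max_def)

lemma trapezoid_support:
  assumes "1 \<le> real n * e" "x \<notin> {p - e..q + e}" "e > 0"
  shows "trapezoid p q n x = 0"
proof -
  have "e \<le> max 0 (max (p - x) (x - q))" using assms by (auto simp: max_def)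
  then have "1 \<le> real n * max 0 (max (p - x) (x - q))"
    using assms(1) by (meson mult_left_mono of_nat_0_le_iff order_trans)
  then show ?thesis by (simp add: trapezoid_def)
qed

lemma trapezoid_limit: "(\<lambda>n. trapezoid p q n x) \<longlonglongrightarrow> indicator {p..q} x"
proof (cases "x \<in> {p..q}")
  case True
  then have "max 0 (max (p - x) (x - q)) = 0" by simp
  then show ?thesis using True by (simp add: trapezoid_def)
next
  case False
  define m where "m = max 0 (max (p - x) (x - q))"
  have m: "m > 0" using False by (auto simp: m_def max_def)
  have "\<forall>\<^sub>F n in sequentially. trapezoid p q n x = 0"
  proof (rule eventually_sequentiallyI[of "nat \<lceil>1 / m\<rceil>"])
    fix n assume "nat \<lceil>1 / m\<rceil> \<le> n"
    then have "1 / m \<le> real n" by linarith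
    then have "1 \<le> real n * m" using m by (simp add: field_simps)
    then show "trapezoid p q n x = 0" by (simp add: trapezoid_def flip: m_def)
  qed
  then show ?thesis using False by (simp add: tendsto_eventually)
qed

lemma trapezoid_integral_limit:
  assumes h: "integrable (interval_measure a) (h :: real \<Rightarrow> complex)" and pq: "0 \<le> p" "q \<le> a"
  shows "integrable (interval_measure a) (\<lambda>x. h x * trapezoid p q n x)"
    and "(\<lambda>n. \<integral>x. h x * trapezoid p q n x \<partial>interval_measure a) \<longlonglongrightarrow> integral {p..q} h"
proof -
  have mt: "trapezoid p q n \<in> borel_measurable (interval_measure a)" for n
    by (intro continuous_imp_measurable_on_sets_lebesgue continuous_trapezoid) auto
  have bd: "norm (h x * trapezoid p q n x) \<le> norm (h x)" for x n
    using norm_trapezoid_le[of p q n x] by (simp add: norm_mult mult_left_le)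
  show "integrable (interval_measure a) (\<lambda>x. h x * trapezoid p q n x)"
    by (rule Bochner_Integration.integrable_bound[OF h]) (use h mt bd in auto)
  have im: "(\<lambda>x. h x * indicator {p..q} x) \<in> borel_measurable (interval_measure a)"
    by (rule borel_measurable_LIMSEQ_metric[where f = "\<lambda>n x. h x * trapezoid p q n x"])
      (use h mt in \<open>auto intro!: tendsto_intros trapezoid_limit\<close>)
  have lim: "(\<lambda>n. \<integral>x. h x * trapezoid p q n x \<partial>interval_measure a) \<longlonglongrightarrow> (\<integral>x. h x * indicator {p..q} x \<partial>interval_measure a)"
  proof (rule integral_dominated_convergence[where w = "\<lambda>x. norm (h x)"])
    show "AE x in interval_measure a. (\<lambda>n. h x * trapezoid p q n x) \<longlonglongrightarrow> h x * indicator {p..q} x"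
      by (intro AE_I2 tendsto_intros trapezoid_limit)
    show "(\<lambda>x. h x * indicator {p..q} x) \<in> borel_measurable (interval_measure a)" by (rule im)
  qed (use h mt bd in auto)
  have i: "integrable (interval_measure a) (\<lambda>x. h x * indicator {p..q} x)"
  proof (rule Bochner_Integration.integrable_bound[OF h])
    show "(\<lambda>x. h x * indicator {p..q} x) \<in> borel_measurable (interval_measure a)" by (rule im)
  qed (auto simp: indicator_def)
  have "(\<integral>x. h x * indicator {p..q} x \<partial>interval_measure a) = integral {0..a} (\<lambda>x. h x * indicator {p..q} x)"
    by (rule integral_interval[OF i])
  also have "\<dots> = integral {0..a} (\<lambda>x. if x \<in> {p..q} then h x else 0)"
    by (intro integral_cong) (auto simp: indicator_def)
  also have "\<dots> = integral {p..q} h"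
    using pq by (subst integral_restrict_Int) (auto simp: Int_absorb2 intro!: arg_cong[of _ _ "\<lambda>A. integral A h"])
  finally show "(\<lambda>n. \<integral>x. h x * trapezoid p q n x \<partial>interval_measure a) \<longlonglongrightarrow> integral {p..q} h"
    using lim by simp
qed

text \<open>Testing with a primitive of a mean-zero combination of two trapezoids shows that \<open>h\<close> has the same average over
any two intervals. The common average is the constant.\<close>

lemma du_Bois_Reymond:
  fixes h :: "real \<Rightarrow> complex"
  assumes a: "0 < a" and h: "integrable (interval_measure a) h"
    and orth: "\<And>\<phi>. \<phi> \<in> test_functions a \<Longrightarrow> (\<integral>x. h x * vector_derivative \<phi> (at x) \<partial>interval_measure a) = 0"
  shows "\<exists>c. AE x in interval_measure a. h x = c"
proof -
  let ?I = "\<lambda>n p q. \<integral>x. h x * trapezoid p q n x \<partial>interval_measure a"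
  define J where "J n p q = integral {0..a} (trapezoid p q n)" for n p q
  have one: "integrable (interval_measure a) (\<lambda>_. 1 :: complex)"
    by (rule continuous_integrable_interval) simp
  have Jlim: "(\<lambda>n. J n p q) \<longlonglongrightarrow> of_real (q - p)" if "0 \<le> p" "p \<le> q" "q \<le> a" for p q
  proof -
    have "(\<integral>x. 1 * trapezoid p q n x \<partial>interval_measure a) = J n p q" for n
      unfolding J_def using trapezoid_integral_limit(1)[OF one that(1,3), of n] by (simp add: integral_interval)
    then show ?thesis
      using trapezoid_integral_limit(2)[OF one that(1,3)] that(2) by (simp add: scaleR_conv_of_real)
  qed
  have test: "J n p q * ?I m p' q' = J m p' q' * ?I n p q"
    if d: "0 < d" "d < a" and 1: "d \<le> p - 1 / real n" "q + 1 / real n \<le> a - d" "p \<le> q" "0 < n"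
      and 2: "d \<le> p' - 1 / real m" "q' + 1 / real m \<le> a - d" "p' \<le> q'" "0 < m"
    for d p q n p' q' m
  proof -
    define \<psi> where "\<psi> x = J n p q * trapezoid p' q' m x - J m p' q' * trapezoid p q n x" for x
    have c: "continuous_on A \<psi>" for A
      unfolding \<psi>_def by (intro continuous_intros continuous_trapezoid)
    have supp: "\<psi> x = 0" if "x \<notin> {d..a-d}" for x
      unfolding \<psi>_def using that 1 2 trapezoid_support[of n "1 / real n" x p q] trapezoid_support[of m "1 / real m" x p' q']
      by auto
    have ti: "trapezoid p q n integrable_on {0..a}" for p q n
      by (intro integrable_continuous_real continuous_trapezoid)
    have mean: "integral {0..a} \<psi> = 0"
      unfolding \<psi>_def J_def using ti by (simp add: Henstock_Kurzweil_Integration.integral_diff integrable_on_mult_right)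
    have "(\<integral>x. h x * \<psi> x \<partial>interval_measure a) = 0"
      using orth[OF test_function_primitive(1)[OF c d supp mean]] test_function_primitive(2)[OF c d supp mean] by simp
    moreover have "(\<integral>x. h x * \<psi> x \<partial>interval_measure a) = J n p q * ?I m p' q' - J m p' q' * ?I n p q"
    proof -
      have "0 < 1 / real n" "0 < 1 / real m" using 1 2 by auto
      then have "0 \<le> p" "q \<le> a" "0 \<le> p'" "q' \<le> a" using 1 2 d by linarith+
      note i = trapezoid_integral_limit(1)[OF h this(1,2), of n] trapezoid_integral_limit(1)[OF h this(3,4), of m]
      have "(\<lambda>x. h x * \<psi> x) = (\<lambda>x. J n p q * (h x * trapezoid p' q' m x) - J m p' q' * (h x * trapezoid p q n x))"
        by (simp add: \<psi>_def algebra_simps)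
      then show ?thesis using i by simp
    qed
    ultimately show ?thesis by simp
  qed
  have pair: "of_real (q - p) * integral {p'..q'} h = of_real (q' - p') * integral {p..q} h"
    if "0 < p" "p < q" "q < a" "0 < p'" "p' < q'" "q' < a" for p q p' q'
  proof -
    define d where "d = min (min p (a - q)) (min p' (a - q')) / 2"
    have d: "0 < d" "d < a" "2 * d \<le> p" "2 * d \<le> p'" "q + 2 * d \<le> a" "q' + 2 * d \<le> a"
      using that a by (auto simp: d_def min_def)
    have "\<forall>\<^sub>F n in sequentially. J n p q * ?I n p' q' = J n p' q' * ?I n p q"
    proof (rule eventually_sequentiallyI[of "nat \<lceil>1 / d\<rceil>"])
      fix n assume "nat \<lceil>1 / d\<rceil> \<le> n"
      then have n: "1 / d \<le> real n" by linarith
      have "0 < 1 / d" using d by simp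
      then have n0: "0 < n" using n by (metis gr0I of_nat_0 not_less)
      have "1 / real n \<le> d" using n n0 d by (simp add: field_simps)
      then show "J n p q * ?I n p' q' = J n p' q' * ?I n p q"
        using d that n0 by (intro test[of d]) auto
    qed
    moreover have "(\<lambda>n. J n p q * ?I n p' q') \<longlonglongrightarrow> of_real (q - p) * integral {p'..q'} h"
      using that by (intro tendsto_mult Jlim trapezoid_integral_limit(2)[OF h]) auto
    moreover have "(\<lambda>n. J n p' q' * ?I n p q) \<longlonglongrightarrow> of_real (q' - p') * integral {p..q} h"
      using that by (intro tendsto_mult Jlim trapezoid_integral_limit(2)[OF h]) auto
    ultimately have "(\<lambda>n. J n p q * ?I n p' q') \<longlonglongrightarrow> of_real (q' - p') * integral {p..q} h"
      and "(\<lambda>n. J n p q * ?I n p' q') \<longlonglongrightarrow> of_real (q - p) * integral {p'..q'} h"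
      using tendsto_cong by fast+
    then show ?thesis using LIMSEQ_unique by blast
  qed
  define c where "c = integral {a/3..2*a/3} h / of_real (a / 3)"
  have hi: "h integrable_on {p..q}" if "0 < p" "q < a" for p q
    using h that by (auto simp: integrable_interval_iff absolutely_integrable_on_def intro: integrable_on_subinterval)
  have "AE x in interval_measure a. h x - c = 0"
  proof (rule AE_zero_of_integral_zero)
    show "integrable (interval_measure a) (\<lambda>x. h x - c)"
      using h continuous_integrable_interval[of a "\<lambda>_. c"] by simp
    show "integral {p..q} (\<lambda>x. h x - c) = 0" if pq: "0 < p" "p < q" "q < a" for p q
    proof -
      have "integral {p..q} (\<lambda>x. h x - c) = integral {p..q} h - of_real (q - p) * c"
        using hi[of p q] pq by (subst Henstock_Kurzweil_Integration.integral_diff) (auto simp: scaleR_conv_of_real)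
      moreover have "of_real (a / 3) * integral {p..q} h = of_real (q - p) * integral {a/3..2*a/3} h"
        using pair[of "a/3" "2*a/3" p q] pq a by (simp add: field_simps)
      ultimately show ?thesis using a by (simp add: c_def field_simps)
    qed
  qed
  then show ?thesis by auto
qed

lemma weak_deriv_imp_primitive:
  assumes a: "0 < a" and f: "f \<in> L2 a" and g: "g \<in> L2 a" and w: "is_weak_deriv a f g"
  obtains c where "AE x in interval_measure a. f x = c + integral {0..x} g"
proof -
  define G where "G x = integral {0..x} g" for x
  note gi = L2_integrable[OF g]
  have G: "G x = G 0 + integral {0..x} g" for x by (simp add: G_def)
  have cG: "continuous_on {0..a} G"
    by (rule integral_by_parts_primitive(3)[of a g G "\<lambda>_. 0" "\<lambda>_. 0"]) (use a gi in \<open>auto simp: G_def\<close>)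
  have "\<exists>c. AE x in interval_measure a. f x - G x = c"
  proof (rule du_Bois_Reymond[OF a])
    show "integrable (interval_measure a) (\<lambda>x. f x - G x)"
      using L2_integrable[OF f] continuous_integrable_interval[OF cG] by simp
    fix \<phi> assume phi: "\<phi> \<in> test_functions a"
    define \<phi>' where "\<phi>' x = vector_derivative \<phi> (at x)" for x
    note T = test_functionD[OF phi, folded \<phi>'_def]
    have c': "continuous_on {0..a} \<phi>'" by (rule continuous_on_subset[OF T(2)]) simp
    note P = integral_by_parts_primitive[of a g G \<phi> \<phi>', OF less_imp_le[OF a] gi G _ c']
    have vd: "(\<phi> has_vector_derivative \<phi>' x) (at x within {0..a})" for x
      using T(1) has_vector_derivative_at_within by blast
    have P1: "integral {0..a} (\<lambda>x. g x * \<phi> x) + integral {0..a} (\<lambda>x. G x * \<phi>' x) = 0"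
      using P(1) vd T by simp
    have i1: "integrable (interval_measure a) (\<lambda>x. f x * \<phi>' x)"
      by (rule L2_times_integrable[OF f continuous_L2[OF c']])
    have i2: "integrable (interval_measure a) (\<lambda>x. G x * \<phi>' x)"
      by (intro continuous_integrable_interval continuous_intros cG c')
    have i3: "integrable (interval_measure a) (\<lambda>x. g x * \<phi> x)"
      using P(2) vd by (simp add: integrable_interval_iff)
    have "(\<integral>x. (f x - G x) * \<phi>' x \<partial>interval_measure a)
        = (\<integral>x. f x * \<phi>' x \<partial>interval_measure a) - (\<integral>x. G x * \<phi>' x \<partial>interval_measure a)"
      unfolding left_diff_distrib by (rule Bochner_Integration.integral_diff[OF i1 i2])
    also have "\<dots> = - ((\<integral>x. g x * \<phi> x \<partial>interval_measure a) + (\<integral>x. G x * \<phi>' x \<partial>interval_measure a))"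
      using w phi by (simp add: is_weak_deriv_def \<phi>'_def)
    also have "\<dots> = 0" using P1 integral_interval[OF i2] integral_interval[OF i3] by simp
    finally show "(\<integral>x. (f x - G x) * vector_derivative \<phi> (at x) \<partial>interval_measure a) = 0"
      by (simp add: \<phi>'_def)
  qed
  then obtain c where "AE x in interval_measure a. f x - G x = c" by blast
  then have "AE x in interval_measure a. f x = c + integral {0..x} g"
    by eventually_elim (simp add: G_def algebra_simps)
  then show ?thesis using that by blast
qed

lemma primitive_is_weak_deriv:
  assumes a: "0 < a" and g: "integrable (interval_measure a) g"
    and F: "\<And>x. x \<in> {0..a} \<Longrightarrow> F x = F 0 + integral {0..x} g"
    and f: "AE x in interval_measure a. f x = F x"
    and meas: "f \<in> borel_measurable (interval_measure a)"
  shows "is_weak_deriv a f g"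
  unfolding is_weak_deriv_def
proof
  fix \<phi> assume phi: "\<phi> \<in> test_functions a"
  define \<phi>' where "\<phi>' x = vector_derivative \<phi> (at x)" for x
  note T = test_functionD[OF phi, folded \<phi>'_def]
  have c': "continuous_on {0..a} \<phi>'" by (rule continuous_on_subset[OF T(2)]) simp
  have vd: "(\<phi> has_vector_derivative \<phi>' x) (at x within {0..a})" for x
    using T(1) has_vector_derivative_at_within by blast
  have P: "integral {0..a} (\<lambda>x. g x * \<phi> x) + integral {0..a} (\<lambda>x. F x * \<phi>' x) = F a * \<phi> a - F 0 * \<phi> 0"
    "(\<lambda>x. g x * \<phi> x) absolutely_integrable_on {0..a}" "continuous_on {0..a} F"
    by (rule integral_by_parts_primitive[of a g F \<phi> \<phi>'];
        blast intro: less_imp_le[OF a] g F vd c')+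
  have P1: "integral {0..a} (\<lambda>x. g x * \<phi> x) + integral {0..a} (\<lambda>x. F x * \<phi>' x) = 0"
    using P(1) T by simp
  have i2: "integrable (interval_measure a) (\<lambda>x. F x * \<phi>' x)"
    using P(3) c' by (intro continuous_integrable_interval continuous_intros) auto
  have i3: "integrable (interval_measure a) (\<lambda>x. g x * \<phi> x)"
    using P(2) by (simp add: integrable_interval_iff)
  have "(\<integral>x. f x * \<phi>' x \<partial>interval_measure a) = (\<integral>x. F x * \<phi>' x \<partial>interval_measure a)"
  proof (rule integral_cong_AE)
    have "\<phi>' \<in> borel_measurable (interval_measure a)"
      using continuous_integrable_interval[OF c'] by simp
    then show "(\<lambda>x. f x * \<phi>' x) \<in> borel_measurable (interval_measure a)"
      using meas by simp
    show "AE x in interval_measure a. f x * \<phi>' x = F x * \<phi>' x"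
      using f by eventually_elim simp
  qed (use i2 in simp)
  then show "(\<integral>x. f x * vector_derivative \<phi> (at x) \<partial>interval_measure a) = - (\<integral>x. g x * \<phi> x \<partial>interval_measure a)"
    using P1 integral_interval[OF i2] integral_interval[OF i3] by (simp add: \<phi>'_def add_eq_0_iff)
qed

lemma integral_cong_AE_interval:
  fixes f g :: "real \<Rightarrow> 'a::euclidean_space"
  assumes "AE x in interval_measure a. f x = g x" "0 \<le> p" "q \<le> a"
  shows "integral {p..q} f = integral {p..q} g"
proof -
  obtain N where "negligible N" "\<forall>x\<in>{0..a} - N. f x = g x"
    using assms(1) unfolding AE_interval_iff by blast
  then show ?thesis using assms(2,3) by (intro integral_spike[of N]) auto
qed

text \<open>Differentiating the indefinite integral, which vanishes, recovers the pointwise value even at the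
endpoints.\<close>

lemma continuous_AE_zero:
  fixes D :: "real \<Rightarrow> 'a::euclidean_space"
  assumes a: "0 < a" and D: "continuous_on {0..a} D" and ae: "AE x in interval_measure a. D x = 0" and x: "x \<in> {0..a}"
  shows "D x = 0"
proof -
  have z: "integral {0..u} D = 0" if "u \<le> a" for u
    using integral_cong_AE_interval[of D "\<lambda>_. 0" a 0 u] ae that by simp
  have "((\<lambda>u. integral {0..u} D) has_vector_derivative D x) (at x within {0..a})"
    by (rule integral_has_vector_derivative[OF D x])
  moreover have "((\<lambda>u. integral {0..u} D) has_vector_derivative 0) (at x within {0..a})"
  proof (rule has_vector_derivative_transform[OF x])
    show "((\<lambda>_. 0) has_vector_derivative 0) (at x within {0..a})" by simp
  qed (use z in auto)
  ultimately show ?thesis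
    using vector_derivative_unique_within_closed_interval[of 0 a x] a x by auto
qed

lemma continuous_AE_eq:
  fixes F G :: "real \<Rightarrow> complex"
  assumes "0 < a" "continuous_on {0..a} F" "continuous_on {0..a} G"
    "AE x in interval_measure a. F x = G x" "x \<in> {0..a}"
  shows "F x = G x"
  using continuous_AE_zero[of a "\<lambda>x. F x - G x" x] assms by (auto intro!: continuous_intros)

lemma point_value_eq:
  assumes a: "0 < a" and F: "continuous_on {0..a} F" "AE x in interval_measure a. f x = F x" and x: "x \<in> {0..a}"
  shows "point_value a f x = F x"
  unfolding point_value_def
proof (rule the_equality)
  have "AE y in interval_measure a. F y = f y" using F(2) by eventually_elim simp
  then show "\<exists>h. continuous_on {0..a} h \<and> (AE y in interval_measure a. h y = f y) \<and> F x = h x"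
    using F(1) by blast
  fix c assume "\<exists>h. continuous_on {0..a} h \<and> (AE y in interval_measure a. h y = f y) \<and> c = h x"
  then obtain h where h: "continuous_on {0..a} h" "AE y in interval_measure a. h y = f y" "c = h x" by blast
  have "AE y in interval_measure a. h y = F y" using h(2) F(2) by eventually_elim simp
  then show "c = F x" using continuous_AE_eq[OF a h(1) F(1) _ x] h(3) by simp
qed

lemma continuous_primitive:
  assumes "0 < a" "g \<in> L2 a"
  shows "continuous_on {0..a} (\<lambda>x. c + integral {0..x} g)"
  using L2_integrable[OF assms(2)]
  by (intro continuous_intros indefinite_integral_continuous_1) (auto simp: integrable_interval_iff absolutely_integrable_on_def)

lemma is_weak_deriv_unique:
  assumes a: "0 < a" and f: "f \<in> L2 a" and g: "g \<in> L2 a" "is_weak_deriv a f g"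
    and g': "g' \<in> L2 a" "is_weak_deriv a f g'"
  shows "AE x in interval_measure a. g x = g' x"
proof -
  obtain c where c: "AE x in interval_measure a. f x = c + integral {0..x} g"
    using weak_deriv_imp_primitive[OF a f g] .
  obtain c' where c': "AE x in interval_measure a. f x = c' + integral {0..x} g'"
    using weak_deriv_imp_primitive[OF a f g'] .
  have "AE x in interval_measure a. c + integral {0..x} g = c' + integral {0..x} g'"
    using c c' by eventually_elim simp
  then have eq: "c + integral {0..x} g = c' + integral {0..x} g'" if "x \<in> {0..a}" for x
    using continuous_AE_eq[OF a continuous_primitive[OF a g(1)] continuous_primitive[OF a g'(1)]] that by blast
  have cc: "c = c'" using eq[of 0] a by simp
  have gi: "g integrable_on {p..q}" "g' integrable_on {p..q}" if "0 \<le> p" "q \<le> a" for p q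
    using L2_integrable[OF g(1)] L2_integrable[OF g'(1)] that
    by (auto simp: integrable_interval_iff absolutely_integrable_on_def intro: integrable_on_subinterval)
  have "AE x in interval_measure a. g x - g' x = 0"
  proof (rule AE_zero_of_integral_zero)
    show "integrable (interval_measure a) (\<lambda>x. g x - g' x)"
      using L2_integrable[OF g(1)] L2_integrable[OF g'(1)] by simp
    show "integral {p..q} (\<lambda>x. g x - g' x) = 0" if pq: "0 < p" "p < q" "q < a" for p q
    proof -
      have "integral {p..q} g = integral {0..q} g - integral {0..p} g"
        "integral {p..q} g' = integral {0..q} g' - integral {0..p} g'"
        using Henstock_Kurzweil_Integration.integral_combine[of 0 p q g]
          Henstock_Kurzweil_Integration.integral_combine[of 0 p q g'] gi pq by (auto simp: algebra_simps)
      then have "integral {p..q} g = integral {p..q} g'"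
        using eq[of p] eq[of q] pq cc by auto
      then show ?thesis
        using gi[of p q] pq by (simp add: Henstock_Kurzweil_Integration.integral_diff)
    qed
  qed
  then show ?thesis by eventually_elim simp
qed

lemma sobolev_L2: "f \<in> sobolev m a \<Longrightarrow> f \<in> L2 a"
  by (cases m) auto

lemma sobolev_cong_AE:
  assumes f: "f \<in> sobolev m a" and ae: "AE x in interval_measure a. f x = g x"
  shows "g \<in> sobolev m a"
proof (cases m)
  case 0
  then show ?thesis using L2_cong_AE[OF _ ae] f by simp
next
  case (Suc k)
  have gL: "g \<in> L2 a" using L2_cong_AE[OF sobolev_L2[OF f] ae] .
  have "is_weak_deriv a g d" if d: "is_weak_deriv a f d" for d
    unfolding is_weak_deriv_def
  proof
    fix \<phi> assume phi: "\<phi> \<in> test_functions a"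
    define \<phi>' where "\<phi>' x = vector_derivative \<phi> (at x)" for x
    have "continuous_on {0..a} \<phi>'"
      unfolding \<phi>'_def[abs_def] by (rule continuous_on_subset[OF test_functionD(2)[OF phi]]) simp
    then have m: "\<phi>' \<in> borel_measurable (interval_measure a)"
      by (rule borel_measurable_integrable[OF continuous_integrable_interval])
    have "(\<integral>x. g x * \<phi>' x \<partial>interval_measure a) = (\<integral>x. f x * \<phi>' x \<partial>interval_measure a)"
    proof (rule integral_cong_AE)
      show "AE x in interval_measure a. g x * \<phi>' x = f x * \<phi>' x" using ae by eventually_elim simp
    qed (use m gL sobolev_L2[OF f] in \<open>auto simp: L2_def\<close>)
    then show "(\<integral>x. g x * vector_derivative \<phi> (at x) \<partial>interval_measure a) = - (\<integral>x. d x * \<phi> x \<partial>interval_measure a)"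
      using d phi by (simp add: is_weak_deriv_def \<phi>'_def)
  qed
  then show ?thesis using f gL Suc by auto
qed

text \<open>This resolves the choice in \<open>weak_deriv\<close> and the description in \<open>point_value\<close>: the point values of
  an \<open>H\<^sup>1\<close> function form a primitive of its weak derivative.\<close>

theorem sobolev_point_value:
  assumes a: "0 < a" and f: "f \<in> sobolev (Suc m) a"
  shows "weak_deriv a f \<in> sobolev m a"
    and "\<And>x. x \<in> {0..a} \<Longrightarrow> point_value a f x = point_value a f 0 + integral {0..x} (weak_deriv a f)"
    and "AE x in interval_measure a. f x = point_value a f x"
    and "continuous_on {0..a} (point_value a f)"
proof -
  obtain g where g: "g \<in> sobolev m a" "is_weak_deriv a f g" using f by auto
  have fL: "f \<in> L2 a" using f by simp
  define w where "w = weak_deriv a f"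
  have w: "w \<in> L2 a" "is_weak_deriv a f w"
    unfolding w_def weak_deriv_def using someI[of "\<lambda>g. g \<in> L2 a \<and> is_weak_deriv a f g" g] g sobolev_L2 by auto
  have "AE x in interval_measure a. g x = w x"
    using is_weak_deriv_unique[OF a fL sobolev_L2[OF g(1)] g(2) w] .
  then show "weak_deriv a f \<in> sobolev m a" using sobolev_cong_AE[OF g(1)] by (simp add: w_def)
  obtain c where c: "AE x in interval_measure a. f x = c + integral {0..x} w"
    using weak_deriv_imp_primitive[OF a fL w] .
  have pv: "point_value a f x = c + integral {0..x} w" if "x \<in> {0..a}" for x
    by (rule point_value_eq[OF a continuous_primitive[OF a w(1)] c that])
  then show "point_value a f x = point_value a f 0 + integral {0..x} (weak_deriv a f)" if "x \<in> {0..a}" for x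
    using that a by (simp add: w_def)
  show cont: "continuous_on {0..a} (point_value a f)"
    by (rule continuous_on_eq[OF continuous_primitive[OF a w(1)]]) (rule pv[symmetric])
  have "AE x in interval_measure a. x \<in> {0..a}" by (auto simp: AE_restrict_space_iff)
  then show "AE x in interval_measure a. f x = point_value a f x"
    using c by eventually_elim (simp add: pv)
qed

section \<open>Functions of class \<open>H\<^sup>3\<close> and the energy identity\<close>

definition jet :: "real \<Rightarrow> (real \<Rightarrow> complex) \<Rightarrow> nat \<Rightarrow> real \<Rightarrow> complex" where
  "jet a u k = point_value a ((weak_deriv a ^^ k) u)"

lemma jet_primitive:
  assumes a: "0 < a" and u: "u \<in> sobolev 3 a"
  shows "(weak_deriv a ^^ 3) u \<in> L2 a" "weak_deriv a u \<in> L2 a" "u \<in> L2 a"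
    and "k \<le> 2 \<Longrightarrow> continuous_on {0..a} (jet a u k)"
    and "k \<le> 2 \<Longrightarrow> AE x in interval_measure a. (weak_deriv a ^^ k) u x = jet a u k x"
    and "k \<le> 2 \<Longrightarrow> x \<in> {0..a} \<Longrightarrow> jet a u k x = jet a u k 0 + integral {0..x} ((weak_deriv a ^^ Suc k) u)"
    and "k \<le> 1 \<Longrightarrow> x \<in> {0..a} \<Longrightarrow> (jet a u k has_vector_derivative jet a u (Suc k) x) (at x within {0..a})"
proof -
  have s: "(weak_deriv a ^^ k) u \<in> sobolev (3 - k) a" if "k \<le> 3" for k
    using that
  proof (induction k)
    case 0 then show ?case using u by simp
  next
    case (Suc k)
    have e: "3 - k = Suc (3 - Suc k)" using Suc.prems by simp
    have "(weak_deriv a ^^ k) u \<in> sobolev (Suc (3 - Suc k)) a"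
      using Suc.IH Suc.prems unfolding e by simp
    from sobolev_point_value(1)[OF a this] show ?case by simp
  qed
  have s': "(weak_deriv a ^^ k) u \<in> sobolev (Suc (2 - k)) a" if "k \<le> 2" for k
  proof -
    have "3 - k = Suc (2 - k)" using that by simp
    then show ?thesis using s[of k] that by (simp only: le_SucI)
  qed
  show "(weak_deriv a ^^ 3) u \<in> L2 a" using s[of 3] by simp
  show "weak_deriv a u \<in> L2 a" using sobolev_L2[OF s[of 1]] by simp
  show "u \<in> L2 a" using sobolev_L2[OF u] .
  have c: "continuous_on {0..a} (jet a u k)" if "k \<le> 2" for k
    unfolding jet_def by (rule sobolev_point_value(4)[OF a s'[OF that]])
  then show "k \<le> 2 \<Longrightarrow> continuous_on {0..a} (jet a u k)" .
  have ae: "AE x in interval_measure a. (weak_deriv a ^^ k) u x = jet a u k x" if "k \<le> 2" for k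
    unfolding jet_def by (rule sobolev_point_value(3)[OF a s'[OF that]])
  then show "k \<le> 2 \<Longrightarrow> AE x in interval_measure a. (weak_deriv a ^^ k) u x = jet a u k x" .
  have p: "jet a u k x = jet a u k 0 + integral {0..x} ((weak_deriv a ^^ Suc k) u)" if "k \<le> 2" "x \<in> {0..a}" for k x
    unfolding jet_def using sobolev_point_value(2)[OF a s'[OF that(1)] that(2)] by simp
  then show "k \<le> 2 \<Longrightarrow> x \<in> {0..a} \<Longrightarrow> jet a u k x = jet a u k 0 + integral {0..x} ((weak_deriv a ^^ Suc k) u)" .
  show "(jet a u k has_vector_derivative jet a u (Suc k) x) (at x within {0..a})" if k: "k \<le> 1" and x: "x \<in> {0..a}"
  proof (rule has_vector_derivative_transform[OF x])
    show "((\<lambda>x. jet a u k 0 + integral {0..x} (jet a u (Suc k))) has_vector_derivative jet a u (Suc k) x) (at x within {0..a})"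
      using integral_has_vector_derivative[OF c x, of "Suc k"] k by (auto intro!: derivative_eq_intros)
    show "jet a u k y = jet a u k 0 + integral {0..y} (jet a u (Suc k))" if y: "y \<in> {0..a}" for y
    proof -
      have "integral {0..y} ((weak_deriv a ^^ Suc k) u) = integral {0..y} (jet a u (Suc k))"
        using ae[of "Suc k"] k y by (intro integral_cong_AE_interval) auto
      then show ?thesis using p[of k y] k y by simp
    qed
  qed
qed

text \<open>The weighted energy balance on one edge, for the weight \<open>\<rho> x = \<kappa> + \<epsilon> x\<close>. One integration by parts moves a
derivative away from \<open>u'''\<close>, which is merely square integrable; everything left is classical calculus for \<open>u\<close>, \<open>u'\<close>, \<open>u''\<close>.\<close>

lemma energy_identity:
  fixes \<kappa> \<epsilon> :: real and u :: "real \<Rightarrow> complex"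
  assumes a: "0 < a" and u: "u \<in> sobolev 3 a"
    and end0: "jet a u 0 a = 0" "jet a u 1 a = 0"
  defines "Au \<equiv> \<lambda>x. - weak_deriv a u x - (weak_deriv a ^^ 3) u x"
  shows "2 * Re (\<integral>x. of_real (\<kappa> + \<epsilon> * x) * (Au x * cnj (u x)) \<partial>interval_measure a)
    = \<kappa> * (2 * Re (jet a u 2 0 * cnj (jet a u 0 0)) - (cmod (jet a u 1 0))\<^sup>2 + (cmod (jet a u 0 0))\<^sup>2)
      - 2 * \<epsilon> * Re (jet a u 1 0 * cnj (jet a u 0 0))
      + \<epsilon> * (\<integral>x. (cmod (u x))\<^sup>2 \<partial>interval_measure a)
      - 3 * \<epsilon> * integral {0..a} (\<lambda>x. (cmod (jet a u 1 x))\<^sup>2)"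
proof -
  define U0 U1 U2 g where "U0 = jet a u 0" and "U1 = jet a u 1" and "U2 = jet a u 2" and "g = (weak_deriv a ^^ 3) u"
  note J = jet_primitive[OF a u]
  have c: "continuous_on {0..a} U0" "continuous_on {0..a} U1" "continuous_on {0..a} U2"
    unfolding U0_def U1_def U2_def by (intro J(4); simp)+
  have d0: "(U0 has_vector_derivative U1 x) (at x within {0..a})" if "x \<in> {0..a}" for x
    using J(7)[of 0 x] that by (simp add: U0_def U1_def)
  have d1: "(U1 has_vector_derivative U2 x) (at x within {0..a})" if "x \<in> {0..a}" for x
    using J(7)[of 1 x] that by (simp add: U1_def U2_def numeral_2_eq_2)
  have p2: "U2 x = U2 0 + integral {0..x} g" if "x \<in> {0..a}" for x
    using J(6)[of 2 x] that by (simp add: U2_def g_def numeral_3_eq_3 numeral_2_eq_2)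
  have gL: "g \<in> L2 a" using J(1) by (simp add: g_def)
  define \<rho> :: "real \<Rightarrow> complex" where "\<rho> x = of_real (\<kappa> + \<epsilon> * x)" for x
  have cr: "continuous_on {0..a} \<rho>" unfolding \<rho>_def by (intro continuous_intros)
  have dr: "(\<rho> has_vector_derivative of_real \<epsilon>) (at x within {0..a})" for x
    unfolding \<rho>_def by (auto intro!: derivative_eq_intros simp: has_vector_derivative_def scaleR_conv_of_real)
  define \<phi> \<phi>' where "\<phi> x = \<rho> x * cnj (U0 x)" and "\<phi>' x = \<rho> x * cnj (U1 x) + of_real \<epsilon> * cnj (U0 x)" for x
  have dphi: "(\<phi> has_vector_derivative \<phi>' x) (at x within {0..a})" if "x \<in> {0..a}" for x
    unfolding \<phi>_def \<phi>'_def
    by (rule has_vector_derivative_mult[OF dr has_vector_derivative_cnj[OF d0[OF that]]])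
  have cphi': "continuous_on {0..a} \<phi>'" unfolding \<phi>'_def by (intro continuous_intros c cr)
  have cphi: "continuous_on {0..a} \<phi>" unfolding \<phi>_def by (intro continuous_intros c cr)
  have parts: "integral {0..a} (\<lambda>x. g x * \<phi> x) + integral {0..a} (\<lambda>x. U2 x * \<phi>' x) = U2 a * \<phi> a - U2 0 * \<phi> 0"
    by (rule integral_by_parts_primitive(1)[of a g U2 \<phi> \<phi>'];
        blast intro: less_imp_le[OF a] L2_integrable[OF gL] p2 dphi cphi')
  have phia: "\<phi> a = 0" using end0 by (simp add: \<phi>_def U0_def)
  have gphi: "integrable (interval_measure a) (\<lambda>x. g x * \<phi> x)"
    by (rule L2_times_integrable[OF gL continuous_L2[OF cphi]])
  define I where "I = (\<integral>x. \<rho> x * (Au x * cnj (u x)) \<partial>interval_measure a)"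
  have "I = (\<integral>x. - (U1 x * \<phi> x) - g x * \<phi> x \<partial>interval_measure a)"
    unfolding I_def
  proof (rule integral_cong_AE)
    have m: "u \<in> borel_measurable (interval_measure a)" "weak_deriv a u \<in> borel_measurable (interval_measure a)"
      "g \<in> borel_measurable (interval_measure a)" "\<rho> \<in> borel_measurable (interval_measure a)"
      "U1 \<in> borel_measurable (interval_measure a)" "\<phi> \<in> borel_measurable (interval_measure a)"
      using J(2,3) gL continuous_L2[OF cr] continuous_L2[OF c(2)] continuous_L2[OF cphi] by (auto simp: L2_def)
    have mc: "(\<lambda>x. cnj (u x)) \<in> borel_measurable (interval_measure a)"
      by (rule measurable_compose[OF m(1)]) (intro borel_measurable_continuous_onI continuous_intros)
    show "(\<lambda>x. \<rho> x * (Au x * cnj (u x))) \<in> borel_measurable (interval_measure a)"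
      unfolding Au_def g_def[symmetric] using m mc by simp
    show "(\<lambda>x. - (U1 x * \<phi> x) - g x * \<phi> x) \<in> borel_measurable (interval_measure a)"
      using m by simp
    have "AE x in interval_measure a. u x = U0 x" "AE x in interval_measure a. weak_deriv a u x = U1 x"
      using J(5)[of 0] J(5)[of 1] by (auto simp: U0_def U1_def)
    then show "AE x in interval_measure a. \<rho> x * (Au x * cnj (u x)) = - (U1 x * \<phi> x) - g x * \<phi> x"
      by eventually_elim (simp add: Au_def g_def \<phi>_def algebra_simps)
  qed
  also have "\<dots> = - integral {0..a} (\<lambda>x. U1 x * \<phi> x) - integral {0..a} (\<lambda>x. g x * \<phi> x)"
  proof -
    have i: "integrable (interval_measure a) (\<lambda>x. U1 x * \<phi> x)"
      by (intro continuous_integrable_interval continuous_intros c cphi)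
    have "(\<integral>x. - (U1 x * \<phi> x) - g x * \<phi> x \<partial>interval_measure a)
        = - (\<integral>x. U1 x * \<phi> x \<partial>interval_measure a) - (\<integral>x. g x * \<phi> x \<partial>interval_measure a)"
      using i gphi by simp
    then show ?thesis using integral_interval[OF i] integral_interval[OF gphi] by simp
  qed
  also have "\<dots> = integral {0..a} (\<lambda>x. U2 x * \<phi>' x) - integral {0..a} (\<lambda>x. U1 x * \<phi> x) + U2 0 * \<phi> 0"
  proof -
    have "integral {0..a} (\<lambda>x. g x * \<phi> x) = (U2 a * \<phi> a - U2 0 * \<phi> 0) - integral {0..a} (\<lambda>x. U2 x * \<phi>' x)"
      unfolding parts[symmetric] by simp
    then show ?thesis using phia by simp
  qed
  finally have I: "I = integral {0..a} (\<lambda>x. U2 x * \<phi>' x) - integral {0..a} (\<lambda>x. U1 x * \<phi> x) + U2 0 * \<phi> 0" .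
  \<comment> \<open>twice the real part of the remaining integrand is an exact derivative up to sign-definite terms\<close>
  define K where "K x = \<rho> x * (U1 x * cnj (U1 x)) + of_real \<epsilon> * (U1 x * cnj (U0 x) + U0 x * cnj (U1 x))
      - \<rho> x * (U0 x * cnj (U0 x))" for x
  define Q where "Q x = U2 x * \<phi>' x - U1 x * \<phi> x" for x
  define R where "R x = 3 * of_real \<epsilon> * (U1 x * cnj (U1 x)) - of_real \<epsilon> * (U0 x * cnj (U0 x))" for x
  have dK: "(K has_vector_derivative Q x + cnj (Q x) + R x) (at x within {0..a})" if x: "x \<in> {0..a}" for x
  proof -
    note d = d0[OF x] d1[OF x] has_vector_derivative_cnj[OF d0[OF x]] has_vector_derivative_cnj[OF d1[OF x]] dr[of x]
    have "(K has_vector_derivative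
        (\<rho> x * (U1 x * cnj (U2 x) + U2 x * cnj (U1 x)) + of_real \<epsilon> * (U1 x * cnj (U1 x)))
        + of_real \<epsilon> * ((U1 x * cnj (U1 x) + U2 x * cnj (U0 x)) + (U0 x * cnj (U2 x) + U1 x * cnj (U1 x)))
        - (\<rho> x * (U0 x * cnj (U1 x) + U1 x * cnj (U0 x)) + of_real \<epsilon> * (U0 x * cnj (U0 x)))) (at x within {0..a})"
      unfolding K_def
      by (intro has_vector_derivative_diff has_vector_derivative_add has_vector_derivative_mult
            has_vector_derivative_mult_right d)
    moreover have "cnj (\<rho> x) = \<rho> x" by (simp add: \<rho>_def)
    ultimately show ?thesis
      by (simp add: Q_def R_def \<phi>_def \<phi>'_def algebra_simps)
  qed
  have KI: "((\<lambda>x. Q x + cnj (Q x) + R x) has_integral (K a - K 0)) {0..a}"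
    using a dK by (intro fundamental_theorem_of_calculus) auto
  have cQ: "continuous_on {0..a} Q" unfolding Q_def by (intro continuous_intros c cphi cphi')
  have QI: "(Q has_integral integral {0..a} Q) {0..a}"
    using cQ by (simp add: integrable_continuous_real integrable_integral)
  define n0 n1 where "n0 = integral {0..a} (\<lambda>x. (cmod (U0 x))\<^sup>2)" and "n1 = integral {0..a} (\<lambda>x. (cmod (U1 x))\<^sup>2)"
  have nI: "((\<lambda>x. U x * cnj (U x)) has_integral of_real (integral {0..a} (\<lambda>x. (cmod (U x))\<^sup>2))) {0..a}"
    if "continuous_on {0..a} U" for U
  proof -
    have "((\<lambda>x. (cmod (U x))\<^sup>2) has_integral integral {0..a} (\<lambda>x. (cmod (U x))\<^sup>2)) {0..a}"
      by (intro integrable_integral integrable_continuous_real continuous_intros that)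
    then have "((\<lambda>x. complex_of_real ((cmod (U x))\<^sup>2)) has_integral of_real (integral {0..a} (\<lambda>x. (cmod (U x))\<^sup>2))) {0..a}"
      by (rule has_integral_of_real)
    then show ?thesis by (simp only: complex_norm_square)
  qed
  have "((\<lambda>x. Q x + cnj (Q x) + R x) has_integral
      (integral {0..a} Q + cnj (integral {0..a} Q) + (3 * of_real \<epsilon> * of_real n1 - of_real \<epsilon> * of_real n0))) {0..a}"
    unfolding R_def n0_def n1_def
    using QI has_integral_cnj[THEN iffD2, OF QI, unfolded o_def] nI[OF c(1)] nI[OF c(2)]
    by (intro has_integral_add has_integral_diff has_integral_mult_right) auto
  then have "integral {0..a} Q + cnj (integral {0..a} Q) + (3 * of_real \<epsilon> * of_real n1 - of_real \<epsilon> * of_real n0) = K a - K 0"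
    using KI has_integral_unique by blast
  from arg_cong[OF this, of Re]
  have ReQ: "2 * Re (integral {0..a} Q) = - Re (K 0) - 3 * \<epsilon> * n1 + \<epsilon> * n0"
    using end0 by (simp add: K_def U0_def U1_def)
  have "integral {0..a} Q = integral {0..a} (\<lambda>x. U2 x * \<phi>' x) - integral {0..a} (\<lambda>x. U1 x * \<phi> x)"
    unfolding Q_def by (intro Henstock_Kurzweil_Integration.integral_diff integrable_continuous_real continuous_intros c cphi cphi')
  then have IQ: "I = integral {0..a} Q + U2 0 * \<phi> 0" using I by simp
  have n0M: "(\<integral>x. (cmod (u x))\<^sup>2 \<partial>interval_measure a) = n0"
  proof -
    have i: "integrable (interval_measure a) (\<lambda>x. (cmod (u x))\<^sup>2)" using J(3) by (simp add: L2_def)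
    have "AE x in interval_measure a. (cmod (u x))\<^sup>2 = (cmod (U0 x))\<^sup>2"
      using J(5)[of 0] by (auto simp: U0_def elim!: eventually_mono)
    then show ?thesis
      unfolding n0_def integral_interval[OF i] by (rule integral_cong_AE_interval) auto
  qed
  have "Re (K 0) = \<kappa> * (cmod (U1 0))\<^sup>2 + 2 * \<epsilon> * Re (U1 0 * cnj (U0 0)) - \<kappa> * (cmod (U0 0))\<^sup>2"
    by (simp add: K_def \<rho>_def cmod_power2 algebra_simps) (simp add: power2_eq_square algebra_simps)
  moreover have "Re (U2 0 * \<phi> 0) = \<kappa> * Re (U2 0 * cnj (U0 0))"
    by (simp add: \<phi>_def \<rho>_def algebra_simps)
  ultimately have "2 * Re I = \<kappa> * (2 * Re (U2 0 * cnj (U0 0)) - (cmod (U1 0))\<^sup>2 + (cmod (U0 0))\<^sup>2)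
      - 2 * \<epsilon> * Re (U1 0 * cnj (U0 0)) + \<epsilon> * n0 - 3 * \<epsilon> * n1"
    unfolding IQ plus_complex.sel distrib_left ReQ by (simp add: algebra_simps)
  then show ?thesis
    unfolding I_def \<rho>_def U0_def U1_def U2_def n0M[symmetric] n1_def .
qed

section \<open>The stationary boundary value problem on one edge\<close>

text \<open>The form \<open>m\<^sup>2 + m n + n\<^sup>2\<close> is invariant under the symmetries of the hexagonal lattice, which permute
\<open>m\<close>, \<open>n\<close>, \<open>- m - n\<close> up to sign. One of them moves the point into the open positive quadrant.\<close>

lemma Eisenstein_norm_positive:
  fixes m n :: int
  assumes "m \<noteq> 0" "n \<noteq> 0" "m + n \<noteq> 0"
  shows "\<exists>k l :: nat. 1 \<le> k \<and> 1 \<le> l \<and> int (k\<^sup>2 + l\<^sup>2 + k * l) = m\<^sup>2 + m * n + n\<^sup>2"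
proof -
  have *: ?thesis if "0 < k" "0 < l" "k\<^sup>2 + l\<^sup>2 + k * l = m\<^sup>2 + m * n + n\<^sup>2" for k l :: int
    using that by (intro exI[of _ "nat k"] exI[of _ "nat l"]) auto
  consider "0 < m" "0 < n" | "m < 0" "n < 0" | "0 < m" "n < 0" "0 < m + n" | "0 < m" "n < 0" "m + n < 0"
    | "m < 0" "0 < n" "0 < m + n" | "m < 0" "0 < n" "m + n < 0"
    using assms by linarith
  then show ?thesis
  proof cases
    case 1 then show ?thesis by (intro *[of m n]) (auto simp: algebra_simps)
  next
    case 2 then show ?thesis by (intro *[of "-m" "-n"]) (auto simp: algebra_simps)
  next
    case 3 then show ?thesis by (intro *[of "m + n" "-n"]) (auto simp: algebra_simps power2_eq_square)
  next
    case 4 then show ?thesis by (intro *[of "m" "- m - n"]) (auto simp: algebra_simps power2_eq_square)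
  next
    case 5 then show ?thesis by (intro *[of "m + n" "- m"]) (auto simp: algebra_simps power2_eq_square)
  next
    case 6 then show ?thesis by (intro *[of "n" "- m - n"]) (auto simp: algebra_simps power2_eq_square)
  qed
qed

lemma depressed_cubic_roots:
  fixes \<nu> :: complex
  obtains z1 z2 z3 where "z1 ^ 3 + z1 + \<nu> = 0" "z2 ^ 3 + z2 + \<nu> = 0" "z3 ^ 3 + z3 + \<nu> = 0"
    "z1 + z2 + z3 = 0" "z1 * z2 + z1 * z3 + z2 * z3 = 1"
proof -
  have "\<not> constant (poly [:\<nu>, 1, 0, 1:])"
  proof
    assume "constant (poly [:\<nu>, 1, 0, 1:])"
    then have "poly [:\<nu>, 1, 0, 1:] 0 = poly [:\<nu>, 1, 0, 1:] 1" unfolding constant_def by blast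
    then show False by simp
  qed
  then obtain z1 where "poly [:\<nu>, 1, 0, 1:] z1 = 0"
    using fundamental_theorem_of_algebra by blast
  then have z1: "z1 ^ 3 + z1 + \<nu> = 0" by (simp add: algebra_simps power3_eq_cube)
  define s where "s = csqrt (- 3 * z1\<^sup>2 - 4)"
  have s2: "s * s = - 3 * z1 * z1 - 4" unfolding s_def by (simp add: power2_eq_square[symmetric])
  define z2 z3 where "z2 = (- z1 + s) / 2" and "z3 = (- z1 - s) / 2"
  have sum: "z1 + z2 + z3 = 0" by (simp add: z2_def z3_def field_simps)
  have "z2 * z3 = (z1 * z1 - s * s) / 4" by (simp add: z2_def z3_def field_simps)
  then have "4 * (z2 * z3) = 4 * (z1 * z1 + 1)" by (simp add: s2 algebra_simps)
  then have prod: "z2 * z3 = z1 * z1 + 1" by (simp only: mult_cancel_left) simp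
  have z23: "z3 = - z1 - z2" using sum by (simp add: eq_neg_iff_add_eq_0 algebra_simps)
  have "z2 * z2 + z1 * z2 = - (z2 * z3)" unfolding z23 by (simp add: algebra_simps)
  then have q: "z2 * z2 + z1 * z2 + z1 * z1 + 1 = 0" by (simp add: prod)
  have e2: "z * z + z1 * z + z1 * z1 + 1 = 0 \<Longrightarrow> z ^ 3 + z + \<nu> = 0" for z
  proof -
    assume h: "z * z + z1 * z + z1 * z1 + 1 = 0"
    have "z ^ 3 + z + \<nu> = (z - z1) * (z * z + z1 * z + z1 * z1 + 1) + (z1 ^ 3 + z1 + \<nu>)"
      by (simp add: algebra_simps power3_eq_cube)
    then show ?thesis using h z1 by simp
  qed
  have q3: "z3 * z3 + z1 * z3 + z1 * z1 + 1 = 0" using q unfolding z23 by (simp add: algebra_simps)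
  have "z1 * z2 + z1 * z3 + z2 * z3 = z1 * (z2 + z3) + z2 * z3" by (simp add: algebra_simps)
  also have "z2 + z3 = - z1" unfolding z23 by simp
  finally have "z1 * z2 + z1 * z3 + z2 * z3 = 1" by (simp add: prod)
  then show ?thesis using that z1 e2[OF q] e2[OF q3] sum by blast
qed

lemma constant_of_zero_derivative:
  fixes f :: "real \<Rightarrow> 'a::real_normed_vector"
  assumes "0 \<le> a" "\<And>x. x \<in> {0..a} \<Longrightarrow> (f has_vector_derivative 0) (at x within {0..a})"
  shows "f a = f 0"
proof -
  have "\<exists>c. \<forall>x\<in>{0..a}. f x = c"
    by (rule has_derivative_zero_constant) (use assms(2) in \<open>auto simp: has_vector_derivative_def\<close>)
  then show ?thesis using assms(1) by auto
qed

text \<open>The functions \<open>U0, U1, U2\<close> are \<open>u, u', u''\<close> for a solution of \<open>\<nu> u + u' + u''' = 0\<close>.\<close>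

locale stationary_edge =
  fixes l :: real and \<nu> :: complex and U0 U1 U2 :: "real \<Rightarrow> complex"
  assumes l: "0 < l"
    and d0: "\<And>x. x \<in> {0..l} \<Longrightarrow> (U0 has_vector_derivative U1 x) (at x within {0..l})"
    and d1: "\<And>x. x \<in> {0..l} \<Longrightarrow> (U1 has_vector_derivative U2 x) (at x within {0..l})"
    and d2: "\<And>x. x \<in> {0..l} \<Longrightarrow> (U2 has_vector_derivative - U1 x - \<nu> * U0 x) (at x within {0..l})"
    and start: "U0 0 = 0" "U1 0 = 0"
begin

text \<open>Formally \<open>W z\<close> arises on integrating \<open>e\<^sup>-\<^sup>z\<^sup>x (\<nu> u + u' + u''')\<close> by parts: its derivative is
\<open>- (z\<^sup>3 + z + \<nu>) e\<^sup>-\<^sup>z\<^sup>x u\<close>, so that it is a first integral when \<open>z\<close> is a characteristic root.\<close>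

definition W :: "complex \<Rightarrow> real \<Rightarrow> complex" where
  "W z x = exp (- z * of_real x) * (U2 x + z * U1 x + (z\<^sup>2 + 1) * U0 x)"

lemma d_exp: "((\<lambda>x. exp (- z * of_real x)) has_vector_derivative - z * exp (- z * of_real x)) (at x within A)"
  for z :: complex
proof -
  have "((\<lambda>w. exp (- z * w)) has_field_derivative - z * exp (- z * of_real x)) (at (of_real x))"
    by (auto intro!: derivative_eq_intros)
  then show ?thesis by (rule has_vector_derivative_real_field)
qed

lemma W_deriv_zero:
  assumes z: "z ^ 3 + z + \<nu> = 0" and x: "x \<in> {0..l}"
  shows "(W z has_vector_derivative 0) (at x within {0..l})"
proof -
  have "(W z has_vector_derivative
      exp (- z * of_real x) * ((- U1 x - \<nu> * U0 x) + z * U2 x + (z\<^sup>2 + 1) * U1 x)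
      + (- z * exp (- z * of_real x)) * (U2 x + z * U1 x + (z\<^sup>2 + 1) * U0 x)) (at x within {0..l})"
    unfolding W_def
    by (intro has_vector_derivative_mult has_vector_derivative_add has_vector_derivative_mult_right d_exp d0 d1 d2 x)
  moreover have "exp (- z * of_real x) * ((- U1 x - \<nu> * U0 x) + z * U2 x + (z\<^sup>2 + 1) * U1 x)
      + (- z * exp (- z * of_real x)) * (U2 x + z * U1 x + (z\<^sup>2 + 1) * U0 x)
      = - (z ^ 3 + z + \<nu>) * (exp (- z * of_real x) * U0 x)"
    by (simp add: algebra_simps power2_eq_square power3_eq_cube)
  ultimately show ?thesis using z by simp
qed

lemma W_const: "z ^ 3 + z + \<nu> = 0 \<Longrightarrow> W z l = W z 0"
  by (rule constant_of_zero_derivative) (use l W_deriv_zero in auto)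

text \<open>At a double root the derivative of \<open>W z\<close> with respect to \<open>z\<close> is a second first integral.\<close>

lemma dW_const:
  assumes z: "z ^ 3 + z + \<nu> = 0" and z': "3 * z\<^sup>2 + 1 = 0"
  defines "V \<equiv> \<lambda>x. exp (- z * of_real x) * (U1 x + 2 * z * U0 x) - of_real x * W z x"
  shows "V l = V 0"
proof (rule constant_of_zero_derivative)
  fix x assume x: "x \<in> {0..l}"
  have dW: "(W z has_vector_derivative 0) (at x within {0..l})" by (rule W_deriv_zero[OF z x])
  have dx: "((\<lambda>x. of_real x) has_vector_derivative (1 :: complex)) (at x within {0..l})"
    by (auto intro!: derivative_eq_intros simp: has_vector_derivative_def scaleR_conv_of_real)
  have "(V has_vector_derivative
      (exp (- z * of_real x) * (U2 x + 2 * z * U1 x) + (- z * exp (- z * of_real x)) * (U1 x + 2 * z * U0 x))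
      - (of_real x * 0 + 1 * W z x)) (at x within {0..l})"
    unfolding V_def
    by (intro has_vector_derivative_diff has_vector_derivative_mult has_vector_derivative_add
        has_vector_derivative_mult_right d_exp d0 d1 dW dx x)
  moreover have "(exp (- z * of_real x) * (U2 x + 2 * z * U1 x) + (- z * exp (- z * of_real x)) * (U1 x + 2 * z * U0 x))
      - (of_real x * 0 + 1 * W z x) = - (3 * z\<^sup>2 + 1) * (exp (- z * of_real x) * U0 x)"
    by (simp add: W_def algebra_simps power2_eq_square)
  ultimately show "(V has_vector_derivative 0) (at x within {0..l})" using z' by simp
qed (use l in simp)

text \<open>With \<open>u, u'\<close> zero at both ends the first integrals read \<open>u''(0) = e\<^sup>-\<^sup>z\<^sup>l u''(l)\<close>. A double root would also
give \<open>l e\<^sup>-\<^sup>z\<^sup>l u''(l) = 0\<close>; so if \<open>u''(0) \<noteq> 0\<close>, the roots are distinct and congruent modulo \<open>2 \<pi> \<i> / l\<close>. The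
symmetric functions of the roots turn this into \<open>(2 \<pi> / l)\<^sup>2 (m\<^sup>2 + m n + n\<^sup>2) = 3\<close>.\<close>

lemma noncritical_trace_zero:
  assumes fin: "U0 l = 0" "U1 l = 0" and crit: "l \<notin> critical_lengths"
  shows "U2 0 = 0"
proof (rule ccontr)
  assume a: "U2 0 \<noteq> 0"
  obtain z1 z2 z3 where z: "z1 ^ 3 + z1 + \<nu> = 0" "z2 ^ 3 + z2 + \<nu> = 0" "z3 ^ 3 + z3 + \<nu> = 0"
    and sum: "z1 + z2 + z3 = 0" and pairs: "z1 * z2 + z1 * z3 + z2 * z3 = 1"
    by (rule depressed_cubic_roots)
  have E: "exp (- z * of_real l) * U2 l = U2 0" if "z ^ 3 + z + \<nu> = 0" for z
    using W_const[OF that] start fin by (simp add: W_def)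
  have b: "U2 l \<noteq> 0" using E[OF z(1)] a by auto
  have simple: "3 * z\<^sup>2 + 1 \<noteq> 0" if "z ^ 3 + z + \<nu> = 0" for z
  proof
    assume "3 * z\<^sup>2 + 1 = 0"
    from dW_const[OF that this] have "of_real l * (exp (- z * of_real l) * U2 l) = 0"
      using start fin by (simp add: W_def)
    then show False using l b by simp
  qed
  have distinct: "p \<noteq> q" if "p ^ 3 + p + \<nu> = 0" "p + q + r = 0" "p * q + p * r + q * r = 1" for p q r
  proof
    assume "p = q"
    then have "r = - 2 * p" using that(2) by (simp add: eq_neg_iff_add_eq_0 algebra_simps)
    then have "3 * p\<^sup>2 + 1 = 0"
      using that(3) \<open>p = q\<close> by (simp add: power2_eq_square algebra_simps) (metis add_diff_cancel_left' diff_minus_eq_add add.inverse_inverse add.commute right_minus)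
    then show False using simple[OF that(1)] by simp
  qed
  have ne: "z1 \<noteq> z2" "z2 \<noteq> z3" "z1 \<noteq> z3"
    using distinct[of z1 z2 z3] distinct[of z2 z3 z1] distinct[of z1 z3 z2] z sum pairs
    by (auto simp: algebra_simps)
  have shift: "\<exists>n::int. p - q = \<i> * of_real (2 * pi / l * of_int n)"
    if "p ^ 3 + p + \<nu> = 0" "q ^ 3 + q + \<nu> = 0" for p q
  proof -
    have "exp (- q * of_real l) = exp (- p * of_real l)"
      using E[OF that(1)] E[OF that(2)] b by (metis mult_right_cancel)
    then obtain n :: int where "- q * of_real l = - p * of_real l + of_int (2 * n) * pi * \<i>"
      unfolding exp_eq by blast
    then have "(p - q) * of_real l = \<i> * of_real (2 * pi * of_int n)" by (simp add: algebra_simps)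
    then have "p - q = \<i> * of_real (2 * pi * of_int n) / of_real l" using l by (simp add: field_simps)
    then show ?thesis by (intro exI[of _ n]) (simp add: field_simps)
  qed
  obtain m :: int where m: "z1 - z2 = \<i> * of_real (2 * pi / l * of_int m)" using shift[OF z(1,2)] by blast
  obtain n :: int where n: "z2 - z3 = \<i> * of_real (2 * pi / l * of_int n)" using shift[OF z(2,3)] by blast
  have "m \<noteq> 0" "n \<noteq> 0" using m n ne by auto
  moreover have "m + n \<noteq> 0"
  proof
    assume "m + n = 0"
    then have "n = - m" by simp
    then have "z1 - z3 = 0" using m n by (metis (no_types, lifting) add.right_inverse add_diff_eq diff_add_cancel mult_minus_right of_int_minus of_real_minus)
    then show False using ne(3) by simp
  qed
  ultimately obtain k j :: nat where kj: "1 \<le> k" "1 \<le> j" "int (k\<^sup>2 + j\<^sup>2 + k * j) = m\<^sup>2 + m * n + n\<^sup>2"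
    using Eisenstein_norm_positive by blast
  have "(z1 - z2)\<^sup>2 + (z1 - z2) * (z2 - z3) + (z2 - z3)\<^sup>2 = (z1 + z2 + z3)\<^sup>2 - 3 * (z1 * z2 + z1 * z3 + z2 * z3)"
    by (simp add: algebra_simps power2_eq_square)
  then have m3: "(z1 - z2)\<^sup>2 + (z1 - z2) * (z2 - z3) + (z2 - z3)\<^sup>2 = - 3" by (simp add: sum pairs)
  have "(z1 - z2)\<^sup>2 + (z1 - z2) * (z2 - z3) + (z2 - z3)\<^sup>2
      = - of_real ((2 * pi / l)\<^sup>2 * of_int (m\<^sup>2 + m * n + n\<^sup>2))"
  proof -
    have "(\<i> * (p * M))\<^sup>2 + (\<i> * (p * M)) * (\<i> * (p * N)) + (\<i> * (p * N))\<^sup>2 = - (p\<^sup>2 * (M\<^sup>2 + M * N + N\<^sup>2))"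
      for p M N :: complex
      by (simp add: algebra_simps power2_eq_square)
    from this[of "of_real (2 * pi / l)" "of_int m" "of_int n"] show ?thesis
      unfolding m n by simp
  qed
  then have "complex_of_real ((2 * pi / l)\<^sup>2 * of_int (m\<^sup>2 + m * n + n\<^sup>2)) = of_real 3"
    using m3 by simp
  then have "(2 * pi / l)\<^sup>2 * of_int (m\<^sup>2 + m * n + n\<^sup>2) = 3"
    using of_real_eq_iff by blast
  then have "(2 * pi / l)\<^sup>2 * real (k\<^sup>2 + j\<^sup>2 + k * j) = 3"
    unfolding kj(3)[symmetric] by simp
  then have "l\<^sup>2 = (2 * pi)\<^sup>2 * (real (k\<^sup>2 + j\<^sup>2 + k * j) / 3)"
    using l by (simp add: power_divide field_simps)
  from arg_cong[OF this, of sqrt]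
  have "sqrt (l\<^sup>2) = sqrt ((2 * pi)\<^sup>2 * (real (k\<^sup>2 + j\<^sup>2 + k * j) / 3))" .
  then have "l = 2 * pi * sqrt (real (k\<^sup>2 + j\<^sup>2 + k * j) / 3)"
    using l by (simp only: real_sqrt_mult real_sqrt_abs) simp
  then have "l \<in> critical_lengths"
    unfolding critical_lengths_def using kj by blast
  then show False using crit by simp
qed

text \<open>Uniqueness for the initial value problem, by a Gronwall argument for \<open>\<bar>u\<bar>\<^sup>2 + \<bar>u'\<bar>\<^sup>2 + \<bar>u''\<bar>\<^sup>2\<close>.\<close>

lemma zero_of_zero_trace:
  assumes U2: "U2 0 = 0" and x: "x \<in> {0..l}"
  shows "U0 x = 0"
proof -
  define C where "C = 3 + cmod \<nu>"
  define \<Phi> where "\<Phi> x = (cmod (U0 x))\<^sup>2 + (cmod (U1 x))\<^sup>2 + (cmod (U2 x))\<^sup>2" for x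
  define \<Phi>' where "\<Phi>' x = 2 * (U0 x \<bullet> U1 x) + 2 * (U1 x \<bullet> U2 x) + 2 * (U2 x \<bullet> (- U1 x - \<nu> * U0 x))" for x
  have dn: "((\<lambda>x. (cmod (f x))\<^sup>2) has_vector_derivative 2 * (f y \<bullet> f')) (at y within {0..l})"
    if "(f has_vector_derivative f') (at y within {0..l})" for f :: "real \<Rightarrow> complex" and f' y
  proof -
    have "((\<lambda>x. f x \<bullet> f x) has_vector_derivative f y \<bullet> f' + f' \<bullet> f y) (at y within {0..l})"
      using bounded_bilinear.has_vector_derivative[OF bounded_bilinear_inner that that] .
    then show ?thesis by (simp add: power2_norm_eq_inner inner_commute)
  qed
  have dPhi: "(\<Phi> has_vector_derivative \<Phi>' y) (at y within {0..l})" if "y \<in> {0..l}" for y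
    unfolding \<Phi>_def \<Phi>'_def by (intro has_vector_derivative_add dn d0 d1 d2 that)
  have ab: "2 * (p \<bullet> q) \<le> (cmod p)\<^sup>2 + (cmod q)\<^sup>2" for p q :: complex
  proof -
    have "0 \<le> (p - q) \<bullet> (p - q)" by simp
    then show ?thesis by (simp add: inner_diff_left inner_diff_right inner_commute power2_norm_eq_inner)
  qed
  have bound: "\<Phi>' y \<le> C * \<Phi> y" for y
  proof -
    have 1: "2 * (U2 y \<bullet> (- U1 y)) \<le> (cmod (U2 y))\<^sup>2 + (cmod (U1 y))\<^sup>2"
      using ab[of "U2 y" "- U1 y"] by simp
    have "U2 y \<bullet> (- (\<nu> * U0 y)) \<le> cmod (U2 y) * (cmod \<nu> * cmod (U0 y))"
      using norm_cauchy_schwarz[of "U2 y" "- (\<nu> * U0 y)"] by (simp add: norm_mult)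
    also have "2 * \<dots> \<le> cmod \<nu> * ((cmod (U2 y))\<^sup>2 + (cmod (U0 y))\<^sup>2)"
    proof -
      have "2 * (cmod (U2 y) * cmod (U0 y)) \<le> (cmod (U2 y))\<^sup>2 + (cmod (U0 y))\<^sup>2"
        using sum_squares_bound[of "cmod (U2 y)" "cmod (U0 y)"] by simp
      from mult_left_mono[OF this, of "cmod \<nu>"] show ?thesis by (simp add: algebra_simps)
    qed
    finally have 2: "2 * (U2 y \<bullet> (- (\<nu> * U0 y))) \<le> cmod \<nu> * ((cmod (U2 y))\<^sup>2 + (cmod (U0 y))\<^sup>2)" by simp
    have 3: "0 \<le> cmod \<nu> * (cmod (U1 y))\<^sup>2" "0 \<le> (cmod (U0 y))\<^sup>2" "0 \<le> (cmod (U2 y))\<^sup>2" by simp_all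
    have "\<Phi>' y = 2 * (U0 y \<bullet> U1 y) + 2 * (U1 y \<bullet> U2 y) + (2 * (U2 y \<bullet> (- U1 y)) + 2 * (U2 y \<bullet> (- (\<nu> * U0 y))))"
      by (simp add: \<Phi>'_def inner_diff_right)
    then have "\<Phi>' y \<le> ((cmod (U0 y))\<^sup>2 + (cmod (U1 y))\<^sup>2) + ((cmod (U1 y))\<^sup>2 + (cmod (U2 y))\<^sup>2)
        + (((cmod (U2 y))\<^sup>2 + (cmod (U1 y))\<^sup>2) + cmod \<nu> * ((cmod (U2 y))\<^sup>2 + (cmod (U0 y))\<^sup>2))"
      using ab[of "U0 y" "U1 y"] ab[of "U1 y" "U2 y"] 1 2 by linarith
    also have "\<dots> = C * \<Phi> y - (2 * (cmod (U0 y))\<^sup>2 + (cmod (U2 y))\<^sup>2 + cmod \<nu> * (cmod (U1 y))\<^sup>2)"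
      by (simp add: \<Phi>_def C_def algebra_simps)
    finally show ?thesis using 3 by linarith
  qed
  define \<Psi> where "\<Psi> y = exp (- C * y) * \<Phi> y" for y
  have dPsi: "(\<Psi> has_vector_derivative exp (- C * y) * (\<Phi>' y - C * \<Phi> y)) (at y within {0..l})" if "y \<in> {0..l}" for y
  proof -
    have "((\<lambda>y. exp (- C * y)) has_vector_derivative - C * exp (- C * y)) (at y within {0..l})"
      unfolding has_real_derivative_iff_has_vector_derivative[symmetric] by (auto intro!: derivative_eq_intros)
    from has_vector_derivative_mult[OF this dPhi[OF that]] show ?thesis
      unfolding \<Psi>_def by (simp add: algebra_simps)
  qed
  have "\<Psi> x \<le> \<Psi> 0"
  proof (rule DERIV_nonpos_imp_decreasing_open[where f = \<Psi> and a = 0 and b = x])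
    show "0 \<le> x" using x by simp
    show "continuous_on {0..x} \<Psi>"
      using dPsi x by (intro continuous_on_subset[where s = "{0..l}" and t = "{0..x}"])
        (auto simp only: continuous_on_eq_continuous_within intro: has_vector_derivative_continuous, auto)
    fix y assume y: "0 < y" "y < x"
    have "at y within {0..l} = at y" using y x by (intro at_within_interior) auto
    then have "(\<Psi> has_real_derivative exp (- C * y) * (\<Phi>' y - C * \<Phi> y)) (at y)"
      using dPsi[of y] y x by (simp add: has_real_derivative_iff_has_vector_derivative)
    moreover have "exp (- C * y) * (\<Phi>' y - C * \<Phi> y) \<le> 0"
      using bound[of y] by (simp add: mult_le_0_iff)
    ultimately show "\<exists>d. (\<Psi> has_real_derivative d) (at y) \<and> d \<le> 0" by blast
  qed
  moreover have "\<Psi> 0 = 0" using start U2 by (simp add: \<Psi>_def \<Phi>_def)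
  ultimately have "\<Phi> x \<le> 0" by (simp add: \<Psi>_def mult_le_0_iff)
  then have "(cmod (U0 x))\<^sup>2 \<le> 0"
    unfolding \<Phi>_def using zero_le_power2[of "cmod (U1 x)"] zero_le_power2[of "cmod (U2 x)"] by linarith
  then show ?thesis by simp
qed

end

section \<open>The network as a semi-inner product space\<close>

definition net_lc :: "complex \<Rightarrow> netfun \<Rightarrow> complex \<Rightarrow> netfun \<Rightarrow> netfun" where
  "net_lc a u b v = (\<lambda>j x. a * u j x + b * v j x)"

definition weighted_ip :: "nat \<Rightarrow> (nat \<Rightarrow> real) \<Rightarrow> (real \<Rightarrow> real) \<Rightarrow> netfun \<Rightarrow> netfun \<Rightarrow> complex" where
  "weighted_ip N L \<rho> u v = (\<Sum>j=1..N. \<integral>x. of_real (\<rho> x) * (u j x * cnj (v j x)) \<partial>interval_measure (L j))"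

abbreviation net_ip :: "nat \<Rightarrow> (nat \<Rightarrow> real) \<Rightarrow> netfun \<Rightarrow> netfun \<Rightarrow> complex" where
  "net_ip N L \<equiv> weighted_ip N L (\<lambda>_. 1)"

lemma integrable_times_continuous:
  fixes f :: "real \<Rightarrow> complex"
  assumes \<rho>: "continuous_on UNIV (\<rho> :: real \<Rightarrow> real)" and f: "integrable (interval_measure a) f"
  shows "integrable (interval_measure a) (\<lambda>x. of_real (\<rho> x) * f x)"
proof -
  have c: "continuous_on {0..a} \<rho>" by (rule continuous_on_subset[OF \<rho>]) simp
  then have "bounded (\<rho> ` {0..a})" by (intro compact_imp_bounded compact_continuous_image) auto
  then obtain B where B: "\<And>x. x \<in> {0..a} \<Longrightarrow> norm (\<rho> x) \<le> B" unfolding bounded_iff by blast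
  have m: "(\<lambda>x. complex_of_real (\<rho> x)) \<in> borel_measurable (interval_measure a)"
    by (rule borel_measurable_integrable[OF continuous_integrable_interval]) (intro continuous_intros c)
  have "integrable (interval_measure a) (\<lambda>x. of_real B * f x)" using f by simp
  then show ?thesis
  proof (rule Bochner_Integration.integrable_bound)
    show "(\<lambda>x. of_real (\<rho> x) * f x) \<in> borel_measurable (interval_measure a)"
      using m f by (intro borel_measurable_times) auto
    show "AE x in interval_measure a. norm (of_real (\<rho> x) * f x) \<le> norm (of_real B * f x)"
    proof (rule AE_I2)
      fix x assume "x \<in> space (interval_measure a)"
      then have "x \<in> {0..a}" by auto
      then have "norm (\<rho> x) \<le> \<bar>B\<bar>" using B[of x] by linarith
      then show "norm (of_real (\<rho> x) * f x) \<le> norm (of_real B * f x)"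
        by (simp add: norm_mult mult_right_mono)
    qed
  qed
qed

lemma L2_cnj: "f \<in> L2 a \<Longrightarrow> (\<lambda>x. cnj (f x)) \<in> L2 a"
proof -
  assume f: "f \<in> L2 a"
  then have "f \<in> borel_measurable (interval_measure a)" by (simp add: L2_def)
  then have "(\<lambda>x. cnj (f x)) \<in> borel_measurable (interval_measure a)"
    by (rule measurable_compose) (intro borel_measurable_continuous_onI continuous_intros)
  then show ?thesis using f by (simp add: L2_def)
qed

lemma weighted_integrable:
  assumes "continuous_on UNIV \<rho>" "f \<in> L2 a" "g \<in> L2 a"
  shows "integrable (interval_measure a) (\<lambda>x. of_real (\<rho> x) * (f x * cnj (g x)))"
  by (intro integrable_times_continuous L2_times_integrable L2_cnj assms)

lemma L2_netD: "u \<in> L2_net N L \<Longrightarrow> j \<in> {1..N} \<Longrightarrow> u j \<in> L2 (L j)"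
  by (simp add: L2_net_def)

lemma net_lc_mem: "u \<in> L2_net N L \<Longrightarrow> v \<in> L2_net N L \<Longrightarrow> net_lc a u b v \<in> L2_net N L"
  unfolding L2_net_def net_lc_def by (auto intro: L2_lincomb)

lemma Re_weighted_ip_self:
  assumes \<rho>: "continuous_on UNIV \<rho>" and u: "u \<in> L2_net N L"
  shows "Re (weighted_ip N L \<rho> u u) = (\<Sum>j=1..N. \<integral>x. \<rho> x * (cmod (u j x))\<^sup>2 \<partial>interval_measure (L j))"
proof -
  have "(\<integral>x. of_real (\<rho> x) * (u j x * cnj (u j x)) \<partial>interval_measure (L j))
      = of_real (\<integral>x. \<rho> x * (cmod (u j x))\<^sup>2 \<partial>interval_measure (L j))" for j
    by (simp only: complex_norm_square[symmetric] of_real_mult[symmetric] integral_complex_of_real)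
  then show ?thesis by (simp add: weighted_ip_def)
qed

lemma weighted_ip_space:
  assumes \<rho>: "continuous_on UNIV \<rho>" and pos: "\<And>x. 0 \<le> x \<Longrightarrow> 0 \<le> \<rho> x"
  shows "semi_inner_space (L2_net N L) net_lc (weighted_ip N L \<rho>)"
proof
  fix u v w :: netfun and a b :: complex
  assume u: "u \<in> L2_net N L" and v: "v \<in> L2_net N L"
  show "net_lc a u b v \<in> L2_net N L" using u v by (rule net_lc_mem)
  show "weighted_ip N L \<rho> v u = cnj (weighted_ip N L \<rho> u v)"
    unfolding weighted_ip_def cnj_sum
  proof (rule sum.cong)
    fix j assume "j \<in> {1..N}"
    have "cnj (\<integral>x. of_real (\<rho> x) * (u j x * cnj (v j x)) \<partial>interval_measure (L j))
        = (\<integral>x. cnj (of_real (\<rho> x) * (u j x * cnj (v j x))) \<partial>interval_measure (L j))" by (rule Bochner_Integration.integral_cnj[symmetric])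
    then show "(\<integral>x. of_real (\<rho> x) * (v j x * cnj (u j x)) \<partial>interval_measure (L j))
        = cnj (\<integral>x. of_real (\<rho> x) * (u j x * cnj (v j x)) \<partial>interval_measure (L j))"
      by (simp add: mult.commute)
  qed simp
  assume w: "w \<in> L2_net N L"
  show "weighted_ip N L \<rho> (net_lc a u b v) w = a * weighted_ip N L \<rho> u w + b * weighted_ip N L \<rho> v w"
    unfolding weighted_ip_def sum_distrib_left sum.distrib[symmetric]
  proof (rule sum.cong)
    fix j assume j: "j \<in> {1..N}"
    note i = weighted_integrable[OF \<rho> L2_netD[OF u j] L2_netD[OF w j]] weighted_integrable[OF \<rho> L2_netD[OF v j] L2_netD[OF w j]]
    have "(\<lambda>x. of_real (\<rho> x) * (net_lc a u b v j x * cnj (w j x)))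
      = (\<lambda>x. a * (of_real (\<rho> x) * (u j x * cnj (w j x))) + b * (of_real (\<rho> x) * (v j x * cnj (w j x))))"
      by (simp add: net_lc_def algebra_simps)
    then show "(\<integral>x. of_real (\<rho> x) * (net_lc a u b v j x * cnj (w j x)) \<partial>interval_measure (L j))
      = a * (\<integral>x. of_real (\<rho> x) * (u j x * cnj (w j x)) \<partial>interval_measure (L j))
        + b * (\<integral>x. of_real (\<rho> x) * (v j x * cnj (w j x)) \<partial>interval_measure (L j))"
      using i by simp
  qed simp
next
  fix u :: netfun assume u: "u \<in> L2_net N L"
  have "0 \<le> (\<integral>x. \<rho> x * (cmod (u j x))\<^sup>2 \<partial>interval_measure (L j))" for j
    by (rule Bochner_Integration.integral_nonneg) (use pos in auto)
  then show "0 \<le> Re (weighted_ip N L \<rho> u u)"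
    unfolding Re_weighted_ip_self[OF \<rho> u] by (intro sum_nonneg) auto
qed

lemma weighted_ip_le:
  assumes \<rho>: "continuous_on UNIV \<rho>" and le: "\<And>j x. j \<in> {1..N} \<Longrightarrow> 0 \<le> x \<Longrightarrow> x \<le> L j \<Longrightarrow> \<rho> x \<le> B"
    and u: "u \<in> L2_net N L"
  shows "Re (weighted_ip N L \<rho> u u) \<le> B * Re (net_ip N L u u)"
proof -
  have c1: "continuous_on UNIV (\<lambda>_::real. 1::real)" by simp
  have "(\<integral>x. \<rho> x * (cmod (u j x))\<^sup>2 \<partial>interval_measure (L j)) \<le> B * (\<integral>x. (cmod (u j x))\<^sup>2 \<partial>interval_measure (L j))"
    if j: "j \<in> {1..N}" for j
  proof -
    have i: "integrable (interval_measure (L j)) (\<lambda>x. (cmod (u j x))\<^sup>2)"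
      using L2_netD[OF u j] by (simp add: L2_def)
    have "integrable (interval_measure (L j)) (\<lambda>x. of_real (\<rho> x) * (u j x * cnj (u j x)))"
      by (rule weighted_integrable[OF \<rho> L2_netD[OF u j] L2_netD[OF u j]])
    then have "integrable (interval_measure (L j)) (\<lambda>x. complex_of_real (\<rho> x * (cmod (u j x))\<^sup>2))"
      by (simp only: complex_norm_square[symmetric] of_real_mult[symmetric])
    then have i2: "integrable (interval_measure (L j)) (\<lambda>x. \<rho> x * (cmod (u j x))\<^sup>2)"
      by (simp only: complex_of_real_integrable_eq)
    have "(\<integral>x. \<rho> x * (cmod (u j x))\<^sup>2 \<partial>interval_measure (L j)) \<le> (\<integral>x. B * (cmod (u j x))\<^sup>2 \<partial>interval_measure (L j))"
      using i i2 le[OF j] by (intro integral_mono) (auto intro!: mult_right_mono)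
    then show ?thesis by simp
  qed
  then show ?thesis
    unfolding Re_weighted_ip_self[OF \<rho> u] Re_weighted_ip_self[OF c1 u] sum_distrib_left
    by (intro sum_mono) auto
qed

lemma norm_net_eq: "u \<in> L2_net N L \<Longrightarrow> norm_net N L u = sqrt (Re (net_ip N L u u))"
  by (simp add: Re_weighted_ip_self norm_net_def)

lemma net_ip_space: "semi_inner_space (L2_net N L) net_lc (net_ip N L)"
  by (rule weighted_ip_space) auto

lemma norm_net_nm: "u \<in> L2_net N L \<Longrightarrow> norm_net N L u = semi_inner_space.nm (net_ip N L) u"
  by (simp add: norm_net_eq semi_inner_space.nm_def[OF net_ip_space])

lemma eq_net_ip:
  assumes e: "eq_net N L u v" and u: "u \<in> L2_net N L" and v: "v \<in> L2_net N L" and w: "w \<in> L2_net N L"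
  shows "net_ip N L u w = net_ip N L v w"
  unfolding weighted_ip_def
proof (rule sum.cong)
  fix j assume j: "j \<in> {1..N}"
  show "(\<integral>x. of_real 1 * (u j x * cnj (w j x)) \<partial>interval_measure (L j)) = (\<integral>x. of_real 1 * (v j x * cnj (w j x)) \<partial>interval_measure (L j))"
  proof (rule integral_cong_AE)
    show "AE x in interval_measure (L j). of_real 1 * (u j x * cnj (w j x)) = of_real 1 * (v j x * cnj (w j x))"
      using e j by (auto simp: eq_net_def elim!: eventually_mono)
  qed (use weighted_integrable[OF _ L2_netD[OF u j] L2_netD[OF w j], of "\<lambda>_. 1"]
        weighted_integrable[OF _ L2_netD[OF v j] L2_netD[OF w j], of "\<lambda>_. 1"] in auto)
qed simp

lemma exp_A_contraction_semigroup:
  assumes S: "C0_contraction_semigroup N L S"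
  shows "contraction_semigroup (L2_net N L) net_lc (net_ip N L) S"
proof -
  interpret semi_inner_space "L2_net N L" net_lc "net_ip N L" by (rule net_ip_space)
  have mem: "S t u \<in> L2_net N L" if "0 \<le> t" "u \<in> L2_net N L" for t u
    using S that by (simp add: C0_contraction_semigroup_def)
  have contr: "norm_net N L (S t u) \<le> norm_net N L u" if "0 \<le> t" "u \<in> L2_net N L" for t u
    using S that by (simp add: C0_contraction_semigroup_def)
  have lin: "eq_net N L (S t (net_lc a u b v)) (net_lc a (S t u) b (S t v))"
    if "0 \<le> t" "u \<in> L2_net N L" "v \<in> L2_net N L" for t a u b v
    using S that by (simp add: C0_contraction_semigroup_def net_lc_def)
  have zero: "eq_net N L (S 0 u) u" if "u \<in> L2_net N L" for u
    using S that by (simp add: C0_contraction_semigroup_def)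
  have add: "eq_net N L (S (s + t) u) (S s (S t u))" if "0 \<le> s" "0 \<le> t" "u \<in> L2_net N L" for s t u
    using S that by (simp add: C0_contraction_semigroup_def)
  have cont: "((\<lambda>t. norm_net N L (net_lc 1 (S t u) (-1) u)) \<longlongrightarrow> 0) (at_right 0)" if "u \<in> L2_net N L" for u
    using S that by (simp add: C0_contraction_semigroup_def net_lc_def)
  show ?thesis
  proof
    show "nm (S t u) \<le> nm u" if "0 \<le> t" "u \<in> L2_net N L" for t u
      using contr[OF that] mem[OF that] that by (simp add: norm_net_nm)
    show "net_ip N L (S t (net_lc a u b v)) w = a * net_ip N L (S t u) w + b * net_ip N L (S t v) w"
      if "0 \<le> t" "u \<in> L2_net N L" "v \<in> L2_net N L" "w \<in> L2_net N L" for t u v w a b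
      using eq_net_ip[OF lin] mem that by (simp del: net_lc_mem)
    show "net_ip N L (S 0 u) w = net_ip N L u w" if "u \<in> L2_net N L" "w \<in> L2_net N L" for u w
      using eq_net_ip[OF zero] mem that by simp
    show "net_ip N L (S (s + t) u) w = net_ip N L (S s (S t u)) w"
      if "0 \<le> s" "0 \<le> t" "u \<in> L2_net N L" "w \<in> L2_net N L" for s t u w
      using eq_net_ip[OF add] mem that by simp
    show "((\<lambda>t. nm (net_lc 1 (S t u) (- 1) u)) \<longlongrightarrow> 0) (at_right 0)" if u: "u \<in> L2_net N L" for u
    proof -
      have "\<forall>\<^sub>F t in at_right 0. norm_net N L (net_lc 1 (S t u) (-1) u) = nm (net_lc 1 (S t u) (-1) u)"
        unfolding eventually_at_right_field using mem u by (intro exI[of _ 1]) (auto intro!: norm_net_nm net_lc_mem)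
      then show ?thesis using cont[OF u] tendsto_cong by fast
    qed
  qed (rule mem)
qed

lemma infinitesimal_generator_gen:
  assumes S: "C0_contraction_semigroup N L S"
  shows "infinitesimal_generator N L S u v \<longleftrightarrow> contraction_semigroup.gen (L2_net N L) net_lc (net_ip N L) S u v"
proof -
  interpret contraction_semigroup "L2_net N L" net_lc "net_ip N L" S
    by (rule exp_A_contraction_semigroup[OF S])
  show ?thesis
  proof (cases "u \<in> L2_net N L \<and> v \<in> L2_net N L")
    case True
    have "\<forall>\<^sub>F h in at_right 0. norm_net N L (\<lambda>j x. (S h u j x - u j x) / complex_of_real h - v j x)
        = nm (net_lc 1 (net_lc (1 / of_real h) (S h u) (- (1 / of_real h)) u) (- 1) v)"
      unfolding eventually_at_right_field
    proof (intro exI[of _ 1] conjI allI impI)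
      fix h :: real assume h: "0 < h" "h < 1"
      have "(\<lambda>j x. (S h u j x - u j x) / complex_of_real h - v j x)
          = net_lc 1 (net_lc (1 / of_real h) (S h u) (- (1 / of_real h)) u) (- 1) v"
        by (simp add: net_lc_def diff_divide_distrib)
      then show "norm_net N L (\<lambda>j x. (S h u j x - u j x) / complex_of_real h - v j x)
          = nm (net_lc 1 (net_lc (1 / of_real h) (S h u) (- (1 / of_real h)) u) (- 1) v)"
        using True h by (simp add: norm_net_nm)
    qed simp
    from tendsto_cong[OF this] show ?thesis
      using True by (simp add: infinitesimal_generator_def gen_def)
  qed (auto simp: infinitesimal_generator_def gen_def)
qed

section \<open>Energy balance on the network\<close>

lemma dom_A_D:
  assumes L: "\<forall>i\<in>{1..N}. L i > 0" and N: "N \<ge> 1" and u: "u \<in> dom_A N \<alpha> L"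
  shows "j \<in> {1..N} \<Longrightarrow> u j \<in> sobolev 3 (L j)"
    and "j \<in> {1..N} \<Longrightarrow> jet (L j) (u j) 0 (L j) = 0"
    and "j \<in> {1..N} \<Longrightarrow> jet (L j) (u j) 1 (L j) = 0"
    and "j \<in> {1..N} \<Longrightarrow> jet (L j) (u j) 0 0 = jet (L 1) (u 1) 0 0"
    and "(\<Sum>j=1..N. jet (L j) (u j) 2 0) = - of_real \<alpha> * jet (L 1) (u 1) 0 0"
    and "u \<in> L2_net N L" and "op_A L u \<in> L2_net N L"
proof -
  show s3: "j \<in> {1..N} \<Longrightarrow> u j \<in> sobolev 3 (L j)" for j using u by (simp add: dom_A_def)
  show "j \<in> {1..N} \<Longrightarrow> jet (L j) (u j) 0 (L j) = 0" "j \<in> {1..N} \<Longrightarrow> jet (L j) (u j) 1 (L j) = 0"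
    using u by (auto simp: dom_A_def H2e_net_def jet_def)
  show "j \<in> {1..N} \<Longrightarrow> jet (L j) (u j) 0 0 = jet (L 1) (u 1) 0 0"
  proof -
    assume j: "j \<in> {1..N}"
    have "\<forall>j\<in>{1..N}. \<forall>k\<in>{1..N}. point_value (L j) (u j) 0 = point_value (L k) (u k) 0"
      using u unfolding dom_A_def H2e_net_def by blast
    then have "point_value (L j) (u j) 0 = point_value (L 1) (u 1) 0"
      using j N by (meson atLeastAtMost_iff order_refl)
    then show ?thesis by (simp add: jet_def)
  qed
  show "(\<Sum>j=1..N. jet (L j) (u j) 2 0) = - of_real \<alpha> * jet (L 1) (u 1) 0 0"
    using u by (simp add: dom_A_def jet_def)
  have "u j \<in> L2 (L j)" if j: "j \<in> {1..N}" for j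
    by (rule sobolev_L2[OF s3[OF j]])
  then show "u \<in> L2_net N L" by (simp add: L2_net_def)
  have "op_A L u j \<in> L2 (L j)" if j: "j \<in> {1..N}" for j
    using L2_lincomb[OF jet_primitive(2)[OF _ s3[OF j]] jet_primitive(1)[OF _ s3[OF j]], of "-1" "-1"] L j
    by (simp add: op_A_def)
  then show "op_A L u \<in> L2_net N L" by (simp add: L2_net_def)
qed

text \<open>Summing the edge identities, the coupling condition at the centre replaces the sum of the \<open>u\<^sub>j''(0)\<close> by
\<open>- \<alpha> u(0)\<close>. The choice \<open>\<kappa> = 1\<close>, \<open>\<epsilon> = 0\<close> is the plain energy balance.\<close>

lemma network_energy:
  fixes \<kappa> \<epsilon> :: real
  assumes L: "\<forall>i\<in>{1..N}. L i > 0" and N: "N \<ge> 1" and u: "u \<in> dom_A N \<alpha> L"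
  shows "2 * Re (weighted_ip N L (\<lambda>x. \<kappa> + \<epsilon> * x) (op_A L u) u)
    = \<kappa> * (- (2 * \<alpha> - real N) * (cmod (jet (L 1) (u 1) 0 0))\<^sup>2 - (\<Sum>j=1..N. (cmod (jet (L j) (u j) 1 0))\<^sup>2))
      - 2 * \<epsilon> * (\<Sum>j=1..N. Re (jet (L j) (u j) 1 0 * cnj (jet (L 1) (u 1) 0 0)))
      + \<epsilon> * (norm_net N L u)\<^sup>2
      - 3 * \<epsilon> * (\<Sum>j=1..N. integral {0..L j} (\<lambda>x. (cmod (jet (L j) (u j) 1 x))\<^sup>2))"
proof -
  note D = dom_A_D[OF L N u]
  define c where "c = jet (L 1) (u 1) 0 0"
  have E: "2 * Re (\<integral>x. of_real (\<kappa> + \<epsilon> * x) * (op_A L u j x * cnj (u j x)) \<partial>interval_measure (L j))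
    = \<kappa> * (2 * Re (jet (L j) (u j) 2 0 * cnj c) - (cmod (jet (L j) (u j) 1 0))\<^sup>2 + (cmod c)\<^sup>2)
      - 2 * \<epsilon> * Re (jet (L j) (u j) 1 0 * cnj c)
      + \<epsilon> * (\<integral>x. (cmod (u j x))\<^sup>2 \<partial>interval_measure (L j))
      - 3 * \<epsilon> * integral {0..L j} (\<lambda>x. (cmod (jet (L j) (u j) 1 x))\<^sup>2)" if j: "j \<in> {1..N}" for j
    using energy_identity[OF _ D(1)[OF j] D(2)[OF j] D(3)[OF j], of \<kappa> \<epsilon>] L j D(4)[OF j] by (simp add: op_A_def c_def)
  have "2 * Re (weighted_ip N L (\<lambda>x. \<kappa> + \<epsilon> * x) (op_A L u) u)
    = (\<Sum>j=1..N. 2 * Re (\<integral>x. of_real (\<kappa> + \<epsilon> * x) * (op_A L u j x * cnj (u j x)) \<partial>interval_measure (L j)))"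
    by (simp add: weighted_ip_def sum_distrib_left)
  also have "\<dots> = (\<Sum>j=1..N. \<kappa> * (2 * Re (jet (L j) (u j) 2 0 * cnj c) - (cmod (jet (L j) (u j) 1 0))\<^sup>2 + (cmod c)\<^sup>2)
      - 2 * \<epsilon> * Re (jet (L j) (u j) 1 0 * cnj c)
      + \<epsilon> * (\<integral>x. (cmod (u j x))\<^sup>2 \<partial>interval_measure (L j))
      - 3 * \<epsilon> * integral {0..L j} (\<lambda>x. (cmod (jet (L j) (u j) 1 x))\<^sup>2))"
    by (rule sum.cong[OF refl E])
  also have "\<dots> = \<kappa> * (2 * Re ((\<Sum>j=1..N. jet (L j) (u j) 2 0) * cnj c) - (\<Sum>j=1..N. (cmod (jet (L j) (u j) 1 0))\<^sup>2) + real N * (cmod c)\<^sup>2)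
      - 2 * \<epsilon> * (\<Sum>j=1..N. Re (jet (L j) (u j) 1 0 * cnj c))
      + \<epsilon> * (\<Sum>j=1..N. \<integral>x. (cmod (u j x))\<^sup>2 \<partial>interval_measure (L j))
      - 3 * \<epsilon> * (\<Sum>j=1..N. integral {0..L j} (\<lambda>x. (cmod (jet (L j) (u j) 1 x))\<^sup>2))"
    unfolding sum_distrib_right Re_sum
    by (simp only: sum.distrib sum_subtractf sum_distrib_left[symmetric] sum_constant card_atLeastAtMost) simp
  also have "Re ((\<Sum>j=1..N. jet (L j) (u j) 2 0) * cnj c) = - \<alpha> * (cmod c)\<^sup>2"
  proof -
    have "(\<Sum>j=1..N. jet (L j) (u j) 2 0) * cnj c = of_real (- \<alpha>) * (c * cnj c)"
      using D(5) by (simp add: c_def)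
    also have "\<dots> = of_real (- \<alpha> * (cmod c)\<^sup>2)"
      by (simp only: complex_norm_square[symmetric] of_real_mult[symmetric])
    finally show ?thesis by simp
  qed
  also have "(\<Sum>j=1..N. \<integral>x. (cmod (u j x))\<^sup>2 \<partial>interval_measure (L j)) = (norm_net N L u)\<^sup>2"
    unfolding norm_net_def by (subst real_sqrt_pow2) (auto intro!: sum_nonneg)
  finally show ?thesis by (simp add: c_def algebra_simps)
qed

section \<open>Density of the domain\<close>

lemma weak_deriv_C1:
  assumes a: "0 < a" and f: "f \<in> L2 a" "AE x in interval_measure a. f x = F x"
    and d: "\<And>x. (F has_vector_derivative F' x) (at x)" and c: "continuous_on UNIV F'"
  shows "is_weak_deriv a f F'" "AE x in interval_measure a. weak_deriv a f x = F' x" "weak_deriv a f \<in> L2 a"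
proof -
  have c': "continuous_on {0..a} F'" by (rule continuous_on_subset[OF c]) simp
  have F': "F' \<in> L2 a" by (rule continuous_L2[OF c'])
  have "F x = F 0 + integral {0..x} F'" if "x \<in> {0..a}" for x
  proof -
    have "(F' has_integral F x - F 0) {0..x}"
      using that d by (intro fundamental_theorem_of_calculus) (auto intro: has_vector_derivative_at_within)
    then show ?thesis by (simp add: integral_unique)
  qed
  then show w: "is_weak_deriv a f F'"
    by (rule primitive_is_weak_deriv[OF a L2_integrable[OF F'] _ f(2)]) (use f(1) in \<open>auto simp: L2_def\<close>)
  have "weak_deriv a f \<in> L2 a \<and> is_weak_deriv a f (weak_deriv a f)"
    unfolding weak_deriv_def by (rule someI[of "\<lambda>g. g \<in> L2 a \<and> is_weak_deriv a f g" F']) (use F' w in blast)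
  then show "AE x in interval_measure a. weak_deriv a f x = F' x" "weak_deriv a f \<in> L2 a"
    using is_weak_deriv_unique[OF a f(1) _ _ F' w] by auto
qed

text \<open>Multiples of \<open>bump\<^sup>3\<close> have vanishing traces up to order two at both ends and so satisfy every boundary and
coupling condition. Each differentiation lowers the power of the bump by one.\<close>

definition bump :: "real \<Rightarrow> real \<Rightarrow> real" where
  "bump a x = x * (a - x)"

lemma bump_power_deriv:
  assumes "(q has_vector_derivative q' x) (at x)"
  shows "((\<lambda>x. bump a x ^ Suc k *\<^sub>R q x) has_vector_derivative
    bump a x ^ k *\<^sub>R ((real (Suc k) * (a - 2 * x)) *\<^sub>R q x + bump a x *\<^sub>R q' x)) (at x)"
proof -
  have "((\<lambda>x. bump a x ^ Suc k) has_real_derivative real (Suc k) * bump a x ^ k * (a - 2 * x)) (at x)"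
    unfolding bump_def by (rule derivative_eq_intros refl | simp add: algebra_simps)+
  from has_vector_derivative_scaleR[OF this assms] show ?thesis
    by (simp add: scaleR_right_distrib mult.commute mult.left_commute add.commute)
qed

lemma bump_multiple_smooth:
  fixes q :: "real \<Rightarrow> complex"
  assumes a: "0 < a" and q: "polynomial_function q"
  defines "p \<equiv> \<lambda>x. bump a x ^ 3 *\<^sub>R q x"
  shows "p \<in> sobolev 3 a" and "\<And>k x. k \<le> 2 \<Longrightarrow> x \<in> {0, a} \<Longrightarrow> point_value a ((weak_deriv a ^^ k) p) x = 0"
proof -
  have pb: "polynomial_function (bump a)" "polynomial_function (\<lambda>x. real n * (a - 2 * x))" for n
  proof -
    have i: "real_polynomial_function (\<lambda>x::real. x)"
      by (rule real_polynomial_function.intros(1)[OF bounded_linear_ident])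
    have c: "real_polynomial_function (\<lambda>x::real. c)" for c by (rule real_polynomial_function.intros(2))
    show "polynomial_function (bump a)" "polynomial_function (\<lambda>x. real n * (a - 2 * x))"
      unfolding bump_def[abs_def] real_polynomial_function_eq[symmetric]
      by (intro real_polynomial_function.intros(4) real_polynomial_function_diff i c)+
  qed
  have step: "\<exists>r'. polynomial_function r' \<and> (\<forall>x. ((\<lambda>x. bump a x ^ Suc k *\<^sub>R r x) has_vector_derivative bump a x ^ k *\<^sub>R r' x) (at x))"
    if r: "polynomial_function r" for r :: "real \<Rightarrow> complex" and k
  proof -
    obtain r1 where r1: "polynomial_function r1" "\<And>x. (r has_vector_derivative r1 x) (at x)"
      using has_vector_derivative_polynomial_function[OF r] by blast
    have D: "((\<lambda>x. bump a x ^ Suc k *\<^sub>R r x) has_vector_derivative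
      bump a x ^ k *\<^sub>R ((real (Suc k) * (a - 2 * x)) *\<^sub>R r x + bump a x *\<^sub>R r1 x)) (at x)" for x
      by (rule bump_power_deriv) (rule r1(2))
    show ?thesis
      using D r r1(1) pb(1) pb(2)[of "Suc k"]
      by (intro exI[of _ "\<lambda>x. (real (Suc k) * (a - 2 * x)) *\<^sub>R r x + bump a x *\<^sub>R r1 x"])
         (auto intro!: polynomial_function_add polynomial_function_mult simp del: of_nat_Suc)
  qed
  obtain q1 where q1: "polynomial_function q1" "\<And>x. (p has_vector_derivative bump a x ^ 2 *\<^sub>R q1 x) (at x)"
    using step[OF q, of 2] by (auto simp: p_def numeral_3_eq_3 numeral_2_eq_2)
  obtain q2 where q2: "polynomial_function q2" "\<And>x. ((\<lambda>x. bump a x ^ 2 *\<^sub>R q1 x) has_vector_derivative bump a x ^ 1 *\<^sub>R q2 x) (at x)"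
    using step[OF q1(1), of 1] by (auto simp: numeral_2_eq_2)
  obtain q3 where q3: "polynomial_function q3" "\<And>x. ((\<lambda>x. bump a x ^ 1 *\<^sub>R q2 x) has_vector_derivative q3 x) (at x)"
    using step[OF q2(1), of 0] by auto
  have cq: "continuous_on A r" if "polynomial_function r" for A and r :: "real \<Rightarrow> complex"
    using that by (rule continuous_on_polymonial_function)
  have cb: "continuous_on A (bump a)" for A unfolding bump_def by (intro continuous_intros)
  define p1 p2 where "p1 x = bump a x ^ 2 *\<^sub>R q1 x" and "p2 x = bump a x ^ 1 *\<^sub>R q2 x" for x
  note d = q1(2)[folded p1_def] q2(2)[folded p1_def p2_def] q3(2)[folded p2_def]
  have c: "continuous_on A p" "continuous_on A p1" "continuous_on A p2" "continuous_on A q3" for A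
    unfolding p_def p1_def p2_def 
    by (intro continuous_on_scaleR continuous_on_power cb cq q1(1) q2(1) q3(1) q)+
  have L: "p \<in> L2 a" "p1 \<in> L2 a" "p2 \<in> L2 a" "q3 \<in> L2 a" by (rule continuous_L2[OF c(1)] continuous_L2[OF c(2)] continuous_L2[OF c(3)] continuous_L2[OF c(4)])+
  note w = weak_deriv_C1[OF a L(1) AE_I2 d(1) c(2)] weak_deriv_C1[OF a L(2) AE_I2 d(2) c(3)] weak_deriv_C1[OF a L(3) AE_I2 d(3) c(4)]
  have "is_weak_deriv a p p1" "is_weak_deriv a p1 p2" "is_weak_deriv a p2 q3" using w(1,4,7) by auto
  then show "p \<in> sobolev 3 a" using L by (auto simp: numeral_3_eq_3)
  have ae1: "AE x in interval_measure a. weak_deriv a p x = p1 x" and l1: "weak_deriv a p \<in> L2 a"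
    using w(2,3) by auto
  note w2 = weak_deriv_C1[OF a l1 ae1 d(2) c(3)]
  have pv: "point_value a ((weak_deriv a ^^ 0) p) x = p x" "point_value a ((weak_deriv a ^^ 1) p) x = p1 x"
    "point_value a ((weak_deriv a ^^ 2) p) x = p2 x" if "x \<in> {0..a}" for x
    using point_value_eq[OF a c(1) AE_I2 that, of p] point_value_eq[OF a c(2) ae1 that] point_value_eq[OF a c(3) w2(2) that]
    by (auto simp: numeral_2_eq_2)
  show "point_value a ((weak_deriv a ^^ k) p) x = 0" if "k \<le> 2" "x \<in> {0, a}" for k x
  proof -
    have "x \<in> {0..a}" "bump a x = 0" using that a by (auto simp: bump_def)
    moreover have "k = 0 \<or> k = 1 \<or> k = 2" using that by auto
    ultimately show ?thesis using pv by (auto simp: p_def p1_def p2_def)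
  qed
qed

lemma L2_dominated_limit:
  fixes f :: "real \<Rightarrow> complex"
  assumes m: "\<And>n. g n \<in> borel_measurable (interval_measure a)" "f \<in> borel_measurable (interval_measure a)"
    and lim: "AE x in interval_measure a. (\<lambda>n. g n x) \<longlonglongrightarrow> f x"
    and w: "integrable (interval_measure a) w" and le: "\<And>n. AE x in interval_measure a. (cmod (g n x - f x))\<^sup>2 \<le> w x"
  shows "(\<lambda>n. \<integral>x. (cmod (g n x - f x))\<^sup>2 \<partial>interval_measure a) \<longlonglongrightarrow> 0"
proof -
  have "(\<lambda>n. \<integral>x. (cmod (g n x - f x))\<^sup>2 \<partial>interval_measure a) \<longlonglongrightarrow> (\<integral>x. 0 \<partial>interval_measure a)"
  proof (rule integral_dominated_convergence[OF _ _ w])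
    show "AE x in interval_measure a. (\<lambda>n. (cmod (g n x - f x))\<^sup>2) \<longlonglongrightarrow> 0"
      using lim
    proof eventually_elim
      case (elim x)
      then have "(\<lambda>n. (cmod (g n x - f x))\<^sup>2) \<longlonglongrightarrow> (cmod (f x - f x))\<^sup>2" by (intro tendsto_intros)
      then show ?case by simp
    qed
    show "(\<lambda>x. (cmod (g n x - f x))\<^sup>2) \<in> borel_measurable (interval_measure a)" for n
    proof -
      note [measurable] = m
      show ?thesis by measurable
    qed
    show "AE x in interval_measure a. norm ((cmod (g n x - f x))\<^sup>2) \<le> w x" for n using le[of n] by simp
  qed simp
  then show ?thesis by simp
qed

lemma L2_square_triangle:
  assumes "f \<in> L2 a" "g \<in> L2 a" "h \<in> L2 a"
  shows "(\<integral>x. (cmod (f x - h x))\<^sup>2 \<partial>interval_measure a)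
    \<le> 2 * (\<integral>x. (cmod (f x - g x))\<^sup>2 \<partial>interval_measure a) + 2 * (\<integral>x. (cmod (g x - h x))\<^sup>2 \<partial>interval_measure a)"
proof -
  have i: "integrable (interval_measure a) (\<lambda>x. (cmod (p x - q x))\<^sup>2)" if "p \<in> L2 a" "q \<in> L2 a" for p q
    using L2_lincomb[OF that, of 1 "-1"] by (simp add: L2_def)
  have "(\<integral>x. (cmod (f x - h x))\<^sup>2 \<partial>interval_measure a)
    \<le> (\<integral>x. 2 * (cmod (f x - g x))\<^sup>2 + 2 * (cmod (g x - h x))\<^sup>2 \<partial>interval_measure a)"
  proof (rule integral_mono)
    fix x
    have "(cmod (f x - h x))\<^sup>2 \<le> (cmod (f x - g x) + cmod (g x - h x))\<^sup>2"
      by (intro power_mono) (auto intro: norm_triangle_ineq4[THEN order_trans] norm_diff_triangle_ineq dist_triangle[of "f x" "h x" "g x", unfolded dist_norm])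
    also have "\<dots> \<le> 2 * (cmod (f x - g x))\<^sup>2 + 2 * (cmod (g x - h x))\<^sup>2"
      using sum_squares_bound[of "cmod (f x - g x)" "cmod (g x - h x)"] by (simp add: power2_sum)
    finally show "(cmod (f x - h x))\<^sup>2 \<le> 2 * (cmod (f x - g x))\<^sup>2 + 2 * (cmod (g x - h x))\<^sup>2" .
  qed (use i assms in auto)
  then show ?thesis using i assms by simp
qed

text \<open>Radial retraction onto the disc of radius \<open>m\<close>.\<close>

definition truncate :: "real \<Rightarrow> complex \<Rightarrow> complex" where
  "truncate m z = z / of_real (max 1 (cmod z / m))"

lemma truncate_bounds:
  assumes "m > 0"
  shows "cmod (truncate m z) \<le> m" "cmod (truncate m z - z) \<le> cmod z" "cmod z \<le> m \<Longrightarrow> truncate m z = z"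
    "continuous_on A (truncate m)"
proof -
  define M where "M = max 1 (cmod z / m)"
  have M: "1 \<le> M" "cmod z / m \<le> M" by (auto simp: M_def)
  have t: "truncate m z = z / of_real M" by (simp add: truncate_def M_def)
  show "cmod (truncate m z) \<le> m"
    unfolding t using M assms by (simp add: norm_divide divide_le_eq field_simps)
  have "truncate m z - z = z * of_real (1 / M - 1)" unfolding t by (simp add: algebra_simps)
  then have "cmod (truncate m z - z) = cmod z * \<bar>1 / M - 1\<bar>" by (simp only: norm_mult norm_of_real)
  moreover have "\<bar>1 / M - 1\<bar> \<le> 1" using M(1) by (simp add: abs_le_iff)
  ultimately show "cmod (truncate m z - z) \<le> cmod z"
    using mult_left_mono[of "\<bar>1 / M - 1\<bar>" 1 "cmod z"] by simp
  show "truncate m z = z" if "cmod z \<le> m" using that assms by (simp add: truncate_def)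
  show "continuous_on A (truncate m)" unfolding truncate_def by (intro continuous_intros) (use assms in auto)
qed

text \<open>A square integrable function is first truncated in size. The truncation is an almost everywhere limit of
continuous functions, which may be truncated at the same level and cut off near the endpoints without affecting
the limit; dominated convergence applies twice.\<close>

lemma continuous_approximation:
  assumes a: "0 < a" and f: "f \<in> L2 a" and e: "e > 0"
  obtains h d where "continuous_on UNIV h" "d > 0" "\<And>x. bump a x \<le> d \<Longrightarrow> h x = 0"
    "(\<integral>x. (cmod (h x - f x))\<^sup>2 \<partial>interval_measure a) < e"
proof -
  have fm: "f \<in> borel_measurable (interval_measure a)" and fi: "integrable (interval_measure a) (\<lambda>x. (cmod (f x))\<^sup>2)"
    using f by (auto simp: L2_def)
  have mc: "g \<in> borel_measurable (interval_measure a)" if "continuous_on UNIV g" for g :: "real \<Rightarrow> complex"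
    by (rule borel_measurable_integrable[OF continuous_integrable_interval[OF continuous_on_subset[OF that]]]) simp
  have mt: "(\<lambda>x. truncate m (f x)) \<in> borel_measurable (interval_measure a)" if "m > 0" for m
    by (rule measurable_compose[OF fm]) (intro borel_measurable_continuous_onI truncate_bounds(4) that)
  have "(\<lambda>n. \<integral>x. (cmod (truncate (real (Suc n)) (f x) - f x))\<^sup>2 \<partial>interval_measure a) \<longlonglongrightarrow> 0"
  proof (rule L2_dominated_limit[OF mt fm _ fi])
    show "AE x in interval_measure a. (\<lambda>n. truncate (real (Suc n)) (f x)) \<longlonglongrightarrow> f x"
    proof (rule AE_I2)
      fix x
      have "\<forall>\<^sub>F n in sequentially. truncate (real (Suc n)) (f x) = f x"
      proof (rule eventually_sequentiallyI[of "nat \<lceil>cmod (f x)\<rceil>"])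
        fix n assume "nat \<lceil>cmod (f x)\<rceil> \<le> n"
        then have "cmod (f x) \<le> real (Suc n)" by linarith
        then show "truncate (real (Suc n)) (f x) = f x" by (intro truncate_bounds(3)) auto
      qed
      then show "(\<lambda>n. truncate (real (Suc n)) (f x)) \<longlonglongrightarrow> f x" by (rule tendsto_eventually)
    qed
    show "AE x in interval_measure a. (cmod (truncate (real (Suc n)) (f x) - f x))\<^sup>2 \<le> (cmod (f x))\<^sup>2" for n
      using truncate_bounds(2)[of "real (Suc n)"] by (intro AE_I2 power_mono) auto
  qed simp
  from order_tendstoD(2)[OF this, of "e / 4"] e
  obtain m0 where m0: "(\<integral>x. (cmod (truncate (real (Suc m0)) (f x) - f x))\<^sup>2 \<partial>interval_measure a) < e / 4"
    by (auto simp: eventually_sequentially)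
  define m where "m = real (Suc m0)"
  have m: "m > 0" "(\<integral>x. (cmod (truncate m (f x) - f x))\<^sup>2 \<partial>interval_measure a) < e / 4"
    using m0 by (auto simp: m_def)
  have "f measurable_on {0<..<a}" using fm by (subst measurable_on_iff_borel_measurable) auto
  then obtain Z g where Z: "negligible Z" and g: "\<And>n. continuous_on UNIV (g n)"
    and glim: "\<And>x. x \<notin> Z \<Longrightarrow> (\<lambda>n. g n x) \<longlonglongrightarrow> (if x \<in> {0<..<a} then f x else 0)"
    unfolding measurable_on_def by blast
  \<comment> \<open>cut-off functions that vanish where \<open>bump \<le> 1 / n\<close> and equal \<open>1\<close> where \<open>bump \<ge> 2 / n\<close>\<close>
  define \<eta> where "\<eta> n x = min 1 (max 0 (real n * bump a x - 1))" for n :: nat and x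
  define h where "h n x = of_real (\<eta> n x) * truncate m (g n x)" for n x
  have ch: "continuous_on UNIV (h n)" for n
  proof -
    have "continuous_on UNIV (\<lambda>x. truncate m (g n x))"
      by (rule continuous_on_compose2[OF truncate_bounds(4)[OF m(1), of UNIV] g]) simp
    then show ?thesis unfolding h_def \<eta>_def bump_def by (intro continuous_intros)
  qed
  have hm: "cmod (h n x) \<le> m" for n x
  proof -
    have "\<bar>\<eta> n x\<bar> \<le> 1" by (auto simp: \<eta>_def)
    then have "\<bar>\<eta> n x\<bar> * cmod (truncate m (g n x)) \<le> 1 * m"
      using truncate_bounds(1)[OF m(1)] by (intro mult_mono) auto
    then show ?thesis by (simp add: h_def norm_mult)
  qed
  have tL: "(\<lambda>x. truncate m (f x)) \<in> L2 a"
  proof -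
    have "integrable (interval_measure a) (\<lambda>x. (cmod (truncate m (f x)))\<^sup>2)"
    proof (rule Bochner_Integration.integrable_bound)
      show "integrable (interval_measure a) (\<lambda>_. m\<^sup>2)" by (rule continuous_integrable_interval) simp
      show "(\<lambda>x. (cmod (truncate m (f x)))\<^sup>2) \<in> borel_measurable (interval_measure a)"
      proof -
        note [measurable] = mt[OF m(1)]
        show ?thesis by measurable
      qed
      show "AE x in interval_measure a. norm ((cmod (truncate m (f x)))\<^sup>2) \<le> norm (m\<^sup>2)"
        using truncate_bounds(1)[OF m(1)] m(1) by (intro AE_I2) (simp add: power_mono)
    qed
    then show ?thesis using mt[OF m(1)] by (simp add: L2_def)
  qed
  have "(\<lambda>n. \<integral>x. (cmod (h n x - truncate m (f x)))\<^sup>2 \<partial>interval_measure a) \<longlonglongrightarrow> 0"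
  proof (rule L2_dominated_limit[OF mc[OF ch] mt[OF m(1)]])
    show "integrable (interval_measure a) (\<lambda>_. (2 * m)\<^sup>2)" by (rule continuous_integrable_interval) simp
    show "AE x in interval_measure a. (cmod (h n x - truncate m (f x)))\<^sup>2 \<le> (2 * m)\<^sup>2" for n
    proof (intro AE_I2 power_mono)
      fix x
      show "cmod (h n x - truncate m (f x)) \<le> 2 * m"
        using norm_triangle_ineq4[of "h n x" "truncate m (f x)"] hm[of n x] truncate_bounds(1)[OF m(1), of "f x"] by linarith
    qed simp
    have "\<forall>x\<in>{0..a} - (Z \<union> {0, a}). (\<lambda>n. h n x) \<longlonglongrightarrow> truncate m (f x)"
    proof
      fix x assume "x \<in> {0..a} - (Z \<union> {0, a})"
      then have x: "x \<in> {0<..<a}" "x \<notin> Z" by auto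
      have "continuous_on UNIV (truncate m)" by (rule truncate_bounds(4)[OF m(1)])
      then have "(\<lambda>n. truncate m (g n x)) \<longlonglongrightarrow> truncate m (f x)"
        using glim[OF x(2)] x(1) by (auto intro: continuous_on_tendsto_compose)
      moreover have "(\<lambda>n. complex_of_real (\<eta> n x)) \<longlonglongrightarrow> 1"
      proof (rule tendsto_eventually, rule eventually_sequentiallyI[of "nat \<lceil>2 / bump a x\<rceil>"])
        fix n assume "nat \<lceil>2 / bump a x\<rceil> \<le> n"
        then have n: "2 / bump a x \<le> real n" by linarith
        have "bump a x > 0" using x by (simp add: bump_def)
        then have "2 \<le> real n * bump a x" using n by (simp add: field_simps)
        then show "complex_of_real (\<eta> n x) = 1" by (simp add: \<eta>_def)
      qed
      ultimately have "(\<lambda>n. h n x) \<longlonglongrightarrow> 1 * truncate m (f x)" unfolding h_def by (intro tendsto_mult)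
      then show "(\<lambda>n. h n x) \<longlonglongrightarrow> truncate m (f x)" by simp
    qed
    then show "AE x in interval_measure a. (\<lambda>n. h n x) \<longlonglongrightarrow> truncate m (f x)"
      unfolding AE_interval_iff using Z by (intro exI[of _ "Z \<union> {0, a}"]) auto
  qed
  from order_tendstoD(2)[OF this, of "e / 4"] e
  obtain n0 where n0: "\<And>n. n \<ge> n0 \<Longrightarrow> (\<integral>x. (cmod (h n x - truncate m (f x)))\<^sup>2 \<partial>interval_measure a) < e / 4"
    by (auto simp: eventually_sequentially)
  define n where "n = Suc n0"
  have hL: "h n \<in> L2 a" by (rule continuous_L2[OF continuous_on_subset[OF ch]]) simp
  have "(\<integral>x. (cmod (h n x - f x))\<^sup>2 \<partial>interval_measure a) < e"
    using L2_square_triangle[OF hL tL f] m(2) n0[of n] by (simp add: n_def)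
  moreover have "h n x = 0" if "bump a x \<le> 1 / real n" for x
  proof -
    have "real n * bump a x \<le> 1" using that by (simp add: n_def field_simps)
    then show ?thesis by (simp add: h_def \<eta>_def)
  qed
  ultimately show ?thesis using that[OF ch, of "1 / real n" n] by (simp add: n_def)
qed

text \<open>Polynomials are uniformly dense by Stone-Weierstrass, and multiplication by \<open>bump\<^sup>3\<close> is bounded.\<close>

lemma bump_multiple_approximation:
  assumes a: "0 < a" and f: "f \<in> L2 a" and e: "e > 0"
  obtains q :: "real \<Rightarrow> complex" where "polynomial_function q"
    "(\<integral>x. (cmod (bump a x ^ 3 *\<^sub>R q x - f x))\<^sup>2 \<partial>interval_measure a) < e"
proof -
  obtain h d where h: "continuous_on UNIV h" "d > 0" "\<And>x. bump a x \<le> d \<Longrightarrow> h x = 0"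
    "(\<integral>x. (cmod (h x - f x))\<^sup>2 \<partial>interval_measure a) < e / 4"
    using continuous_approximation[OF a f, of "e / 4"] e by (metis divide_pos_pos zero_less_numeral)
  \<comment> \<open>dividing by \<open>bump\<^sup>3\<close> is harmless because \<open>h\<close> vanishes where \<open>bump\<close> is small\<close>
  define k where "k x = h x / of_real (max d (bump a x) ^ 3)" for x
  have ck: "continuous_on {0..a} k"
    unfolding k_def bump_def using h(2)
    by (intro continuous_intros continuous_on_subset[OF h(1)]) (auto simp: max_def)
  have hk: "h x = bump a x ^ 3 *\<^sub>R k x" for x
  proof (cases "bump a x \<le> d")
    case True then show ?thesis using h(3) by (simp add: k_def)
  next
    case False
    then show ?thesis using h(2) by (simp add: k_def scaleR_conv_of_real max_def)
  qed
  define B where "B = (a * a) ^ 3"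
  have B: "B > 0" using a by (simp add: B_def)
  have bB: "\<bar>bump a x ^ 3\<bar> \<le> B" if "x \<in> {0..a}" for x
  proof -
    have "0 \<le> bump a x" "bump a x \<le> a * a" unfolding bump_def using that a by (auto intro!: mult_mono)
    then show ?thesis unfolding B_def by (simp add: power_mono)
  qed
  define c where "c = sqrt (e / (8 * a)) / B"
  have c: "c > 0" using a e B by (simp add: c_def)
  obtain q where q: "polynomial_function q" "\<And>x. x \<in> {0..a} \<Longrightarrow> norm (k x - q x) < c"
    using Stone_Weierstrass_polynomial_function[OF compact_Icc ck c] by auto
  define p where "p x = bump a x ^ 3 *\<^sub>R q x" for x
  have cp: "continuous_on {0..a} p"
    unfolding p_def bump_def by (intro continuous_intros continuous_on_polymonial_function[OF q(1)])
  have pL: "p \<in> L2 a" and hL: "h \<in> L2 a"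
    using continuous_L2[OF cp] continuous_L2[OF continuous_on_subset[OF h(1)]] by auto
  have "(\<integral>x. (cmod (p x - h x))\<^sup>2 \<partial>interval_measure a) \<le> (\<integral>x. (B * c)\<^sup>2 \<partial>interval_measure a)"
  proof (rule integral_mono)
    show "integrable (interval_measure a) (\<lambda>x. (cmod (p x - h x))\<^sup>2)"
      using L2_lincomb[OF pL hL, of 1 "-1"] by (simp add: L2_def)
    show "integrable (interval_measure a) (\<lambda>x. (B * c)\<^sup>2)" by (rule continuous_integrable_interval) simp
    fix x assume "x \<in> space (interval_measure a)"
    then have x: "x \<in> {0..a}" by auto
    have "cmod (p x - h x) = \<bar>bump a x ^ 3\<bar> * norm (k x - q x)"
      unfolding hk p_def by (simp add: norm_minus_commute flip: scaleR_right_diff_distrib)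
    also have "\<dots> \<le> B * c" using bB[OF x] q(2)[OF x] B by (intro mult_mono) auto
    finally show "(cmod (p x - h x))\<^sup>2 \<le> (B * c)\<^sup>2" by (intro power_mono) auto
  qed
  also have "\<dots> = a * (B * c)\<^sup>2"
  proof -
    have "(\<integral>x. (B * c)\<^sup>2 \<partial>interval_measure a) = integral {0..a} (\<lambda>_. (B * c)\<^sup>2)"
      by (intro integral_interval continuous_integrable_interval) simp
    then show ?thesis using a by simp
  qed
  also have "\<dots> = e / 8" using a e B by (simp add: c_def)
  finally have "(\<integral>x. (cmod (p x - h x))\<^sup>2 \<partial>interval_measure a) \<le> e / 8" .
  then have "(\<integral>x. (cmod (p x - f x))\<^sup>2 \<partial>interval_measure a) < e"
    using L2_square_triangle[OF pL hL f] h(4) e by linarith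
  then show ?thesis using that[OF q(1)] by (simp add: p_def)
qed

lemma dom_A_dense:
  assumes L: "\<forall>i\<in>{1..N}. L i > 0" and N: "N \<ge> 1" and u: "u \<in> L2_net N L" and e: "e > 0"
  shows "\<exists>v\<in>dom_A N \<alpha> L. norm_net N L (net_lc 1 v (-1) u) < e"
proof -
  define d where "d = e\<^sup>2 / real (Suc N)"
  have d: "d > 0" using e by (simp add: d_def)
  have "\<exists>q. polynomial_function q \<and> (\<integral>x. (cmod (bump (L j) x ^ 3 *\<^sub>R q x - u j x))\<^sup>2 \<partial>interval_measure (L j)) < d"
    if j: "j \<in> {1..N}" for j
  proof -
    have "0 < L j" using L j by blast
    from bump_multiple_approximation[OF this L2_netD[OF u j] d] show ?thesis by blast
  qed
  then have "\<forall>j\<in>{1..N}. \<exists>q. polynomial_function q \<and> (\<integral>x. (cmod (bump (L j) x ^ 3 *\<^sub>R q x - u j x))\<^sup>2 \<partial>interval_measure (L j)) < d"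
    by blast
  from bchoice[OF this] obtain q where q: "\<And>j. j \<in> {1..N} \<Longrightarrow> polynomial_function (q j)"
    "\<And>j. j \<in> {1..N} \<Longrightarrow> (\<integral>x. (cmod (bump (L j) x ^ 3 *\<^sub>R q j x - u j x))\<^sup>2 \<partial>interval_measure (L j)) < d"
    by blast
  define v where "v j x = bump (L j) x ^ 3 *\<^sub>R q j x" for j x
  have v: "v j \<in> sobolev 3 (L j)" "k \<le> 2 \<Longrightarrow> x \<in> {0, L j} \<Longrightarrow> point_value (L j) ((weak_deriv (L j) ^^ k) (v j)) x = 0"
    if j: "j \<in> {1..N}" for j k x
    using bump_multiple_smooth[OF _ q(1)[OF j], of "L j"] L j by (auto simp: v_def[abs_def])
  have v0: "point_value (L j) (v j) x = 0" "point_value (L j) (weak_deriv (L j) (v j)) x = 0"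
    "point_value (L j) ((weak_deriv (L j) ^^ 2) (v j)) x = 0" if "j \<in> {1..N}" "x \<in> {0, L j}" for j x
    using v(2)[OF that(1), of 0 x] v(2)[OF that(1), of 1 x] v(2)[OF that(1), of 2 x] that(2) by auto
  have s2: "v j \<in> sobolev 2 (L j)" if j: "j \<in> {1..N}" for j
  proof -
    have down: "f \<in> sobolev m a" if "f \<in> sobolev (Suc m) a" for f m a
      using that by (induction m arbitrary: f) auto
    show ?thesis using down[of "v j" 2 "L j"] v(1)[OF j] by (simp add: numeral_3_eq_3 numeral_2_eq_2)
  qed
  have "(\<Sum>j=1..N. point_value (L j) ((weak_deriv (L j) ^^ 2) (v j)) 0) = - of_real \<alpha> * point_value (L 1) (v 1) 0"
    using v0(1)[of 1 0] v0(3) N by (simp add: sum.neutral)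
  then have "v \<in> dom_A N \<alpha> L"
    unfolding dom_A_def H2e_net_def using v0 v(1) s2 by simp
  moreover have "norm_net N L (net_lc 1 v (-1) u) < e"
  proof -
    have "(\<Sum>j = 1..N. \<integral>x. (cmod (net_lc 1 v (-1) u j x))\<^sup>2 \<partial>interval_measure (L j)) \<le> (\<Sum>j = 1..N. d)"
      using q(2) by (intro sum_mono less_imp_le) (simp add: net_lc_def v_def)
    also have "\<dots> = e\<^sup>2 * (real N / real (Suc N))" by (simp add: d_def)
    also have "\<dots> < e\<^sup>2" using e by (simp add: field_simps)
    finally have "norm_net N L (net_lc 1 v (-1) u) < sqrt (e\<^sup>2)"
      unfolding norm_net_def by (rule real_sqrt_less_mono)
    then show ?thesis using e by simp
  qed
  ultimately show ?thesis by blast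
qed

section \<open>Smoothing and compactness\<close>

definition slope_energy :: "nat \<Rightarrow> (nat \<Rightarrow> real) \<Rightarrow> netfun \<Rightarrow> real" where
  "slope_energy N L u = (\<Sum>j=1..N. integral {0..L j} (\<lambda>x. (cmod (jet (L j) (u j) 1 x))\<^sup>2))"

text \<open>The estimate \<open>\<bar>u'\<bar> \<le> s \<bar>u'\<bar>\<^sup>2 / 2 + 1 / (2 s)\<close>, integrated; optimizing over \<open>s\<close> would give Hoelder
continuity of order one half, but a free parameter is just as good for equicontinuity.\<close>

lemma jet_increment:
  assumes a: "0 < a" and u: "u \<in> sobolev 3 a" and xy: "0 \<le> x" "x \<le> y" "y \<le> a" and s: "s > 0"
  shows "cmod (jet a u 0 y - jet a u 0 x) \<le> s * integral {0..a} (\<lambda>x. (cmod (jet a u 1 x))\<^sup>2) / 2 + (y - x) / (2 * s)"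
proof -
  define U1 where "U1 = jet a u 1"
  have c: "continuous_on {0..a} U1" unfolding U1_def by (rule jet_primitive(4)[OF a u]) simp
  have cxy: "continuous_on {x..y} U1" by (rule continuous_on_subset[OF c]) (use xy in auto)
  have i: "(\<lambda>t. (cmod (U1 t))\<^sup>2) integrable_on {p..q}" if "0 \<le> p" "q \<le> a" for p q
    by (intro integrable_continuous_real continuous_intros continuous_on_subset[OF c]) (use that in auto)
  have "(U1 has_integral jet a u 0 y - jet a u 0 x) {x..y}"
  proof (rule fundamental_theorem_of_calculus)
    fix t assume t: "t \<in> {x..y}"
    have "(jet a u 0 has_vector_derivative U1 t) (at t within {0..a})"
      using jet_primitive(7)[OF a u, of 0 t] t xy by (simp add: U1_def)
    then show "(jet a u 0 has_vector_derivative U1 t) (at t within {x..y})"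
      by (rule has_vector_derivative_within_subset) (use xy in auto)
  qed (use xy in simp)
  then have "cmod (jet a u 0 y - jet a u 0 x) = cmod (integral {x..y} U1)" by (simp add: integral_unique)
  also have "\<dots> \<le> integral {x..y} (\<lambda>t. s / 2 * (cmod (U1 t))\<^sup>2 + 1 / (2 * s))"
  proof (rule integral_norm_bound_integral)
    show "U1 integrable_on {x..y}" by (rule integrable_continuous_real[OF cxy])
    show "(\<lambda>t. s / 2 * (cmod (U1 t))\<^sup>2 + 1 / (2 * s)) integrable_on {x..y}"
      by (intro integrable_continuous_real continuous_intros cxy)
    fix t
    have "0 \<le> (s * cmod (U1 t) - 1)\<^sup>2" by simp
    then have "2 * s * cmod (U1 t) \<le> s * s * (cmod (U1 t))\<^sup>2 + 1" by (simp add: power2_eq_square algebra_simps)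
    also have "\<dots> = 2 * s * (s / 2 * (cmod (U1 t))\<^sup>2 + 1 / (2 * s))" using s by (simp add: field_simps)
    finally have "2 * s * cmod (U1 t) \<le> 2 * s * (s / 2 * (cmod (U1 t))\<^sup>2 + 1 / (2 * s))" .
    then show "cmod (U1 t) \<le> s / 2 * (cmod (U1 t))\<^sup>2 + 1 / (2 * s)" using s by simp
  qed
  also have "\<dots> = s / 2 * integral {x..y} (\<lambda>t. (cmod (U1 t))\<^sup>2) + (y - x) / (2 * s)"
    using i[of x y] xy by (subst Henstock_Kurzweil_Integration.integral_add) (auto intro: integrable_on_mult_right)
  also have "integral {x..y} (\<lambda>t. (cmod (U1 t))\<^sup>2) \<le> integral {0..a} (\<lambda>t. (cmod (U1 t))\<^sup>2)"
    using xy i[of x y] i[of 0 a] by (intro integral_subset_le) auto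
  finally show ?thesis using s by (simp add: U1_def mult_left_mono)
qed

text \<open>The theorem of Arzela and Ascoli for all edges at once: the edges are laid out disjointly in the plane as the compact set
\<open>T\<close>. Boundedness comes from the zero at the outer end of each edge.\<close>

lemma slope_energy_compact:
  assumes L: "\<forall>i\<in>{1..N}. L i > 0" and N: "N \<ge> 1"
    and f: "\<And>n. f n \<in> dom_A N \<alpha> L" "\<And>n. slope_energy N L (f n) \<le> M"
  obtains r y where "strict_mono (r :: nat \<Rightarrow> nat)" "y \<in> L2_net N L"
    "(\<lambda>n. norm_net N L (net_lc 1 (f (r n)) (-1) y)) \<longlonglongrightarrow> 0"
proof -
  note D = dom_A_D[OF L N f(1)]
  define U where "U n j = jet (L j) (f n j) 0" for n j
  define E where "E n j = integral {0..L j} (\<lambda>x. (cmod (jet (L j) (f n j) 1 x))\<^sup>2)" for n j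
  have E0: "0 \<le> E n j" if j: "j \<in> {1..N}" for n j
  proof -
    have "continuous_on {0..L j} (jet (L j) (f n j) 1)"
      by (rule jet_primitive(4)) (use L j D(1)[OF j] in auto)
    then show ?thesis
      unfolding E_def by (intro Henstock_Kurzweil_Integration.integral_nonneg integrable_continuous_real continuous_intros) auto
  qed
  have EM: "E n j \<le> M" if j: "j \<in> {1..N}" for n j
  proof -
    have "E n j \<le> (\<Sum>j=1..N. E n j)" using E0 j by (intro member_le_sum) auto
    then show ?thesis using f(2)[of n] by (simp add: slope_energy_def E_def)
  qed
  have M0: "0 \<le> M" using EM[of 1 0] E0[of 1 0] N by simp
  have inc: "cmod (U n j x - U n j y) \<le> s * M / 2 + \<bar>x - y\<bar> / (2 * s)"
    if j: "j \<in> {1..N}" and xy: "x \<in> {0..L j}" "y \<in> {0..L j}" and s: "s > 0" for n j x y s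
  proof -
    have *: "cmod (U n j y - U n j x) \<le> s * M / 2 + \<bar>x - y\<bar> / (2 * s)" if "x \<in> {0..L j}" "y \<in> {0..L j}" "x \<le> y" for x y
    proof -
      have "0 < L j" using L j by blast
      from jet_increment[OF this D(1)[OF j, of n], of x y s] that s
      have "cmod (U n j y - U n j x) \<le> s * E n j / 2 + (y - x) / (2 * s)" by (simp add: U_def E_def)
      moreover have "s * E n j / 2 \<le> s * M / 2" using EM[OF j, of n] s by simp
      ultimately show ?thesis using that(3) by simp
    qed
    show ?thesis
    proof (cases "x \<le> y")
      case True then show ?thesis using *[OF xy True] by (simp add: norm_minus_commute)
    next
      case False then show ?thesis using *[OF xy(2,1)] by (simp add: abs_minus_commute)
    qed
  qed
  define T where "T = (\<Union>j\<in>{1..N}. {real j} \<times> {0..L j})"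
  define F where "F n p = U n (nat \<lfloor>fst p\<rfloor>) (snd p)" for n and p :: "real \<times> real"
  have cT: "compact T" unfolding T_def by (intro compact_UN compact_Times) auto
  define B where "B = M / 2 + (\<Sum>j=1..N. L j) / 2"
  have bound: "norm (F n p) \<le> B" if pT: "p \<in> T" for n p
  proof -
    obtain j x where p: "p = (real j, x)" and j: "j \<in> {1..N}" and x: "x \<in> {0..L j}"
      using pT by (auto simp: T_def)
    have Lj: "0 < L j" using L j by blast
    have "U n j (L j) = 0" using D(2)[OF j, of n] by (simp add: U_def)
    then have "cmod (U n j x) \<le> 1 * M / 2 + \<bar>x - L j\<bar> / (2 * 1)"
      using inc[OF j x, of "L j" 1 n] Lj by simp
    also have "\<bar>x - L j\<bar> \<le> L j" using x by auto
    also have "L j \<le> (\<Sum>j=1..N. L j)" using L j by (intro member_le_sum) (auto intro: less_imp_le)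
    finally show ?thesis by (simp add: F_def p B_def divide_right_mono)
  qed
  have equi: "\<exists>d. 0 < d \<and> (\<forall>n q. q \<in> T \<and> norm (p - q) < d \<longrightarrow> norm (F n p - F n q) < e)" if p: "p \<in> T" and e: "0 < e" for p e
  proof -
    \<comment> \<open>each of the two terms of the increment estimate is then at most \<open>e / 2\<close>\<close>
    define s where "s = e / (M + 1)"
    have s: "s > 0" using e M0 by (simp add: s_def)
    define d where "d = min (1 / 2) (e * s)"
    have d: "0 < d" using e s by (simp add: d_def)
    have "norm (F n p - F n q) < e" if q: "q \<in> T" "norm (p - q) < d" for n q
    proof -
      obtain j x where pj: "p = (real j, x)" and j: "j \<in> {1..N}" and x: "x \<in> {0..L j}"
        using p by (auto simp: T_def)
      obtain i y where qi: "q = (real i, y)" and i: "i \<in> {1..N}" and y: "y \<in> {0..L i}"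
        using q by (auto simp: T_def)
      have "\<bar>real j - real i\<bar> < d" "\<bar>x - y\<bar> < d"
        using norm_fst_le[of "real j - real i" "x - y"] norm_snd_le[of "x - y" "real j - real i"] q(2)
        unfolding pj qi by auto
      then have "\<bar>real j - real i\<bar> < 1" "\<bar>x - y\<bar> < e * s" by (auto simp: d_def)
      then have ij: "i = j" "\<bar>x - y\<bar> < e * s" by auto
      have "cmod (U n j x - U n j y) \<le> s * M / 2 + \<bar>x - y\<bar> / (2 * s)"
        using inc[OF j x, of y s n] y s ij by simp
      also have "\<dots> < e / 2 + e / 2"
      proof (rule add_le_less_mono)
        have "s * M \<le> e" using e M0 by (simp add: s_def field_simps)
        then show "s * M / 2 \<le> e / 2" by simp
        show "\<bar>x - y\<bar> / (2 * s) < e / 2" using ij s by (simp add: field_simps)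
      qed
      finally show ?thesis by (simp add: F_def pj qi ij)
    qed
    then show ?thesis using d by blast
  qed
  obtain G r where G: "continuous_on T G" and r: "strict_mono (r :: nat \<Rightarrow> nat)"
    and unif: "\<And>e. 0 < e \<Longrightarrow> \<exists>m. \<forall>n p. n \<ge> m \<and> p \<in> T \<longrightarrow> norm (F (r n) p - G p) < e"
    using Arzela_Ascoli[OF cT bound equi] by blast
  define y where "y j x = G (real j, x)" for j x
  have cy: "continuous_on {0..L j} (y j)" if j: "j \<in> {1..N}" for j
    unfolding y_def by (rule continuous_on_compose2[OF G]) (use j in \<open>auto simp: T_def intro!: continuous_intros\<close>)
  have yL: "y \<in> L2_net N L" unfolding L2_net_def using continuous_L2[OF cy] by simp
  have "(\<lambda>n. norm_net N L (net_lc 1 (f (r n)) (-1) y)) \<longlonglongrightarrow> 0"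
  proof (rule LIMSEQ_I)
    fix e :: real assume e: "0 < e"
    define Q where "Q = (\<Sum>j=1..N. L j) + 1"
    have Q: "Q > 0" unfolding Q_def using L by (intro add_nonneg_pos sum_nonneg) (auto intro: less_imp_le)
    define d where "d = e / sqrt Q"
    have d: "d > 0" using e Q by (simp add: d_def)
    obtain m where m: "\<And>n p. n \<ge> m \<Longrightarrow> p \<in> T \<Longrightarrow> norm (F (r n) p - G p) < d"
      using unif[OF d] by blast
    have "norm (norm_net N L (net_lc 1 (f (r n)) (-1) y) - 0) < e" if n: "n \<ge> m" for n
    proof -
      have "(\<integral>x. (cmod (net_lc 1 (f (r n)) (-1) y j x))\<^sup>2 \<partial>interval_measure (L j)) \<le> L j * d\<^sup>2" if j: "j \<in> {1..N}" for j
      proof -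
        have Lj: "0 < L j" using L j by blast
        have lL: "net_lc 1 (f (r n)) (-1) y j \<in> L2 (L j)"
          using L2_netD[OF net_lc_mem[OF D(6) yL] j] .
        have ae: "AE x in interval_measure (L j). f (r n) j x = U (r n) j x"
          using jet_primitive(5)[OF Lj D(1)[OF j, of "r n"], of 0] by (simp add: U_def)
        have sp: "AE x in interval_measure (L j). x \<in> {0..L j}" by (auto simp: AE_restrict_space_iff)
        have "(\<integral>x. (cmod (net_lc 1 (f (r n)) (-1) y j x))\<^sup>2 \<partial>interval_measure (L j)) \<le> (\<integral>x. d\<^sup>2 \<partial>interval_measure (L j))"
        proof (rule integral_mono_AE)
          show "integrable (interval_measure (L j)) (\<lambda>x. (cmod (net_lc 1 (f (r n)) (-1) y j x))\<^sup>2)"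
            using lL by (simp add: L2_def)
          show "integrable (interval_measure (L j)) (\<lambda>x. d\<^sup>2)" by (rule continuous_integrable_interval) simp
          show "AE x in interval_measure (L j). (cmod (net_lc 1 (f (r n)) (-1) y j x))\<^sup>2 \<le> d\<^sup>2"
            using ae sp
          proof eventually_elim
            case (elim x)
            have "norm (F (r n) (real j, x) - G (real j, x)) < d"
              using elim(2) j by (intro m n) (auto simp: T_def)
            then show ?case using elim(1) by (intro power_mono) (auto simp: net_lc_def F_def y_def)
          qed
        qed
        also have "(\<integral>x. d\<^sup>2 \<partial>interval_measure (L j)) = integral {0..L j} (\<lambda>_. d\<^sup>2)"
          by (intro integral_interval continuous_integrable_interval) simp
        finally show ?thesis using Lj by simp
      qed
      then have "(\<Sum>j=1..N. \<integral>x. (cmod (net_lc 1 (f (r n)) (-1) y j x))\<^sup>2 \<partial>interval_measure (L j)) \<le> (\<Sum>j=1..N. L j * d\<^sup>2)"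
        by (intro sum_mono) auto
      also have "\<dots> < Q * d\<^sup>2" using d by (simp add: Q_def sum_distrib_right[symmetric])
      also have "\<dots> = e\<^sup>2" using Q by (simp add: d_def power_divide)
      finally have "norm_net N L (net_lc 1 (f (r n)) (-1) y) < sqrt (e\<^sup>2)"
        unfolding norm_net_def by (rule real_sqrt_less_mono)
      moreover have "0 \<le> norm_net N L (net_lc 1 (f (r n)) (-1) y)"
        unfolding norm_net_def by (intro real_sqrt_ge_zero sum_nonneg) auto
      ultimately show ?thesis using e by simp
    qed
    then show "\<exists>m. \<forall>n\<ge>m. norm (norm_net N L (net_lc 1 (f (r n)) (-1) y) - 0) < e" by blast
  qed
  then show ?thesis using that r yL by blast
qed

lemma exp_A_generator:
  assumes L: "\<forall>i\<in>{1..N}. L i > 0" and N: "N \<ge> 1" and S: "is_exp_A N \<alpha> L S" and u: "u \<in> dom_A N \<alpha> L" and t: "0 \<le> t"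
  shows "S t u \<in> dom_A N \<alpha> L"
    and "contraction_semigroup.gen (L2_net N L) net_lc (net_ip N L) S (S t u) (op_A L (S t u))"
proof -
  have S0: "C0_contraction_semigroup N L S"
    and iff: "\<And>u v. u \<in> L2_net N L \<Longrightarrow> v \<in> L2_net N L \<Longrightarrow>
      infinitesimal_generator N L S u v \<longleftrightarrow> u \<in> dom_A N \<alpha> L \<and> eq_net N L v (op_A L u)"
    using S unfolding is_exp_A_def by blast+
  interpret contraction_semigroup "L2_net N L" net_lc "net_ip N L" S
    by (rule exp_A_contraction_semigroup[OF S0])
  have g: "gen u (op_A L u)" if "u \<in> dom_A N \<alpha> L" for u
    using iff[OF dom_A_D(6,7)[OF L N that]] that
    by (simp add: infinitesimal_generator_gen[OF S0] eq_net_def)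
  have gS: "gen (S t u) (S t (op_A L u))" by (rule gen_S[OF g[OF u] t])
  then show dom: "S t u \<in> dom_A N \<alpha> L"
    using iff[of "S t u" "S t (op_A L u)"] unfolding infinitesimal_generator_gen[OF S0] by (simp add: gen_def)
  show "gen (S t u) (op_A L (S t u))" by (rule g[OF dom])
qed

text \<open>The Kato smoothing effect in pointwise form. Weighting the energy with \<open>\<kappa> + x\<close> for large
  \<open>\<kappa>\<close> makes all boundary terms favourable, and the weighted energy decreases at rate three times
  the squared norm of the first derivative, up to the energy itself. It is nonnegative, so the first
  derivative cannot be large during the whole unit time interval.\<close>

lemma smoothing:
  assumes L: "\<forall>i\<in>{1..N}. L i > 0" and N: "N \<ge> 1" and \<alpha>: "\<alpha> > real N / 2" and S: "is_exp_A N \<alpha> L S"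
  obtains M where "\<And>u. u \<in> dom_A N \<alpha> L \<Longrightarrow> norm_net N L u \<le> 2 \<Longrightarrow>
    \<exists>t\<in>{0..1}. S t u \<in> dom_A N \<alpha> L \<and> slope_energy N L (S t u) \<le> M"
proof -
  have S0: "C0_contraction_semigroup N L S" using S unfolding is_exp_A_def by blast
  define \<delta> where "\<delta> = 2 * \<alpha> - real N"
  have \<delta>: "\<delta> > 0" using \<alpha> by (simp add: \<delta>_def)
  \<comment> \<open>large enough to absorb the cross terms of \<open>u\<^sub>j'(0)\<close> and \<open>u(0)\<close>\<close>
  define \<kappa> where "\<kappa> = 1 + real N / \<delta>"
  have \<kappa>: "\<kappa> \<ge> 1" "\<kappa> * \<delta> \<ge> real N" using \<delta> by (auto simp: \<kappa>_def field_simps)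
  define R where "R = \<kappa> + (\<Sum>j=1..N. L j)"
  have Lsum: "0 \<le> (\<Sum>j=1..N. L j)" using L by (intro sum_nonneg) (auto intro: less_imp_le)
  have LR: "\<kappa> + x \<le> R" if "j \<in> {1..N}" "x \<le> L j" for j x
  proof -
    have "L j \<le> (\<Sum>j=1..N. L j)" using L that by (intro member_le_sum) (auto intro: less_imp_le)
    then show ?thesis using that by (simp add: R_def)
  qed
  have R0: "0 \<le> R" using \<kappa> Lsum by (simp add: R_def)
  define \<rho> where "\<rho> x = \<kappa> + 1 * x" for x :: real
  have c\<rho>: "continuous_on UNIV \<rho>" unfolding \<rho>_def by (intro continuous_intros)
  interpret contraction_semigroup "L2_net N L" net_lc "net_ip N L" S
    by (rule exp_A_contraction_semigroup[OF S0])
  interpret B: semi_inner_space "L2_net N L" net_lc "weighted_ip N L \<rho>"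
    by (rule weighted_ip_space[OF c\<rho>]) (use \<kappa> in \<open>auto simp: \<rho>_def\<close>)
  have wle: "Re (weighted_ip N L \<rho> u u) \<le> R * (nm u)\<^sup>2" if "u \<in> L2_net N L" for u
    using weighted_ip_le[OF c\<rho> _ that, of R] LR nm_power2[OF that] by (simp add: \<rho>_def)
  interpret bounded_form "L2_net N L" net_lc "net_ip N L" S "weighted_ip N L \<rho>" "sqrt R"
  proof
    show "0 \<le> sqrt R" using R0 by simp
    show "B.nm u \<le> sqrt R * nm u" if "u \<in> L2_net N L" for u
      using real_sqrt_le_mono[OF wle[OF that]] that by (simp add: B.nm_def real_sqrt_mult)
  qed
  \<comment> \<open>the weighted energy is at most \<open>4 R\<close> initially and would decrease by \<open>3 M - 4 > 4 R\<close>\<close>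
  define M where "M = (4 * R + 5) / 3"
  have "\<exists>t\<in>{0..1}. S t u \<in> dom_A N \<alpha> L \<and> slope_energy N L (S t u) \<le> M"
    if u: "u \<in> dom_A N \<alpha> L" and nu: "norm_net N L u \<le> 2" for u
  proof (rule ccontr)
    assume neg: "\<not> ?thesis"
    note E = exp_A_generator[OF L N S u]
    have uX: "u \<in> L2_net N L" by (rule dom_A_D(6)[OF L N u])
    have nu2: "nm u \<le> 2" using nu uX by (simp add: norm_net_nm)
    define G where "G t = Re (weighted_ip N L \<rho> (S t u) (S t u))" for t
    have cG: "continuous_on {0..1} G"
      unfolding G_def by (rule continuous_on_subset[OF form_continuous[OF uX]]) auto
    have "G 1 \<le> G 0 - (3 * M - 4)"
    proof (rule right_derivative_decrease[OF cG])
      fix t :: real assume t: "0 \<le> t" "t < 1"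
      define v where "v = S t u"
      have vD: "v \<in> dom_A N \<alpha> L" using E(1)[OF t(1)] by (simp add: v_def)
      have big: "slope_energy N L v > M" using neg t vD by (force simp: v_def)
      define c where "c = jet (L 1) (v 1) 0 0"
      define W where "W j = jet (L j) (v j) 1 0" for j
      have cross: "- 2 * (\<Sum>j=1..N. Re (W j * cnj c)) \<le> (\<Sum>j=1..N. (cmod (W j))\<^sup>2) + real N * (cmod c)\<^sup>2"
      proof -
        have "- 2 * Re (W j * cnj c) \<le> (cmod (W j))\<^sup>2 + (cmod c)\<^sup>2" for j
        proof -
          have "- Re (W j * cnj c) \<le> cmod (W j) * cmod c"
            using abs_Re_le_cmod[of "W j * cnj c"] by (simp add: norm_mult)
          then show ?thesis using sum_squares_bound[of "cmod (W j)" "cmod c"] by simp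
        qed
        then have "(\<Sum>j=1..N. - 2 * Re (W j * cnj c)) \<le> (\<Sum>j=1..N. (cmod (W j))\<^sup>2 + (cmod c)\<^sup>2)"
          by (intro sum_mono) auto
        then show ?thesis by (simp only: sum.distrib sum_constant card_atLeastAtMost sum_distrib_left[symmetric]) simp
      qed
      have b1: "real N * (cmod c)\<^sup>2 \<le> \<kappa> * \<delta> * (cmod c)\<^sup>2" using \<kappa> by (intro mult_right_mono) auto
      have b2: "(\<Sum>j=1..N. (cmod (W j))\<^sup>2) \<le> \<kappa> * (\<Sum>j=1..N. (cmod (W j))\<^sup>2)"
        using mult_right_mono[OF \<kappa>(1), of "\<Sum>j=1..N. (cmod (W j))\<^sup>2"] by (simp add: sum_nonneg)
      have nv: "(norm_net N L v)\<^sup>2 \<le> 4"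
      proof -
        have "norm_net N L v = nm v" "0 \<le> nm v" using dom_A_D(6)[OF L N vD] by (auto simp: norm_net_nm)
        moreover have "nm v \<le> 2" using S_contraction[OF t(1) uX] nu2 by (simp add: v_def)
        ultimately show ?thesis using power_mono[of "nm v" 2 2] by simp
      qed
      have "2 * Re (weighted_ip N L \<rho> (op_A L v) v)
        = \<kappa> * (- \<delta> * (cmod c)\<^sup>2 - (\<Sum>j=1..N. (cmod (W j))\<^sup>2)) - 2 * (\<Sum>j=1..N. Re (W j * cnj c))
          + (norm_net N L v)\<^sup>2 - 3 * slope_energy N L v"
        using network_energy[OF L N vD, of \<kappa> 1]
        unfolding \<rho>_def c_def W_def \<delta>_def slope_energy_def by (simp only: mult_1_left mult_1_right)
      also have "\<dots> = - (\<kappa> * \<delta> * (cmod c)\<^sup>2) - \<kappa> * (\<Sum>j=1..N. (cmod (W j))\<^sup>2) - 2 * (\<Sum>j=1..N. Re (W j * cnj c))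
          + (norm_net N L v)\<^sup>2 - 3 * slope_energy N L v"
        by (simp add: algebra_simps)
      also have "\<dots> \<le> - (3 * M - 4)" using cross b1 b2 nv big by linarith
      finally have le: "2 * Re (weighted_ip N L \<rho> (op_A L v) v) \<le> - (3 * M - 4)" .
      have "((\<lambda>h. (G (t + h) - G t) / h) \<longlongrightarrow> 2 * Re (weighted_ip N L \<rho> (op_A L v) v)) (at_right 0)"
        unfolding G_def v_def by (rule form_right_derivative[OF uX E(2)[OF t(1)] t(1)])
      then show "\<exists>d\<le>- (3 * M - 4). ((\<lambda>h. (G (t + h) - G t) / h) \<longlongrightarrow> d) (at_right 0)" using le by blast
    qed
    moreover have "G 0 \<le> 4 * R"
    proof -
      have "G 0 \<le> R * (nm (S 0 u))\<^sup>2" unfolding G_def using uX by (intro wle) auto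
      also have "\<dots> \<le> R * 2\<^sup>2"
        using S_contraction[of 0 u] uX nu2 R0 by (intro mult_left_mono power_mono) auto
      finally show ?thesis by simp
    qed
    moreover have "0 \<le> G 1" unfolding G_def using uX by (intro B.ip_self_nonneg) auto
    moreover have "3 * M = 4 * R + 5" by (simp add: M_def)
    ultimately show False by linarith
  qed
  then show ?thesis using that by blast
qed

section \<open>Exponential stability\<close>

text \<open>An eigenvector of the generator for an imaginary eigenvalue dissipates no energy, so all
  components satisfy the overdetermined stationary problem. On the edges of noncritical length the
  component vanishes; the Kirchhoff-type condition at the centre then annihilates the second
  derivative of the only component that is left.\<close>

lemma no_imaginary_eigenvector:
  assumes N: "N \<ge> 1" and \<alpha>: "\<alpha> > real N / 2" and L: "\<forall>i\<in>{1..N}. L i > 0"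
    and crit: "card {i \<in> {1..N}. L i \<in> critical_lengths} \<le> 1"
    and y: "y \<in> dom_A N \<alpha> L" and eig: "eq_net N L (\<lambda>j x. l * y j x) (op_A L y)" and Rel: "Re l = 0"
  shows "norm_net N L y = 0"
proof -
  note D = dom_A_D[OF L N y]
  interpret semi_inner_space "L2_net N L" net_lc "net_ip N L" by (rule net_ip_space)
  define c where "c = jet (L 1) (y 1) 0 0"
  define W where "W j = jet (L j) (y j) 1 0" for j
  have ly: "(\<lambda>j x. l * y j x) = net_lc l y 0 y" by (simp add: net_lc_def)
  have "net_ip N L (op_A L y) y = net_ip N L (\<lambda>j x. l * y j x) y"
    by (rule eq_net_ip[OF eig _ D(7) D(6), symmetric]) (simp only: ly net_lc_mem[OF D(6) D(6)])
  also have "\<dots> = l * net_ip N L y y" unfolding ly using D(6) by simp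
  finally have "Re (net_ip N L (op_A L y) y) = 0"
    using Rel D(6) by simp
  then have bal: "(2 * \<alpha> - real N) * (cmod c)\<^sup>2 + (\<Sum>j=1..N. (cmod (W j))\<^sup>2) = 0"
    using network_energy[OF L N y, of 1 0] by (simp add: c_def W_def algebra_simps)
  have nn: "0 \<le> (2 * \<alpha> - real N) * (cmod c)\<^sup>2" "0 \<le> (\<Sum>j=1..N. (cmod (W j))\<^sup>2)"
    using \<alpha> by (auto intro: sum_nonneg)
  have "(2 * \<alpha> - real N) * (cmod c)\<^sup>2 = 0" "(\<Sum>j=1..N. (cmod (W j))\<^sup>2) = 0"
    using bal nn by linarith+
  then have c0: "c = 0" and W0: "W j = 0" if "j \<in> {1..N}" for j
    using \<alpha> that by (auto simp: sum_nonneg_eq_0_iff)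
  have edge: "stationary_edge (L j) l (jet (L j) (y j) 0) (jet (L j) (y j) 1) (jet (L j) (y j) 2)"
    if j: "j \<in> {1..N}" for j
  proof -
    have Lj: "0 < L j" using L j by blast
    note J = jet_primitive[OF Lj D(1)[OF j]]
    have c12: "continuous_on {0..L j} (jet (L j) (y j) 0)" "continuous_on {0..L j} (jet (L j) (y j) 1)"
      by (rule J(4); simp)+
    define g where "g x = - jet (L j) (y j) 1 x - l * jet (L j) (y j) 0 x" for x
    have cg: "continuous_on {0..L j} g" unfolding g_def by (intro continuous_intros c12)
    have "AE x in interval_measure (L j). l * y j x = - weak_deriv (L j) (y j) x - (weak_deriv (L j) ^^ 3) (y j) x"
      using eig j by (simp add: eq_net_def op_A_def)
    moreover have "AE x in interval_measure (L j). y j x = jet (L j) (y j) 0 x"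
      using J(5)[of 0] by simp
    moreover have "AE x in interval_measure (L j). weak_deriv (L j) (y j) x = jet (L j) (y j) 1 x"
      using J(5)[of 1] by simp
    ultimately have ae: "AE x in interval_measure (L j). (weak_deriv (L j) ^^ 3) (y j) x = g x"
      by eventually_elim (simp add: g_def algebra_simps)
    have p: "jet (L j) (y j) 2 x = jet (L j) (y j) 2 0 + integral {0..x} g" if x: "x \<in> {0..L j}" for x
    proof -
      have "integral {0..x} ((weak_deriv (L j) ^^ 3) (y j)) = integral {0..x} g"
        by (rule integral_cong_AE_interval[OF ae]) (use x in auto)
      then show ?thesis using J(6)[of 2 x] x by (simp add: numeral_3_eq_3 numeral_2_eq_2)
    qed
    show ?thesis
    proof
      show "0 < L j" by (rule Lj)
      show "(jet (L j) (y j) 0 has_vector_derivative jet (L j) (y j) 1 x) (at x within {0..L j})" if "x \<in> {0..L j}" for x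
        using J(7)[of 0 x] that by simp
      show "(jet (L j) (y j) 1 has_vector_derivative jet (L j) (y j) 2 x) (at x within {0..L j})" if "x \<in> {0..L j}" for x
        using J(7)[of 1 x] that by (simp add: numeral_2_eq_2)
      show "(jet (L j) (y j) 2 has_vector_derivative - jet (L j) (y j) 1 x - l * jet (L j) (y j) 0 x) (at x within {0..L j})"
        if x: "x \<in> {0..L j}" for x
      proof (rule has_vector_derivative_transform[OF x p])
        show "((\<lambda>x. jet (L j) (y j) 2 0 + integral {0..x} g) has_vector_derivative - jet (L j) (y j) 1 x - l * jet (L j) (y j) 0 x) (at x within {0..L j})"
          using has_vector_derivative_add[OF has_vector_derivative_const integral_has_vector_derivative[OF cg x]]
          by (simp add: g_def)
      qed
      show "jet (L j) (y j) 0 0 = 0" using D(4)[OF j] c0[OF j] by (simp add: c_def)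
      show "jet (L j) (y j) 1 0 = 0" using W0[OF j] by (simp add: W_def)
    qed
  qed
  have nc: "jet (L j) (y j) 2 0 = 0" if j: "j \<in> {1..N}" "L j \<notin> critical_lengths" for j
    by (rule stationary_edge.noncritical_trace_zero[OF edge[OF j(1)] D(2)[OF j(1)] D(3)[OF j(1)] j(2)])
  have all: "jet (L j) (y j) 2 0 = 0" if j: "j \<in> {1..N}" for j
  proof (cases "L j \<in> critical_lengths")
    case True
    have "jet (L i) (y i) 2 0 = 0" if i: "i \<in> {1..N} - {j}" for i
    proof (rule nc)
      show "i \<in> {1..N}" using i by simp
      show "L i \<notin> critical_lengths"
      proof
        assume "L i \<in> critical_lengths"
        then have "{i, j} \<subseteq> {i \<in> {1..N}. L i \<in> critical_lengths}" using i j True by auto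
        then have "card {i, j} \<le> card {i \<in> {1..N}. L i \<in> critical_lengths}" by (intro card_mono) auto
        then show False using crit i by simp
      qed
    qed
    then have "(\<Sum>i=1..N. jet (L i) (y i) 2 0) = jet (L j) (y j) 2 0"
      using j by (subst sum.remove[of _ j]) (auto intro: sum.neutral)
    then show ?thesis using D(5) c0[OF j] by (simp add: c_def)
  qed (use nc j in blast)
  have z: "(\<integral>x. (cmod (y j x))\<^sup>2 \<partial>interval_measure (L j)) = 0" if j: "j \<in> {1..N}" for j
  proof -
    have Lj: "0 < L j" using L j by blast
    have "AE x in interval_measure (L j). y j x = jet (L j) (y j) 0 x"
      using jet_primitive(5)[OF Lj D(1)[OF j], of 0] by simp
    moreover have "AE x in interval_measure (L j). x \<in> {0..L j}" by (auto simp: AE_restrict_space_iff)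
    ultimately have "AE x in interval_measure (L j). (cmod (y j x))\<^sup>2 = 0"
      by eventually_elim (simp add: stationary_edge.zero_of_zero_trace[OF edge[OF j] all[OF j]])
    then show ?thesis by (rule integral_eq_zero_AE)
  qed
  then show ?thesis by (simp add: norm_net_def)
qed

theorem theorem3p4:
  fixes N :: nat and \<alpha> :: real and L :: "nat \<Rightarrow> real"
    and S :: "real \<Rightarrow> netfun \<Rightarrow> netfun"
  assumes "N \<ge> 1"
    and "\<alpha> > real N / 2"
    and "\<forall>i\<in>{1..N}. L i > 0"
    and "card {i \<in> {1..N}. L i \<in> critical_lengths} \<le> 1"
    and "is_exp_A N \<alpha> L S"
  shows "\<exists>C>0. \<exists>\<mu>>0. \<forall>u0\<in>L2_net N L. \<forall>t\<ge>0.
           norm_net N L (S t u0) \<le> C * norm_net N L u0 * exp (- \<mu> * t)"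
proof -
  note N = assms(1) and L = assms(3)
  have S0: "C0_contraction_semigroup N L S"
    and iff: "\<And>u v. u \<in> L2_net N L \<Longrightarrow> v \<in> L2_net N L \<Longrightarrow>
      infinitesimal_generator N L S u v \<longleftrightarrow> u \<in> dom_A N \<alpha> L \<and> eq_net N L v (op_A L u)"
    using assms(5) unfolding is_exp_A_def by blast+
  interpret contraction_semigroup "L2_net N L" net_lc "net_ip N L" S
    by (rule exp_A_contraction_semigroup[OF S0])
  obtain M where M: "\<And>u. u \<in> dom_A N \<alpha> L \<Longrightarrow> norm_net N L u \<le> 2 \<Longrightarrow>
    \<exists>t\<in>{0..1}. S t u \<in> dom_A N \<alpha> L \<and> slope_energy N L (S t u) \<le> M"
    using smoothing[OF L N assms(2,5)] by blast
  define K where "K = {u \<in> dom_A N \<alpha> L. slope_energy N L u \<le> M}"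
  note domX = dom_A_D(6)[OF L N]
  have S1_compact
  proof (rule S1_compactI[of K "dom_A N \<alpha> L"])
    show "K \<subseteq> L2_net N L" using domX by (auto simp: K_def)
    show "\<exists>r y. strict_mono r \<and> y \<in> L2_net N L \<and> tends (\<lambda>n. f (r n)) y"
      if f: "\<And>n. f n \<in> K" for f :: "nat \<Rightarrow> netfun"
    proof -
      have fd: "f n \<in> dom_A N \<alpha> L" "slope_energy N L (f n) \<le> M" for n using f[of n] by (auto simp: K_def)
      obtain r y where r: "strict_mono (r :: nat \<Rightarrow> nat)" "y \<in> L2_net N L"
        "(\<lambda>n. norm_net N L (net_lc 1 (f (r n)) (-1) y)) \<longlonglongrightarrow> 0"
        using slope_energy_compact[OF L N fd] .
      have "tends (\<lambda>n. f (r n)) y"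
        unfolding tends_def using r(3) norm_net_nm[OF net_lc_mem[OF domX[OF fd(1)] r(2)]] by simp
      then show ?thesis using r by blast
    qed
    show "u \<in> L2_net N L \<and> (nm u \<le> 2 \<longrightarrow> (\<exists>t\<in>{0..1}. S t u \<in> K))" if u: "u \<in> dom_A N \<alpha> L" for u
      using M[OF u] domX[OF u] by (auto simp: K_def norm_net_nm)
    show "\<exists>v\<in>dom_A N \<alpha> L. nm (net_lc 1 v (- 1) u) < e" if u: "u \<in> L2_net N L" and e: "0 < e" for u e
    proof -
      obtain v where v: "v \<in> dom_A N \<alpha> L" "norm_net N L (net_lc 1 v (-1) u) < e"
        using dom_A_dense[OF L N u e] by blast
      then have "nm (net_lc 1 v (- 1) u) < e"
        using norm_net_nm[OF net_lc_mem[OF domX[OF v(1)] u]] by simp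
      then show ?thesis using v(1) by blast
    qed
  qed
  from decay_or_eigenvector[OF this] show ?thesis
  proof
    assume "\<exists>C>0. \<exists>\<mu>>0. \<forall>u\<in>L2_net N L. \<forall>t\<ge>0. nm (S t u) \<le> C * nm u * exp (- \<mu> * t)"
    then show ?thesis by (simp add: norm_net_nm)
  next
    assume "\<exists>y\<in>L2_net N L. \<exists>l. nm y = 1 \<and> Re l = 0 \<and>
      ((\<lambda>h. nm (net_lc (1 / of_real h) (S h y) (- (1 / of_real h) - l) y)) \<longlongrightarrow> 0) (at_right 0)"
    then obtain y l where y: "y \<in> L2_net N L" "nm y = 1" and l: "Re l = 0"
      and lim: "((\<lambda>h. nm (net_lc (1 / of_real h) (S h y) (- (1 / of_real h) - l) y)) \<longlongrightarrow> 0) (at_right 0)"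
      by blast
    define v where "v = (\<lambda>j x. l * y j x)"
    have v: "v \<in> L2_net N L" using net_lc_mem[OF y(1) y(1), of l 0] by (simp add: net_lc_def v_def)
    have "net_lc (1 / of_real h) (S h y) (- (1 / of_real h) - l) y
        = net_lc 1 (net_lc (1 / of_real h) (S h y) (- (1 / of_real h)) y) (- 1) v" for h
      by (simp add: net_lc_def v_def algebra_simps)
    then have "gen y v" using lim y(1) v by (simp add: gen_def)
    then have "y \<in> dom_A N \<alpha> L" "eq_net N L v (op_A L y)"
      using iff[OF y(1) v] unfolding infinitesimal_generator_gen[OF S0] by auto
    then have "norm_net N L y = 0"
      unfolding v_def by (rule no_imaginary_eigenvector[OF N assms(2) L assms(4) _ _ l])
    then show ?thesis using y by (simp add: norm_net_nm)
  qed
qed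

end
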